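(* Let $\lambda\in P^+$. The crystal structures on $\Sigma_\iota[\lambda]$ and $\mathcal T'(\lambda)$ induce (by transport through the bijections $\varsigma_\lambda:\mathcal{GT}_\lambda\to\Sigma_\iota[\lambda]$ and $\psi_\lambda\circ\varsigma_\lambda:\mathcal{GT}_\lambda\to\mathcal T'(\lambda)$) a crystal structure on $\mathcal{GT}_\lambda$ given as follows. For $g=(y_k^{(i)})\in\mathcal{GT}_\lambda$ and $i\in I$: $$\mathrm{wt}(g)=\sum_{i=1}^{n+1}\sum_{j=1}^{n+2-i}\big(y_j^{(i-1)}-y_j^{(i)}\big)\epsilon_i,\qquad \varepsilon_i(g)=\max_{j\in I}\sigma_j^{(i)}(g),\qquad \varphi_i(g)=\langle\alpha_i^\vee,\mathrm{wt}(g)\rangle+\varepsilon_i(g);$$ $\tilde f_ig$ is the pattern obtained from $g$ by replacing $y_v^{(i)}$ with $y_v^{(i)}+1$, where $v=\min M^{(i)}(g)$, if $\max_{j\in I}\sigma_j^{(i)}(g)>\sigma_0^{(i)}(g)$, and $\tilde f_ig=0$ otherwise; $\tilde e_ig$ is the pattern obtained from $g$ by replacing $y_v^{(i)}$ with $y_v^{(i)}-1$, where $v=\max M^{(i)}(g)$, if $\max_{j\in I}\sigma_j^{(i)}(g)>0$, and $\tilde e_ig=0$ otherwise.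
   Context: Fix $n$, $I=\{1,\dots,n\}$. Let $\epsilon_1,\dots,\epsilon_{n+1}$ be the standard basis of $\mathbb R^{n+1}$, $\alpha_i=\epsilon_i-\epsilon_{i+1}$, $\omega_i=\epsilon_1+\dots+\epsilon_i$, $P=\bigoplus_{i\in I}\mathbb Z\omega_i$ (integer combinations of the $\epsilon_j$ are regarded in $P$ modulo $\epsilon_1+\dots+\epsilon_{n+1}$), $P^+=\bigoplus\mathbb Z_{\ge0}\omega_i$, $\langle\alpha_i^\vee,\epsilon_j\rangle=\delta_{i,j}-\delta_{i+1,j}$. Write $\lambda=\sum_{i=1}^n a_i\omega_i$, $\lambda_i=\sum_{j=i}^n a_j$, $\lambda_{n+1}=0$; identify $\lambda$ with the Young diagram with rows $\lambda_1\ge\dots\ge\lambda_n$. A crystal of type $A_n$ is a set $B$ with maps $\mathrm{wt}:B\to P$, $\tilde e_i,\tilde f_i:B\to B\cup\{0\}$, $\varepsilon_i,\varphi_i:B\to\mathbb Z\cup\{-\infty\}$ ($i\in I$) such that: $\varphi_i(b)=\varepsilon_i(b)+\langle\alpha_i^\vee,\mathrm{wt}(b)\rangle$; if $\tilde e_ib\ne0$ then $\mathrm{wt}(\tilde e_ib)=\mathrm{wt}(b)+\alpha_i$, $\varepsilon_i(\tilde e_ib)=\varepsilon_i(b)-1$, $\varphi_i(\tilde e_ib)=\varphi_i(b)+1$; if $\tilde f_ib\neq0$ then $\mathrm{wt}(\tilde f_ib)=\mathrm{wt}(b)-\alpha_i$, $\varepsilon_i(\tilde f_ib)=\varepsilon_i(b)+1$,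 $\varphi_i(\tilde f_ib)=\varphi_i(b)-1$; $\tilde f_ib=b'$ iff $b=\tilde e_ib'$ for $b,b'\in B$; and $\tilde e_ib=\tilde f_ib=0$ if $\varphi_i(b)=-\infty$. Gelfand–Tsetlin patterns. Put $y_k^{(0)}=\lambda_k$ for $1\le k\le n+1$. $\mathcal{GT}_\lambda$ is the set of arrays $g=(y_k^{(i)})_{1\le i\le n,\,1\le k\le n+1-i}$ of nonnegative integers with $y_k^{(i-1)}\ge y_k^{(i)}\ge y_{k+1}^{(i-1)}$. Entries $y_k^{(i)}$ with $i\ge1$ outside the range $1\le k\le n+1-i$ (in particular $y_0^{(i)}$) are $0$. For $i\in I$, $j\in\{0\}\cup I$: $$\sigma_j^{(i)}(g)=y_j^{(i)}+2\sum_{k=j+1}^{n+1-i}y_k^{(i)}-\sum_{k=j}^{n-i}y_k^{(i+1)}-\sum_{k=j+1}^{n+2-i}y_k^{(i-1)},\qquad M^{(i)}(g)=\{j\in I:\sigma_j^{(i)}(g)=\max_{j'\in I}\sigma_{j'}^{(i)}(g)\}$$ (empty sums are $0$). Polyhedral realization. Consider integer sequences $\overrightarrow{x}=(\dots,x_2,x_1)$ with $x_k=0$ for $k\gg0$; write $x_j^{(i)}=x_{(j-1)n+i}$ for $j\ge1$, $i\in I$, with $x_j^{(0)}=0$, and let $\iota=(\dots,i_2,i_1)$ with $i_{(j-1)n+i}=i$. $\Sigma_\iota[\lambda]$ is the set of $\overrightarrow{x}$ with $x_1^{(i)}\ge x_2^{(i-1)}\ge\dots\ge x_i^{(1)}\ge0$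 for $1\le i\le n$; $x_j^{(i)}=0$ for $i+j>n+1$; and $\lambda_i-\lambda_{i+1}\ge x_j^{(i-j+1)}-x_j^{(i-j)}$ for $1\le j\le i\le n$. Put $\sigma_k(\overrightarrow{x})=x_k+\sum_{j>k}\langle\alpha_{i_k}^\vee,\alpha_{i_j}\rangle x_j$, $\sigma^{(i)}(\overrightarrow{x})=\max_{k:i_k=i}\sigma_k(\overrightarrow{x})$, $M^{(i)}(\overrightarrow{x})=\{k: i_k=i,\ \sigma_k(\overrightarrow{x})=\sigma^{(i)}(\overrightarrow{x})\}$, $\sigma_0^{(i)}(\overrightarrow{x})=-\langle\alpha_i^\vee,\lambda\rangle+\sum_{j\ge1}\langle\alpha_i^\vee,\alpha_{i_j}\rangle x_j$; $\overrightarrow{e_k}$ is the $k$-th unit vector. Crystal structure on $\Sigma_\iota[\lambda]$: $\mathrm{wt}(\overrightarrow{x})=\lambda-\sum_j x_j\alpha_{i_j}$; $\tilde f_i\overrightarrow{x}=\overrightarrow{x}+\overrightarrow{e_k}$, $k=\min M^{(i)}(\overrightarrow{x})$, if $\sigma^{(i)}(\overrightarrow{x})>\sigma_0^{(i)}(\overrightarrow{x})$, and $0$ otherwise; $\tilde e_i\overrightarrow{x}=\overrightarrow{x}-\overrightarrow{e_k}$, $k=\max M^{(i)}(\overrightarrow{x})$, if $\sigma^{(i)}(\overrightarrow{x})\ge\sigma_0^{(i)}(\overrightarrow{x})$ and $\sigma^{(i)}(\overrightarrow{x})>0$, and $0$ otherwise; $\varepsilon_i(\overrightarrow{x})=\max(\sigma^{(i)}(\overrightarrow{x}),\sigma_0^{(i)}(\overrightarrow{x}))$;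 $\varphi_i(\overrightarrow{x})=\langle\alpha_i^\vee,\mathrm{wt}(\overrightarrow{x})\rangle+\varepsilon_i(\overrightarrow{x})$. The bijection $\varsigma_\lambda:\mathcal{GT}_\lambda\to\Sigma_\iota[\lambda]$ sends $g=(y_k^{(i)})$ to $\overrightarrow{x}$ with $x_k^{(i)}=y_k^{(i)}-\lambda_{k+i}$ for $1\le i\le n$, $1\le k\le n+1-i$ (other coordinates $0$). Reverse tableaux. $\mathcal T(\lambda)$ is the set of semistandard Young tableaux of shape $\lambda$ with entries in $\{1,\dots,n+1\}$, with the following crystal structure: read the boxes by columns from right to left, each column from top to bottom; write $+$ for each entry $i$ and $-$ for each entry $i+1$; cancel successively all pairs $(+,-)$ ($+$ before $-$). In the remaining sequence, $\tilde f_i$ changes $i$ to $i+1$ in the box of the leftmost $+$ ($0$ if none), $\tilde e_i$ changes $i+1$ to $i$ in the box of the rightmost $-$ ($0$ if none), $\varepsilon_i,\varphi_i$ are the numbers of remaining $-$'s and $+$'s, and $\mathrm{wt}(T)=\sum_i|T|_i\epsilon_i$ with $|T|_i$ the number of entries $i$. $\mathcal T'(\lambda)$ is the set of reverse semistandard tableaux of shape $\lambda$ (entries in $\{1,\dots,n+1\}$, weakly decreasing along rows, strictly decreasing down columns), $\phi:\mathcal T'(\lambda)\to\mathcal T(\lambda)$ replaces each entry $a$ by $n+2-a$, and the crystal structure on $\mathcal T'(\lambda)$ is $\mathrm{wt}(T)=\sum_i|T|_i\epsilon_i$, $\tilde e_iT=\phi^{-1}(\tilde f_{n+1-i}\phi(T))$,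 $\tilde f_iT=\phi^{-1}(\tilde e_{n+1-i}\phi(T))$, $\varepsilon_i(T)=\varphi_{n+1-i}(\phi(T))$, $\varphi_i(T)=\varepsilon_{n+1-i}(\phi(T))$ (with $\phi^{-1}(0)=0$). The bijection $\psi_\lambda:\Sigma_\iota[\lambda]\to\mathcal T'(\lambda)$ sends $\overrightarrow{x}$ to the tableau in which, for $1\le i\le n+1$, the boxes of $\Lambda_i/\Lambda_{i+1}$ are filled with $i$, where $\Lambda_i=(x_k^{(i-1)}+\lambda_{k+i-1})_{1\le k\le n+2-i}$ and $\Lambda_{n+2}=\emptyset$. *)

theory Defs
  imports Main "HOL-Library.Function_Algebras" "HOL-Library.Extended"
begin

section \<open>Weights\<close>

text \<open>
  An element of the free Z-module P on omega_1, ..., omega_n is represented by its coefficient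
  function, which vanishes outside {1..n}; addition is pointwise.  Consequently pairing with the
  i-th simple coroot is the i-th coefficient, and the image of epsilon_j in P
  (that is, modulo epsilon_1 + ... + epsilon_(n+1)) has i-th coefficient
  delta_(i,j) - delta_(i+1,j).  The lemmas of this section check that this is the
  quotient of the lattice spanned by the epsilon_j, with the usual omega_i.
\<close>

type_synonym weight = "nat \<Rightarrow> int"

definition weight_lattice :: "nat \<Rightarrow> weight set" where
  "weight_lattice n = {\<mu>. \<forall>i. i \<notin> {1..n} \<longrightarrow> \<mu> i = 0}"

definition dominant_weights :: "nat \<Rightarrow> weight set" where
  "dominant_weights n = {\<mu> \<in> weight_lattice n. \<forall>i\<in>{1..n}. 0 \<le> \<mu> i}"

definition coroot_pairing :: "nat \<Rightarrow> weight \<Rightarrow> int" where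
  "coroot_pairing i \<mu> = \<mu> i"

definition wscale :: "int \<Rightarrow> weight \<Rightarrow> weight" where
  "wscale c \<mu> = (\<lambda>i. c * \<mu> i)"

definition eps :: "nat \<Rightarrow> nat \<Rightarrow> weight" where
  "eps n j = (\<lambda>i. if i \<in> {1..n} then of_bool (i = j) - of_bool (i + 1 = j) else 0)"

definition omega :: "nat \<Rightarrow> nat \<Rightarrow> weight" where
  "omega n i = (\<Sum>j = 1..i. eps n j)"

definition alpha :: "nat \<Rightarrow> nat \<Rightarrow> weight" where
  "alpha n i = eps n i - eps n (i + 1)"

lemma sum_weight_apply: "(\<Sum>j\<in>A. f j :: weight) i = (\<Sum>j\<in>A. f j i)"
  by (induction A rule: infinite_finite_induct) auto

lemma omega_apply:
  assumes "i \<in> {1..n}"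
  shows "omega n i = (\<lambda>k. of_bool (k = i))"
proof
  fix k
  show "omega n i k = of_bool (k = i)"
  proof (cases "k \<in> {1..n}")
    case False
    then show ?thesis using assms by (auto simp: omega_def sum_weight_apply eps_def)
  next
    case True
    then have "omega n i k = (\<Sum>j = 1..i. of_bool (k = j)) - (\<Sum>j = 1..i. of_bool (k + 1 = j))"
      by (simp add: omega_def sum_weight_apply eps_def sum_subtractf)
    also have "\<dots> = of_bool (k \<in> {1..i}) - of_bool (k + 1 \<in> {1..i})"
      by (simp add: of_bool_def sum.delta)
    finally show ?thesis using True by auto
  qed
qed

lemma weight_lattice_eq_span:
  "weight_lattice n = {\<mu>. \<exists>a. \<mu> = (\<Sum>i = 1..n. wscale (a i) (omega n i))}"
proof -
  have *: "(\<Sum>i = 1..n. wscale (a i) (omega n i)) = (\<lambda>k. if k \<in> {1..n} then a k else 0)" for a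
  proof
    fix k
    have "(\<Sum>i = 1..n. wscale (a i) (omega n i)) k = (\<Sum>i = 1..n. if k = i then a i else 0)"
      by (auto simp: sum_weight_apply wscale_def omega_apply intro!: sum.cong)
    then show "(\<Sum>i = 1..n. wscale (a i) (omega n i)) k = (if k \<in> {1..n} then a k else 0)"
      by (simp add: sum.delta)
  qed
  show ?thesis unfolding * weight_lattice_def by (auto simp: fun_eq_iff)
qed

lemma sum_eps_eq_0_iff:
  "(\<Sum>j = 1..n + 1. wscale (c j) (eps n j)) = 0 \<longleftrightarrow> (\<exists>d. \<forall>j\<in>{1..n + 1}. c j = d)"
proof -
  have *: "(\<Sum>j = 1..n + 1. wscale (c j) (eps n j)) i
      = (if i \<in> {1..n} then c i - c (i + 1) else 0)" for i
  proof (cases "i \<in> {1..n}")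
    case True
    then have "(\<Sum>j = 1..n + 1. wscale (c j) (eps n j)) i
        = (\<Sum>j = 1..n + 1. (if i = j then c j else 0) - (if i + 1 = j then c j else 0))"
      by (auto simp: sum_weight_apply wscale_def eps_def intro!: sum.cong)
    also have "\<dots> = c i - c (i + 1)"
      using True by (simp only: sum_subtractf sum.delta finite_atLeastAtMost) auto
    finally show ?thesis using True by simp
  qed (auto simp: sum_weight_apply wscale_def eps_def)
  have "(\<Sum>j = 1..n + 1. wscale (c j) (eps n j)) = 0
      \<longleftrightarrow> (\<forall>i. (if i \<in> {1..n} then c i - c (i + 1) else 0) = 0)"
    by (simp only: fun_eq_iff * zero_fun_def)
  also have "\<dots> \<longleftrightarrow> (\<forall>i\<in>{1..n}. c i = c (i + 1))"
    by auto
  also have "\<dots> \<longleftrightarrow> (\<forall>j\<in>{1..n + 1}. c j = c 1)"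
  proof
    assume step: "\<forall>i\<in>{1..n}. c i = c (i + 1)"
    have "Suc k \<le> n + 1 \<longrightarrow> c (Suc k) = c 1" for k
      by (induction k) (use step in auto)
    then show "\<forall>j\<in>{1..n + 1}. c j = c 1"
      by (metis One_nat_def Suc_le_D atLeastAtMost_iff)
  next
    assume const: "\<forall>j\<in>{1..n + 1}. c j = c 1"
    show "\<forall>i\<in>{1..n}. c i = c (i + 1)"
    proof
      fix i assume "i \<in> {1..n}"
      then have "i \<in> {1..n + 1}" "i + 1 \<in> {1..n + 1}" by auto
      then show "c i = c (i + 1)" using const by metis
    qed
  qed
  also have "\<dots> \<longleftrightarrow> (\<exists>d. \<forall>j\<in>{1..n + 1}. c j = d)"
  proof
    assume "\<exists>d. \<forall>j\<in>{1..n + 1}. c j = d"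
    moreover have "1 \<in> {1..n + 1}" by simp
    ultimately show "\<forall>j\<in>{1..n + 1}. c j = c 1" by metis
  qed blast
  finally show ?thesis .
qed

text \<open>The row lengths of the Young diagram of lam = sum of a_i omega_i.\<close>

definition part :: "nat \<Rightarrow> weight \<Rightarrow> nat \<Rightarrow> int" where
  "part n lam i = (\<Sum>j = i..n. lam j)"


section \<open>Crystals\<close>

text \<open>The formal symbol 0 is rendered by None; the value \<^term>\<open>\<infinity> :: int extended\<close> is excluded
  by \<open>is_crystal\<close>.\<close>

record 'b crystal =
  cset :: "'b set"
  cwt :: "'b \<Rightarrow> weight"
  ce :: "nat \<Rightarrow> 'b \<Rightarrow> 'b option"
  cf :: "nat \<Rightarrow> 'b \<Rightarrow> 'b option"
  ceps :: "nat \<Rightarrow> 'b \<Rightarrow> int extended"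
  cphi :: "nat \<Rightarrow> 'b \<Rightarrow> int extended"

definition is_crystal :: "nat \<Rightarrow> 'b crystal \<Rightarrow> bool" where
  "is_crystal n C \<longleftrightarrow>
    (\<forall>b\<in>cset C. cwt C b \<in> weight_lattice n) \<and>
    (\<forall>i\<in>{1..n}. \<forall>b\<in>cset C.
      set_option (ce C i b) \<subseteq> cset C \<and> set_option (cf C i b) \<subseteq> cset C \<and>
      ceps C i b \<noteq> \<infinity> \<and> cphi C i b \<noteq> \<infinity> \<and>
      cphi C i b = ceps C i b + Fin (coroot_pairing i (cwt C b)) \<and>
      (\<forall>b'. ce C i b = Some b' \<longrightarrow>
        cwt C b' = cwt C b + alpha n i \<and>
        ceps C i b' = ceps C i b - Fin 1 \<and> cphi C i b' = cphi C i b + Fin 1) \<and>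
      (\<forall>b'. cf C i b = Some b' \<longrightarrow>
        cwt C b' = cwt C b - alpha n i \<and>
        ceps C i b' = ceps C i b + Fin 1 \<and> cphi C i b' = cphi C i b - Fin 1) \<and>
      (\<forall>b'\<in>cset C. cf C i b = Some b' \<longleftrightarrow> ce C i b' = Some b) \<and>
      (cphi C i b = -\<infinity> \<longrightarrow> ce C i b = None \<and> cf C i b = None))"

definition transport :: "('a \<Rightarrow> 'b) \<Rightarrow> 'a set \<Rightarrow> 'b crystal \<Rightarrow> 'a crystal" where
  "transport h A C =
    \<lparr> cset = A,
      cwt = (\<lambda>a. cwt C (h a)),
      ce = (\<lambda>i a. map_option (inv_into A h) (ce C i (h a))),
      cf = (\<lambda>i a. map_option (inv_into A h) (cf C i (h a))),
      ceps = (\<lambda>i a. ceps C i (h a)),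
      cphi = (\<lambda>i a. cphi C i (h a)) \<rparr>"


section \<open>Gelfand--Tsetlin patterns\<close>

text \<open>A pattern is a function g with g i k the entry of row i at position k for i > 0; the
  row with index 0, which is given by lam, is not part of the array and is supplied by
  \<open>gt_entry\<close>.\<close>

type_synonym gt_pattern = "nat \<Rightarrow> nat \<Rightarrow> int"

definition gt_entry :: "nat \<Rightarrow> weight \<Rightarrow> gt_pattern \<Rightarrow> nat \<Rightarrow> nat \<Rightarrow> int" where
  "gt_entry n lam g i k = (if i = 0 then part n lam k else g i k)"

definition GT :: "nat \<Rightarrow> weight \<Rightarrow> gt_pattern set" where
  "GT n lam = {g.
    (\<forall>i k. \<not> (1 \<le> i \<and> i \<le> n \<and> 1 \<le> k \<and> k \<le> n + 1 - i) \<longrightarrow> g i k = 0) \<and>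
    (\<forall>i\<in>{1..n}. \<forall>k\<in>{1..n + 1 - i}.
      0 \<le> g i k \<and>
      gt_entry n lam g (i - 1) k \<ge> gt_entry n lam g i k \<and>
      gt_entry n lam g i k \<ge> gt_entry n lam g (i - 1) (k + 1))}"

definition gt_sigma :: "nat \<Rightarrow> weight \<Rightarrow> gt_pattern \<Rightarrow> nat \<Rightarrow> nat \<Rightarrow> int" where
  "gt_sigma n lam g i j =
    gt_entry n lam g i j
    + 2 * (\<Sum>k = j + 1..n + 1 - i. gt_entry n lam g i k)
    - (\<Sum>k = j..n - i. gt_entry n lam g (i + 1) k)
    - (\<Sum>k = j + 1..n + 2 - i. gt_entry n lam g (i - 1) k)"

definition gt_max :: "nat \<Rightarrow> weight \<Rightarrow> gt_pattern \<Rightarrow> nat \<Rightarrow> int" where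
  "gt_max n lam g i = Max (gt_sigma n lam g i ` {1..n})"

definition gt_M :: "nat \<Rightarrow> weight \<Rightarrow> gt_pattern \<Rightarrow> nat \<Rightarrow> nat set" where
  "gt_M n lam g i = {j\<in>{1..n}. gt_sigma n lam g i j = gt_max n lam g i}"

definition gt_add :: "gt_pattern \<Rightarrow> nat \<Rightarrow> nat \<Rightarrow> int \<Rightarrow> gt_pattern" where
  "gt_add g i v d = g(i := (g i)(v := g i v + d))"


section \<open>Polyhedral realization\<close>

text \<open>A sequence (..., x_2, x_1) is a function on the natural numbers whose value at the
  unused index 0 is fixed to be 0.\<close>

type_synonym zseq = "nat \<Rightarrow> int"

definition xc :: "nat \<Rightarrow> zseq \<Rightarrow> nat \<Rightarrow> nat \<Rightarrow> int" where
  "xc n x j i = (if i = 0 then 0 else x ((j - 1) * n + i))"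

definition iota :: "nat \<Rightarrow> nat \<Rightarrow> nat" where
  "iota n k = (k - 1) mod n + 1"

definition Sigma_set :: "nat \<Rightarrow> weight \<Rightarrow> zseq set" where
  "Sigma_set n lam = {x.
    x 0 = 0 \<and> (\<exists>K. \<forall>k>K. x k = 0) \<and>
    (\<forall>i\<in>{1..n}.
      (\<forall>j. 1 \<le> j \<and> j < i \<longrightarrow> xc n x j (i - j + 1) \<ge> xc n x (j + 1) (i - j)) \<and>
      xc n x i 1 \<ge> 0) \<and>
    (\<forall>i\<in>{1..n}. \<forall>j\<ge>1. i + j > n + 1 \<longrightarrow> xc n x j i = 0) \<and>
    (\<forall>i\<in>{1..n}. \<forall>j\<in>{1..i}.
      part n lam i - part n lam (i + 1) \<ge> xc n x j (i - j + 1) - xc n x j (i - j))}"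

text \<open>Sums over infinitely many indices are restricted to the (finite) support of x.\<close>

definition seq_sigma :: "nat \<Rightarrow> zseq \<Rightarrow> nat \<Rightarrow> int" where
  "seq_sigma n x k =
    x k + (\<Sum>j | j > k \<and> x j \<noteq> 0. coroot_pairing (iota n k) (alpha n (iota n j)) * x j)"

definition seq_sigma0 :: "nat \<Rightarrow> weight \<Rightarrow> zseq \<Rightarrow> nat \<Rightarrow> int" where
  "seq_sigma0 n lam x i =
    - coroot_pairing i lam
    + (\<Sum>j | j \<ge> 1 \<and> x j \<noteq> 0. coroot_pairing i (alpha n (iota n j)) * x j)"

text \<open>For x of finite support only finitely many values occur here, because
  \<open>seq_sigma n x k = 0\<close> for large k.\<close>

definition seq_max :: "nat \<Rightarrow> zseq \<Rightarrow> nat \<Rightarrow> int" where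
  "seq_max n x i = Max (seq_sigma n x ` {k. k \<ge> 1 \<and> iota n k = i})"

definition seq_M :: "nat \<Rightarrow> zseq \<Rightarrow> nat \<Rightarrow> nat set" where
  "seq_M n x i = {k. k \<ge> 1 \<and> iota n k = i \<and> seq_sigma n x k = seq_max n x i}"

text \<open>\<open>seq_M n x i\<close> is infinite if \<open>seq_max n x i = 0\<close>, hence the minimum is
  taken with LEAST; its maximum is only used when \<open>seq_max n x i > 0\<close>, in which case the
  set is finite.\<close>

definition Sigma_wt :: "nat \<Rightarrow> weight \<Rightarrow> zseq \<Rightarrow> weight" where
  "Sigma_wt n lam x = lam - (\<Sum>j | j \<ge> 1 \<and> x j \<noteq> 0. wscale (x j) (alpha n (iota n j)))"

definition Sigma_crystal :: "nat \<Rightarrow> weight \<Rightarrow> zseq crystal" where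
  "Sigma_crystal n lam =
    \<lparr> cset = Sigma_set n lam,
      cwt = Sigma_wt n lam,
      ce = (\<lambda>i x.
        if seq_max n x i \<ge> seq_sigma0 n lam x i \<and> seq_max n x i > 0
        then Some (let k = Max (seq_M n x i) in x(k := x k - 1))
        else None),
      cf = (\<lambda>i x.
        if seq_max n x i > seq_sigma0 n lam x i
        then Some (let k = (LEAST k. k \<in> seq_M n x i) in x(k := x k + 1))
        else None),
      ceps = (\<lambda>i x. Fin (max (seq_max n x i) (seq_sigma0 n lam x i))),
      cphi = (\<lambda>i x. Fin (coroot_pairing i (Sigma_wt n lam x)
                        + max (seq_max n x i) (seq_sigma0 n lam x i))) \<rparr>"

text \<open>The coordinate \<open>x_k^(i)\<close> of the image sits at index m = (k - 1) * n + i.\<close>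

definition varsigma :: "nat \<Rightarrow> weight \<Rightarrow> gt_pattern \<Rightarrow> zseq" where
  "varsigma n lam g = (\<lambda>m.
    if m = 0 then 0
    else let i = iota n m; k = (m - 1) div n + 1
         in if k \<le> n + 1 - i then g i k - part n lam (k + i) else 0)"


section \<open>Tableaux\<close>

text \<open>Boxes are pairs (row, column), counted from 1 (top left).  A filling of the diagram is
  extended by 0 outside of it.\<close>

type_synonym tableau = "nat \<times> nat \<Rightarrow> nat"

definition boxes :: "nat \<Rightarrow> weight \<Rightarrow> (nat \<times> nat) set" where
  "boxes n lam = {(r, c). 1 \<le> r \<and> r \<le> n \<and> 1 \<le> c \<and> int c \<le> part n lam r}"

definition fillings :: "nat \<Rightarrow> weight \<Rightarrow> tableau set" where
  "fillings n lam = {T. (\<forall>b\<in>boxes n lam. T b \<in> {1..n + 1}) \<and> (\<forall>b. b \<notin> boxes n lam \<longrightarrow> T b = 0)}"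

definition SSYT :: "nat \<Rightarrow> weight \<Rightarrow> tableau set" where
  "SSYT n lam = {T \<in> fillings n lam.
    (\<forall>r c. (r, c) \<in> boxes n lam \<and> (r, c + 1) \<in> boxes n lam \<longrightarrow> T (r, c) \<le> T (r, c + 1)) \<and>
    (\<forall>r c. (r, c) \<in> boxes n lam \<and> (r + 1, c) \<in> boxes n lam \<longrightarrow> T (r, c) < T (r + 1, c))}"

definition RSSYT :: "nat \<Rightarrow> weight \<Rightarrow> tableau set" where
  "RSSYT n lam = {T \<in> fillings n lam.
    (\<forall>r c. (r, c) \<in> boxes n lam \<and> (r, c + 1) \<in> boxes n lam \<longrightarrow> T (r, c) \<ge> T (r, c + 1)) \<and>
    (\<forall>r c. (r, c) \<in> boxes n lam \<and> (r + 1, c) \<in> boxes n lam \<longrightarrow> T (r, c) > T (r + 1, c))}"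

definition tab_wt :: "nat \<Rightarrow> weight \<Rightarrow> tableau \<Rightarrow> weight" where
  "tab_wt n lam T =
    (\<Sum>i = 1..n + 1. wscale (int (card {b \<in> boxes n lam. T b = i})) (eps n i))"

definition reading :: "nat \<Rightarrow> weight \<Rightarrow> (nat \<times> nat) list" where
  "reading n lam =
    concat (map (\<lambda>c. filter (\<lambda>b. b \<in> boxes n lam) (map (\<lambda>r. (r, c)) [1..<n + 1]))
                (rev [1..<nat (part n lam 1) + 1]))"

datatype bracket = Plus | Minus

text \<open>The signature remembers the box from which each sign comes.\<close>

definition signature :: "nat \<Rightarrow> weight \<Rightarrow> nat \<Rightarrow> tableau \<Rightarrow> ((nat \<times> nat) \<times> bracket) list" where
  "signature n lam i T =
    map (\<lambda>b. (b, if T b = i then Plus else Minus))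
        (filter (\<lambda>b. T b = i \<or> T b = i + 1) (reading n lam))"

fun cancel_cons :: "'a \<times> bracket \<Rightarrow> ('a \<times> bracket) list \<Rightarrow> ('a \<times> bracket) list" where
  "cancel_cons (b, Plus) ((b', Minus) # w) = w"
| "cancel_cons p w = p # w"

definition cancel :: "('a \<times> bracket) list \<Rightarrow> ('a \<times> bracket) list" where
  "cancel w = foldr cancel_cons w []"

text \<open>\<open>cancel w\<close> is the unique sequence obtained from w by deleting adjacent pairs (+, -) until
  none is left, see \<open>cancel_unique\<close>.\<close>

inductive cancel_step :: "('a \<times> bracket) list \<Rightarrow> ('a \<times> bracket) list \<Rightarrow> bool" where
  "cancel_step (u @ (b, Plus) # (b', Minus) # w) (u @ w)"

lemma cancel_Nil [simp]: "cancel [] = []"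
  by (simp add: cancel_def)

lemma cancel_Cons [simp]: "cancel (p # w) = cancel_cons p (cancel w)"
  by (simp add: cancel_def)

lemma cancel_step_Cons: "cancel_step v w \<Longrightarrow> cancel_step (p # v) (p # w)"
  by (erule cancel_step.cases) (metis append_Cons cancel_step.intros)

lemma cancel_reachable: "cancel_step\<^sup>*\<^sup>* w (cancel w)"
proof (induction w)
  case (Cons p w)
  have "cancel_step\<^sup>*\<^sup>* (p # w) (p # cancel w)"
    using Cons by (induction rule: rtranclp_induct)
      (auto intro: rtranclp.rtrancl_into_rtrancl cancel_step_Cons)
  moreover have "cancel_step\<^sup>*\<^sup>* (p # cancel w) (cancel_cons p (cancel w))"
    by (cases "(p, cancel w)" rule: cancel_cons.cases)
      (auto intro: cancel_step.intros[of "[]", simplified])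
  ultimately show ?case by simp
qed simp

lemma cancel_step_ConsD:
  assumes "cancel_step (p # w) v"
  shows "(\<exists>b b' w'. p = (b, Plus) \<and> w = (b', Minus) # w') \<or> (\<exists>v'. cancel_step w v')"
  using assms
proof cases
  case (1 u b b' z)
  then show ?thesis by (cases u) (auto intro: cancel_step.intros)
qed

lemma cancel_cons_normal:
  assumes "\<nexists>v. cancel_step w v" shows "\<nexists>v. cancel_step (cancel_cons p w) v"
  using assms
proof (cases "(p, w)" rule: cancel_cons.cases)
  case (1 b b' w')
  then show ?thesis using assms by (auto dest: cancel_step_Cons)
next
  case ("2_1" b w')
  then show ?thesis using assms
    by (metis cancel_cons.simps(2) cancel_step_ConsD bracket.distinct(1) prod.inject)
next
  case ("2_2" v)
  then show ?thesis by (auto dest!: cancel_step_ConsD elim: cancel_step.cases)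
next
  case ("2_3" b b' w')
  then show ?thesis using assms
    by (metis Pair_inject bracket.distinct(1) cancel_cons.simps(4) cancel_step_ConsD list.inject)
qed

lemma cancel_unique:
  "cancel_step\<^sup>*\<^sup>* w v \<and> (\<nexists>v'. cancel_step v v') \<longleftrightarrow> v = cancel w"
proof -
  have step: "cancel w = cancel v" if "cancel_step w v" for w v :: "('a \<times> bracket) list"
    using that
  proof cases
    case (1 u b b' z)
    have "cancel ((b, Plus) # (b', Minus) # z) = cancel z"
      by simp
    then show ?thesis unfolding 1 cancel_def by simp
  qed
  have steps: "cancel w = cancel v" if "cancel_step\<^sup>*\<^sup>* w v" for w v :: "('a \<times> bracket) list"
    using that by (induction) (auto dest: step)
  have normal: "cancel v = v" if "\<nexists>v'. cancel_step v v'" for v :: "('a \<times> bracket) list"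
    using cancel_reachable[of v] that by (metis converse_rtranclpE)
  have "\<nexists>v'. cancel_step (cancel w) v'"
  proof (induction w)
    case Nil
    then show ?case by (auto elim: cancel_step.cases)
  next
    case (Cons p w)
    then show ?case by (simp only: cancel_Cons cancel_cons_normal not_False_eq_True)
  qed
  then show ?thesis using cancel_reachable steps normal by metis
qed

definition pluses :: "nat \<Rightarrow> weight \<Rightarrow> nat \<Rightarrow> tableau \<Rightarrow> (nat \<times> nat) list" where
  "pluses n lam i T = map fst (filter (\<lambda>p. snd p = Plus) (cancel (signature n lam i T)))"

definition minuses :: "nat \<Rightarrow> weight \<Rightarrow> nat \<Rightarrow> tableau \<Rightarrow> (nat \<times> nat) list" where
  "minuses n lam i T = map fst (filter (\<lambda>p. snd p = Minus) (cancel (signature n lam i T)))"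

definition SSYT_crystal :: "nat \<Rightarrow> weight \<Rightarrow> tableau crystal" where
  "SSYT_crystal n lam =
    \<lparr> cset = SSYT n lam,
      cwt = tab_wt n lam,
      ce = (\<lambda>i T. if minuses n lam i T = [] then None
                  else Some (T(last (minuses n lam i T) := i))),
      cf = (\<lambda>i T. if pluses n lam i T = [] then None
                  else Some (T(hd (pluses n lam i T) := i + 1))),
      ceps = (\<lambda>i T. Fin (int (length (minuses n lam i T)))),
      cphi = (\<lambda>i T. Fin (int (length (pluses n lam i T)))) \<rparr>"

definition flip :: "nat \<Rightarrow> weight \<Rightarrow> tableau \<Rightarrow> tableau" where
  "flip n lam T = (\<lambda>b. if b \<in> boxes n lam then n + 2 - T b else 0)"

definition RSSYT_crystal :: "nat \<Rightarrow> weight \<Rightarrow> tableau crystal" where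
  "RSSYT_crystal n lam =
    \<lparr> cset = RSSYT n lam,
      cwt = tab_wt n lam,
      ce = (\<lambda>i T. map_option (inv_into (RSSYT n lam) (flip n lam))
                    (cf (SSYT_crystal n lam) (n + 1 - i) (flip n lam T))),
      cf = (\<lambda>i T. map_option (inv_into (RSSYT n lam) (flip n lam))
                    (ce (SSYT_crystal n lam) (n + 1 - i) (flip n lam T))),
      ceps = (\<lambda>i T. cphi (SSYT_crystal n lam) (n + 1 - i) (flip n lam T)),
      cphi = (\<lambda>i T. ceps (SSYT_crystal n lam) (n + 1 - i) (flip n lam T)) \<rparr>"

text \<open>The k-th row length of the diagram \<open>\<Lambda>\<^sub>i\<close>; it is 0 for all k if i = n + 2.\<close>

definition psi_row :: "nat \<Rightarrow> weight \<Rightarrow> zseq \<Rightarrow> nat \<Rightarrow> nat \<Rightarrow> int" where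
  "psi_row n lam x i k =
    (if 1 \<le> k \<and> k \<le> n + 2 - i then xc n x k (i - 1) + part n lam (k + i - 1) else 0)"

definition psi :: "nat \<Rightarrow> weight \<Rightarrow> zseq \<Rightarrow> tableau" where
  "psi n lam x = (\<lambda>(r, c).
    if (r, c) \<in> boxes n lam
    then (THE i. i \<in> {1..n + 1} \<and> psi_row n lam x (i + 1) r < int c \<and> int c \<le> psi_row n lam x i r)
    else 0)"

end

theory Submission
  imports Defs "HOL-Library.Sublist"
begin

text \<open>
  Write \<open>Y i k\<close> for the entry at position \<open>k\<close> of row \<open>i\<close> of a pattern, with row 0 given by
  \<open>lam\<close>, and \<open>\<sigma> j\<close> for \<open>gt_sigma n lam g i j\<close>.  The proof first shows that the formulas of the
  theorem define a crystal \<open>GT_crystal\<close> on the patterns, and then that the two bijections carry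
  this crystal to the polyhedral one and to the one on reverse tableaux.  Transporting a structure
  back along such an isomorphism, or pushing the axioms forward, is a formality (\<open>is_crystal_iso\<close>,
  \<open>transport_iso\<close>), so that neither of the two given structures has to be checked
  against the crystal axioms directly.

  Everything rests on the recursion (\<open>gt_sigma_rec\<close>)
  \<open>\<sigma> j = \<sigma> (j + 1) + (Y i j - Y (i + 1) j) - (Y (i - 1) (j + 1) - Y i (j + 1))\<close>
  with \<open>\<sigma> (n + 1) = 0\<close>.  A strict descent of \<open>\<sigma>\<close> next to a maximum is therefore a strict
  inequality between neighbouring entries of the pattern, and this is exactly the room that is
  needed to change \<open>Y i v\<close> by one at the first or last maximum \<open>v\<close>.  Changing \<open>Y i v\<close> by \<open>d\<close> adds
  \<open>2 * d\<close>, \<open>d\<close> or 0 to \<open>\<sigma> j\<close> for \<open>j < v\<close>, \<open>j = v\<close> and \<open>j > v\<close>; hence raising at the first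
  maximum makes \<open>v\<close> the last one, and vice versa, so the two operators are mutually inverse.

  For the polyhedral realization, moving by \<open>n\<close> positions in the sequence changes
  \<open>seq_sigma\<close> by a window of the Cartan matrix, which gives the same recursion
  (\<open>seq_sigma_rec\<close>); the shifts by row lengths of \<open>lam\<close> cancel.  So \<open>seq_sigma\<close> at the
  \<open>j\<close>-th coordinate of colour \<open>i\<close> is \<open>\<sigma> j\<close>, and the number \<open>seq_sigma0\<close> is \<open>\<sigma> 0\<close>
  (\<open>seq_sigma_eq_gt_sigma\<close>, \<open>seq_sigma0_eq_gt_sigma\<close>).

  For tableaux, a box \<open>(r, c)\<close> contains an entry larger than \<open>i\<close> iff \<open>c \<le> Y i r\<close>.  The relevant
  signature thus has a minus for every box of row \<open>r\<close> with \<open>Y i r < c \<le> Y (i - 1) r\<close> and a plus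
  for every box with \<open>Y (i + 1) r < c \<le> Y i r\<close>.  In a bracket word the number of surviving
  pluses is the maximum over all suffixes of the number of pluses minus the number of minuses, and
  the first surviving plus opens the shortest suffix at which this maximum is attained, while the
  last surviving minus immediately precedes the longest one
  (\<open>length_unpaired_Plus\<close>, \<open>hd_unpaired_Plus\<close>, \<open>last_unpaired_Minus\<close>).  By interlacing, between
  the columns \<open>Y i (k + 1)\<close> and \<open>Y i k\<close> only the rows \<open>k\<close> and \<open>k + 1\<close> contribute, and there the
  suffix balance is a convex function of the column whose values at the two ends are
  \<open>\<sigma> (k + 1)\<close> and \<open>\<sigma> k\<close> (\<open>balance_word\<close>).  So the maximal suffix balance is the maximum of
  \<open>\<sigma>\<close>, and the brackets that the operators change lie in the row of the first or last maximum.
\<close>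

section \<open>Isomorphisms of crystals\<close>

definition crystal_iso :: "nat \<Rightarrow> ('a \<Rightarrow> 'b) \<Rightarrow> 'a crystal \<Rightarrow> 'b crystal \<Rightarrow> bool" where
  "crystal_iso n h G C \<longleftrightarrow>
    bij_betw h (cset G) (cset C) \<and>
    (\<forall>g\<in>cset G. cwt C (h g) = cwt G g \<and>
      (\<forall>i\<in>{1..n}.
        ceps C i (h g) = ceps G i g \<and> cphi C i (h g) = cphi G i g \<and>
        ce C i (h g) = map_option h (ce G i g) \<and> cf C i (h g) = map_option h (cf G i g)))"

lemma crystal_opD:
  assumes "is_crystal n G" "i \<in> {1..n}" "g \<in> cset G"
  shows "ce G i g = Some g' \<Longrightarrow> g' \<in> cset G" and "cf G i g = Some g' \<Longrightarrow> g' \<in> cset G"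
proof -
  have "set_option (ce G i g) \<subseteq> cset G \<and> set_option (cf G i g) \<subseteq> cset G"
    using assms unfolding is_crystal_def by blast
  then show "ce G i g = Some g' \<Longrightarrow> g' \<in> cset G" and "cf G i g = Some g' \<Longrightarrow> g' \<in> cset G"
    by auto
qed

text \<open>
  An operator of \<open>C\<close> never leaves the image of \<open>h\<close>, because it is the image of an operator of
  \<open>G\<close>; therefore \<open>inv_into\<close> really undoes \<open>h\<close> in the definition of \<open>transport\<close>.
\<close>

lemma transport_iso:
  assumes C: "is_crystal n G" and iso: "crystal_iso n h G C"
    and g: "g \<in> cset G" and i: "i \<in> {1..n}"
  shows "ce (transport h (cset G) C) i g = ce G i g"
    and "cf (transport h (cset G) C) i g = cf G i g"
    and "ceps (transport h (cset G) C) i g = ceps G i g"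
    and "cphi (transport h (cset G) C) i g = cphi G i g"
proof -
  have inj: "inj_on h (cset G)"
    using iso by (simp add: crystal_iso_def bij_betw_def)
  have inv: "map_option (inv_into (cset G) h) (map_option h p) = p"
    if "\<And>g'. p = Some g' \<Longrightarrow> g' \<in> cset G" for p
    using that inj by (cases p) auto
  show "ce (transport h (cset G) C) i g = ce G i g"
    and "cf (transport h (cset G) C) i g = cf G i g"
    using iso g i inv[of "ce G i g"] inv[of "cf G i g"] crystal_opD[OF C i g]
    by (simp_all add: transport_def crystal_iso_def)
  show "ceps (transport h (cset G) C) i g = ceps G i g"
    and "cphi (transport h (cset G) C) i g = cphi G i g"
    using iso g i by (simp_all add: transport_def crystal_iso_def)
qed

text \<open>
  Each axiom at \<open>h g\<close> is the image of the axiom at \<open>g\<close>.  Injectivity of \<open>h\<close> is needed for the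
  equivalence of \<open>cf C i b = Some b'\<close> and \<open>ce C i b' = Some b\<close>.
\<close>

lemma is_crystal_iso:
  assumes C: "is_crystal n G" and iso: "crystal_iso n h G C"
  shows "is_crystal n C"
proof -
  have cset: "cset C = h ` cset G" and inj: "inj_on h (cset G)"
    using iso by (auto simp: crystal_iso_def bij_betw_def)
  note op = crystal_opD[OF C]
  have wt: "cwt C (h g) = cwt G g" if "g \<in> cset G" for g
    using iso that by (auto simp: crystal_iso_def)
  have ops: "ceps C i (h g) = ceps G i g" "cphi C i (h g) = cphi G i g"
    "ce C i (h g) = map_option h (ce G i g)" "cf C i (h g) = map_option h (cf G i g)"
    if "g \<in> cset G" "i \<in> {1..n}" for i g
    using iso that by (auto simp: crystal_iso_def)
  have Some_iff: "map_option h p = Some (h g) \<longleftrightarrow> p = Some g"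
    if "\<And>g'. p = Some g' \<Longrightarrow> g' \<in> cset G" "g \<in> cset G" for p g
    using that inj by (cases p) (auto dest: inj_onD)
  show ?thesis
    unfolding is_crystal_def[of n C]
  proof (rule conjI; intro ballI)
    fix b assume "b \<in> cset C"
    then obtain g where g: "b = h g" "g \<in> cset G" by (auto simp: cset)
    then show "cwt C b \<in> weight_lattice n"
      using C wt by (simp add: is_crystal_def)
  next
    fix i b assume i: "i \<in> {1..n}" and "b \<in> cset C"
    then obtain g where b: "b = h g" and g: "g \<in> cset G" by (auto simp: cset)
    have ax: "set_option (ce G i g) \<subseteq> cset G" "set_option (cf G i g) \<subseteq> cset G"
      "ceps G i g \<noteq> \<infinity>" "cphi G i g \<noteq> \<infinity>"
      "cphi G i g = ceps G i g + Fin (coroot_pairing i (cwt G g))"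
      "cphi G i g = -\<infinity> \<longrightarrow> ce G i g = None \<and> cf G i g = None"
      "\<forall>g'. ce G i g = Some g' \<longrightarrow> cwt G g' = cwt G g + alpha n i \<and>
        ceps G i g' = ceps G i g - Fin 1 \<and> cphi G i g' = cphi G i g + Fin 1"
      "\<forall>g'. cf G i g = Some g' \<longrightarrow> cwt G g' = cwt G g - alpha n i \<and>
        ceps G i g' = ceps G i g + Fin 1 \<and> cphi G i g' = cphi G i g - Fin 1"
      "\<forall>g'\<in>cset G. cf G i g = Some g' \<longleftrightarrow> ce G i g' = Some g"
      using C i g unfolding is_crystal_def by blast+
    have e: "cwt C b' = cwt C b + alpha n i \<and>
        ceps C i b' = ceps C i b - Fin 1 \<and> cphi C i b' = cphi C i b + Fin 1"
      if e: "ce C i b = Some b'" for b'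
    proof -
      obtain g' where g': "ce G i g = Some g'" "b' = h g'"
        using e ops(3)[OF g i] b by auto
      then have "g' \<in> cset G" using op(1)[OF i g] by blast
      then show ?thesis using g' ax(7) wt ops i g b by simp
    qed
    have f: "cwt C b' = cwt C b - alpha n i \<and>
        ceps C i b' = ceps C i b + Fin 1 \<and> cphi C i b' = cphi C i b - Fin 1"
      if f: "cf C i b = Some b'" for b'
    proof -
      obtain g' where g': "cf G i g = Some g'" "b' = h g'"
        using f ops(4)[OF g i] b by auto
      then have "g' \<in> cset G" using op(2)[OF i g] by blast
      then show ?thesis using g' ax(8) wt ops i g b by simp
    qed
    have fe: "cf C i b = Some b' \<longleftrightarrow> ce C i b' = Some b" if b': "b' \<in> cset C" for b'
    proof -
      obtain g' where g': "b' = h g'" "g' \<in> cset G" using b' by (auto simp: cset)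
      have "cf C i b = Some b' \<longleftrightarrow> cf G i g = Some g'"
        unfolding b g'(1) ops(4)[OF g i] using op(2)[OF i g] g' by (intro Some_iff)
      moreover have "ce C i b' = Some b \<longleftrightarrow> ce G i g' = Some g"
        unfolding b g'(1) ops(3)[OF g'(2) i] using op(1)[OF i g'(2)] g by (intro Some_iff)
      ultimately show ?thesis using ax(9) g' by simp
    qed
    have "set_option (ce C i b) \<subseteq> cset C" "set_option (cf C i b) \<subseteq> cset C"
      using ax(1,2) ops[OF g i] b cset by (auto simp: option.set_map)
    moreover have "cphi C i b = ceps C i b + Fin (coroot_pairing i (cwt C b))"
      "ceps C i b \<noteq> \<infinity>" "cphi C i b \<noteq> \<infinity>"
      "cphi C i b = -\<infinity> \<longrightarrow> ce C i b = None \<and> cf C i b = None"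
      using ax(3-6) ops[OF g i] wt[OF g] b by auto
    ultimately show "set_option (ce C i b) \<subseteq> cset C \<and> set_option (cf C i b) \<subseteq> cset C \<and>
      ceps C i b \<noteq> \<infinity> \<and> cphi C i b \<noteq> \<infinity> \<and>
      cphi C i b = ceps C i b + Fin (coroot_pairing i (cwt C b)) \<and>
      (\<forall>b'. ce C i b = Some b' \<longrightarrow> cwt C b' = cwt C b + alpha n i \<and>
        ceps C i b' = ceps C i b - Fin 1 \<and> cphi C i b' = cphi C i b + Fin 1) \<and>
      (\<forall>b'. cf C i b = Some b' \<longrightarrow> cwt C b' = cwt C b - alpha n i \<and>
        ceps C i b' = ceps C i b + Fin 1 \<and> cphi C i b' = cphi C i b - Fin 1) \<and>
      (\<forall>b'\<in>cset C. cf C i b = Some b' \<longleftrightarrow> ce C i b' = Some b) \<and>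
      (cphi C i b = -\<infinity> \<longrightarrow> ce C i b = None \<and> cf C i b = None)"
      using e f fe by blast
  qed
qed

lemma transport_wt:
  assumes "crystal_iso n h G C" and "g \<in> cset G"
  shows "cwt (transport h (cset G) C) g = cwt G g"
  using assms by (simp add: transport_def crystal_iso_def)

text \<open>
  The identity is an isomorphism from \<open>G\<close> to the transported crystal.  The two need not be equal
  as records, since they may differ outside of the carrier.
\<close>

lemma is_crystal_transport:
  assumes "is_crystal n G" and "crystal_iso n h G C"
  shows "is_crystal n (transport h (cset G) C)"
proof (rule is_crystal_iso[OF assms(1)])
  show "crystal_iso n id G (transport h (cset G) C)"
    unfolding crystal_iso_def
  proof (intro conjI ballI)
    show "bij_betw id (cset G) (cset (transport h (cset G) C))"
      by (simp add: transport_def)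
  qed (simp_all add: transport_iso[OF assms] transport_wt[OF assms(2)] option.map_id)
qed

section \<open>Cancellation of brackets and suffix sums\<close>

fun bracket_sign :: "bracket \<Rightarrow> int" where
  "bracket_sign Plus = 1" | "bracket_sign Minus = -1"

definition balance :: "('a \<times> bracket) list \<Rightarrow> int" where
  "balance w = (\<Sum>p\<leftarrow>w. bracket_sign (snd p))"

definition unpaired :: "bracket \<Rightarrow> ('a \<times> bracket) list \<Rightarrow> 'a list" where
  "unpaired s w = map fst (filter (\<lambda>p. snd p = s) (cancel w))"

lemma balance_simps [simp]:
  "balance [] = 0" "balance ((b, s) # w) = bracket_sign s + balance w"
  "balance (v @ w) = balance v + balance w"
  by (simp_all add: balance_def)

text \<open>
  A reduced word has no plus before a minus.  This makes \<open>cancel\<close> computable from the two lists of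
  survivors alone, as in the recursion equations below.
\<close>

lemma cancel_normal_form:
  "cancel w = map (\<lambda>b. (b, Minus)) (unpaired Minus w) @ map (\<lambda>b. (b, Plus)) (unpaired Plus w)"
proof -
  have "\<exists>ms ps. cancel w = map (\<lambda>b. (b, Minus)) ms @ map (\<lambda>b. (b, Plus)) ps"
  proof (induction w)
    case (Cons p w)
    then obtain ms ps where w: "cancel w = map (\<lambda>b. (b, Minus)) ms @ map (\<lambda>b. (b, Plus)) ps"
      by blast
    obtain b s where p: "p = (b, s)" by force
    show ?case
    proof (cases s)
      case Minus
      then have "cancel (p # w) = map (\<lambda>b. (b, Minus)) (b # ms) @ map (\<lambda>b. (b, Plus)) ps"
        by (simp add: w p)
      then show ?thesis by blast
    next
      case Plus
      have "cancel (p # w) = (if ms = []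
          then map (\<lambda>b. (b, Minus)) [] @ map (\<lambda>b. (b, Plus)) (b # ps)
          else map (\<lambda>b. (b, Minus)) (tl ms) @ map (\<lambda>b. (b, Plus)) ps)"
        using Plus by (cases ms; cases ps) (simp_all add: w p)
      then show ?thesis by metis
    qed
  qed simp
  then show ?thesis
    by (auto simp: unpaired_def filter_map o_def)
qed

lemma unpaired_Nil [simp]: "unpaired s [] = []"
  by (simp add: unpaired_def)

lemma unpaired_Minus [simp]:
  "unpaired Minus ((b, Minus) # w) = b # unpaired Minus w"
  "unpaired Plus ((b, Minus) # w) = unpaired Plus w"
  by (simp_all add: unpaired_def)

lemma unpaired_Plus [simp]:
  "unpaired Minus ((b, Plus) # w) = tl (unpaired Minus w)"
  "unpaired Plus ((b, Plus) # w)
    = (if unpaired Minus w = [] then b # unpaired Plus w else unpaired Plus w)"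
proof -
  define ms ps where m: "ms = unpaired Minus w" "ps = unpaired Plus w"
  have "cancel w = map (\<lambda>b. (b, Minus)) ms @ map (\<lambda>b. (b, Plus)) ps"
    unfolding m by (rule cancel_normal_form)
  then have "unpaired Minus ((b, Plus) # w) = tl ms \<and>
    unpaired Plus ((b, Plus) # w) = (if ms = [] then b # ps else ps)"
    by (cases ms; cases ps) (simp_all add: unpaired_def filter_map o_def)
  then show "unpaired Minus ((b, Plus) # w) = tl (unpaired Minus w)"
    "unpaired Plus ((b, Plus) # w)
      = (if unpaired Minus w = [] then b # unpaired Plus w else unpaired Plus w)"
    by (simp_all add: m)
qed

lemma balance_unpaired:
  "balance w = int (length (unpaired Plus w)) - int (length (unpaired Minus w))"
proof (induction w)
  case (Cons p w)
  then show ?case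
    by (cases p; cases "snd p"; cases "unpaired Minus w") auto
qed simp

text \<open>
  Prepending a bracket never decreases the number of surviving pluses, and in a suffix the
  surviving pluses exceed the balance by the number of surviving minuses.
\<close>

lemma balance_suffix_le:
  assumes "suffix x w" shows "balance x \<le> int (length (unpaired Plus w))"
proof -
  have "length (unpaired Plus x) \<le> length (unpaired Plus w)"
  proof -
    obtain u where "w = u @ x" using assms by (auto simp: suffix_def)
    moreover have "length (unpaired Plus x) \<le> length (unpaired Plus (u @ x))"
    proof (induction u)
      case (Cons p u)
      then show ?case by (cases p; cases "snd p") auto
    qed simp
    ultimately show ?thesis by simp
  qed
  then show ?thesis using balance_unpaired[of x] by linarith
qed

text \<open>
  If the plus at the head of a word survives, then no minus does, and the whole word is a suffix
  whose balance is the number of surviving pluses.  Otherwise that number is unchanged by the head.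
\<close>

lemma balance_suffix_attained:
  "\<exists>x. suffix x w \<and> balance x = int (length (unpaired Plus w))"
proof (induction w)
  case (Cons p w)
  then obtain x where x: "suffix x w" "balance x = int (length (unpaired Plus w))" by blast
  show ?case
  proof (cases "length (unpaired Plus (p # w)) = length (unpaired Plus w)")
    case True
    then show ?thesis using x by (metis suffix_ConsI)
  next
    case False
    then have "snd p = Plus \<and> unpaired Minus w = []"
      by (cases p; cases "snd p") (auto split: if_splits)
    then have "unpaired Minus (p # w) = []" by (cases p) auto
    then show ?thesis using balance_unpaired[of "p # w"] by auto
  qed
qed simp

lemma length_unpaired_Plus:
  assumes "\<And>x. suffix x w \<Longrightarrow> balance x \<le> m" and "suffix v w" and "balance v = m"
  shows "int (length (unpaired Plus w)) = m"
  using assms balance_suffix_le[of v w] balance_suffix_attained[of w] by force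

lemma unpaired_Minus_eq_Nil:
  assumes "\<And>x. suffix x w \<Longrightarrow> balance x \<le> balance w"
  shows "unpaired Minus w = []"
  using length_unpaired_Plus[of w "balance w" w] assms balance_unpaired[of w] by simp

text \<open>
  A suffix \<open>v\<close> whose balance is maximal has no surviving minus, so the minus in front of it is
  the only one to survive in \<open>(b, Minus) # v\<close>.  In a longer suffix it could be lost only when every
  minus has been cancelled, and then the balance of that suffix would again be the maximum.
\<close>

lemma last_unpaired_Minus:
  assumes "suffix ((b, Minus) # v) w" and "\<And>x. suffix x w \<Longrightarrow> balance x \<le> balance v"
    and "\<And>x. suffix x w \<Longrightarrow> length v < length x \<Longrightarrow> balance x < balance v"
  shows "unpaired Minus w \<noteq> [] \<and> last (unpaired Minus w) = b"
proof -
  obtain u where "w = u @ (b, Minus) # v" using assms(1) by (auto simp: suffix_def)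
  with assms(2,3) show ?thesis
  proof (induction u arbitrary: w)
    case Nil
    have "suffix v w" using Nil by (simp add: suffix_ConsI)
    then have "unpaired Minus v = []"
      using Nil(1) by (intro unpaired_Minus_eq_Nil) (blast intro: suffix_order.trans)
    then show ?case using Nil by simp
  next
    case (Cons p u)
    let ?w' = "u @ (b, Minus) # v"
    have w: "w = p # ?w'" using Cons by simp
    have IH: "unpaired Minus ?w' \<noteq> [] \<and> last (unpaired Minus ?w') = b"
      using Cons.prems(1,2) w by (intro Cons.IH) (auto intro: suffix_ConsI)
    obtain b' s where p: "p = (b', s)" by force
    have "suffix v w" by (simp add: w suffix_ConsI suffix_appendI)
    then have "int (length (unpaired Plus w)) = balance v"
      using Cons.prems(1) by (intro length_unpaired_Plus) auto
    moreover have "balance w < balance v"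
      using Cons.prems(2)[of w] by (simp add: w)
    ultimately have "unpaired Minus w \<noteq> []"
      using balance_unpaired[of w] by auto
    then show ?case
      using IH by (cases s) (auto simp: w p last_tl)
  qed
qed

text \<open>
  All suffixes of \<open>v\<close> have balance at most that of \<open>v\<close>, so \<open>v\<close> has no surviving minus that
  could cancel the plus in front of it.  With that plus the maximal balance is reached; a further
  surviving plus to its left would exceed it.
\<close>

lemma hd_unpaired_Plus:
  assumes "suffix ((b, Plus) # v) w" and "\<And>x. suffix x w \<Longrightarrow> balance x \<le> balance v + 1"
    and "\<And>x. suffix x w \<Longrightarrow> length x \<le> length v \<Longrightarrow> balance x \<le> balance v"
  shows "unpaired Plus w \<noteq> [] \<and> hd (unpaired Plus w) = b"
proof -
  obtain u where "w = u @ (b, Plus) # v" using assms(1) by (auto simp: suffix_def)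
  with assms(2,3) show ?thesis
  proof (induction u arbitrary: w)
    case Nil
    have "suffix v w" using Nil by (simp add: suffix_ConsI)
    then have "unpaired Minus v = []"
      using Nil(2) by (intro unpaired_Minus_eq_Nil)
        (meson suffix_length_le suffix_order.trans)
    then show ?case using Nil by simp
  next
    case (Cons p u)
    let ?w' = "u @ (b, Plus) # v"
    have w: "w = p # ?w'" using Cons by simp
    have IH: "unpaired Plus ?w' \<noteq> [] \<and> hd (unpaired Plus ?w') = b"
      using Cons.prems(1,2) w by (intro Cons.IH) (auto intro: suffix_ConsI)
    obtain b' s where p: "p = (b', s)" by force
    have "int (length (unpaired Plus w)) = balance v + 1"
      using Cons.prems(1) by (intro length_unpaired_Plus[where v = "(b, Plus) # v"])
        (auto simp: w suffix_ConsI suffix_appendI)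
    moreover have "int (length (unpaired Plus ?w')) = balance v + 1"
      using Cons.prems(1) by (intro length_unpaired_Plus[where v = "(b, Plus) # v"])
        (auto simp: w suffix_ConsI suffix_appendI)
    ultimately have "length (unpaired Plus w) = length (unpaired Plus ?w')" by simp
    then show ?case
      using IH by (cases s) (auto simp: w p split: if_splits)
  qed
qed

section \<open>Peaks of integer sequences\<close>

definition peak_height :: "nat \<Rightarrow> (nat \<Rightarrow> int) \<Rightarrow> int" where
  "peak_height n s = Max (s ` {1..n})"

definition peaks :: "nat \<Rightarrow> (nat \<Rightarrow> int) \<Rightarrow> nat set" where
  "peaks n s = {j\<in>{1..n}. s j = peak_height n s}"

lemma peak_height_ge: "j \<in> {1..n} \<Longrightarrow> s j \<le> peak_height n s"
  by (simp add: peak_height_def)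

lemma peak_height_eqI:
  assumes "v \<in> {1..n}" "s v = m" "\<And>j. j \<in> {1..n} \<Longrightarrow> s j \<le> m"
  shows "peak_height n s = m"
  unfolding peak_height_def using assms by (intro Max_eqI) auto

lemma finite_peaks: "finite (peaks n s)"
  by (simp add: peaks_def)

lemma peaks_nonempty:
  assumes "1 \<le> n" shows "peaks n s \<noteq> {}"
proof -
  have "peak_height n s \<in> s ` {1..n}"
    unfolding peak_height_def using assms by (intro Max_in) auto
  then show ?thesis by (force simp: peaks_def)
qed

lemma first_peak:
  assumes "1 \<le> n" and "v = Min (peaks n s)"
  shows "v \<in> {1..n}" "s v = peak_height n s"
    and "\<And>j. 1 \<le> j \<Longrightarrow> j < v \<Longrightarrow> s j < peak_height n s"
proof -
  have v: "v \<in> peaks n s"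
    unfolding assms(2) using finite_peaks peaks_nonempty[OF assms(1)] by (rule Min_in)
  then show "v \<in> {1..n}" "s v = peak_height n s" by (auto simp: peaks_def)
  fix j assume j: "1 \<le> j" "j < v"
  then have "j \<notin> peaks n s"
    using Min_le[OF finite_peaks, of j n s] assms(2) by force
  moreover have "j \<in> {1..n}" using j v by (auto simp: peaks_def)
  ultimately show "s j < peak_height n s"
    using peak_height_ge[of j n s] by (auto simp: peaks_def)
qed

lemma last_peak:
  assumes "1 \<le> n" and "v = Max (peaks n s)"
  shows "v \<in> {1..n}" "s v = peak_height n s"
    and "\<And>j. v < j \<Longrightarrow> j \<le> n \<Longrightarrow> s j < peak_height n s"
proof -
  have v: "v \<in> peaks n s"
    unfolding assms(2) using finite_peaks peaks_nonempty[OF assms(1)] by (rule Max_in)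
  then show "v \<in> {1..n}" "s v = peak_height n s" by (auto simp: peaks_def)
  fix j assume j: "v < j" "j \<le> n"
  then have "j \<notin> peaks n s"
    using Max_ge[OF finite_peaks, of j n s] assms(2) by force
  moreover have "j \<in> {1..n}" using j v by (auto simp: peaks_def)
  ultimately show "s j < peak_height n s"
    using peak_height_ge[of j n s] by (auto simp: peaks_def)
qed

text \<open>
  Under raising, all positions before the first peak \<open>v\<close> are at least one below the old maximum
  and gain two, \<open>v\<close> gains one, and the others do not change; so \<open>v\<close> is again a peak, the last one.
\<close>

lemma raise_first_peak:
  assumes "1 \<le> n" and v: "v = Min (peaks n s)"
    and s': "\<And>j. s' j = s j + (if j < v then 2 else if j = v then 1 else 0)"
  shows "peak_height n s' = peak_height n s + 1" and "Max (peaks n s') = v"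
proof -
  note fp = first_peak[OF assms(1) v]
  have le: "s' j \<le> peak_height n s + 1" "v < j \<Longrightarrow> s' j < peak_height n s + 1"
    if "j \<in> {1..n}" for j
    using that fp(3)[of j] peak_height_ge[OF that, of s] by (auto simp: s')
  show h: "peak_height n s' = peak_height n s + 1"
    using fp le by (intro peak_height_eqI[of v]) (auto simp: s')
  show "Max (peaks n s') = v"
  proof (rule Max_eqI[OF finite_peaks])
    show "v \<in> peaks n s'" using fp h by (simp add: peaks_def s')
    fix j assume "j \<in> peaks n s'"
    then show "j \<le> v" using le(2)[of j] h by (force simp: peaks_def)
  qed
qed

text \<open>
  The mirror image: positions after the last peak stay strictly below the maximum, hence at most
  at the new maximum, while those before it drop by two.
\<close>

lemma lower_last_peak:
  assumes "1 \<le> n" and v: "v = Max (peaks n s)"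
    and s': "\<And>j. s' j = s j - (if j < v then 2 else if j = v then 1 else 0)"
  shows "peak_height n s' = peak_height n s - 1" and "Min (peaks n s') = v"
proof -
  note lp = last_peak[OF assms(1) v]
  have le: "s' j \<le> peak_height n s - 1" "j < v \<Longrightarrow> s' j < peak_height n s - 1"
    if "j \<in> {1..n}" for j
    using that lp(3)[of j] lp(2) peak_height_ge[OF that, of s] by (auto simp: s')
  show h: "peak_height n s' = peak_height n s - 1"
    using lp le by (intro peak_height_eqI[of v]) (auto simp: s')
  show "Min (peaks n s') = v"
  proof (rule Min_eqI[OF finite_peaks])
    show "v \<in> peaks n s'" using lp h by (simp add: peaks_def s')
    fix j assume "j \<in> peaks n s'"
    then show "v \<le> j" using le(2)[of j] h by (force simp: peaks_def)
  qed
qed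

section \<open>Gelfand--Tsetlin patterns as infinite interlacing arrays\<close>

lemma part_rec: "i \<le> n \<Longrightarrow> part n lam i = lam i + part n lam (Suc i)"
  by (simp add: part_def sum.atLeast_Suc_atMost)

lemma part_eq_0 [simp]: "n < i \<Longrightarrow> part n lam i = 0"
  by (simp add: part_def)

lemma part_nonneg:
  assumes "lam \<in> dominant_weights n" "1 \<le> i" shows "0 \<le> part n lam i"
  using assms by (auto simp: part_def dominant_weights_def intro!: sum_nonneg)

lemma part_Suc_le:
  assumes "lam \<in> dominant_weights n" "1 \<le> i" shows "part n lam (Suc i) \<le> part n lam i"
  using assms part_rec[of i n lam] by (cases "i \<le> n") (auto simp: dominant_weights_def)

lemma gt_entry_0 [simp]: "gt_entry n lam g 0 k = part n lam k"
  by (simp add: gt_entry_def)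

lemma gt_entry_Suc [simp]: "gt_entry n lam g (Suc i) k = g (Suc i) k"
  by (simp add: gt_entry_def)

definition interlacing :: "(nat \<Rightarrow> nat \<Rightarrow> int) \<Rightarrow> bool" where
  "interlacing Y \<longleftrightarrow> (\<forall>i. \<forall>k\<ge>1. Y i (Suc k) \<le> Y (Suc i) k \<and> Y (Suc i) k \<le> Y i k)"

text \<open>
  The shape condition alone, without inequalities.  It is all that the formulas for \<open>gt_sigma\<close> and the
  weight depend on.
\<close>

definition triangular :: "nat \<Rightarrow> gt_pattern \<Rightarrow> bool" where
  "triangular n g \<longleftrightarrow> (\<forall>i k. i = 0 \<or> n < i \<or> k = 0 \<or> n + 1 < i + k \<longrightarrow> g i k = 0)"

lemma triangularD: "triangular n g \<Longrightarrow> i = 0 \<or> n < i \<or> k = 0 \<or> n + 1 < i + k \<Longrightarrow> g i k = 0"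
  unfolding triangular_def by blast

lemma triangular_entry:
  "triangular n g \<Longrightarrow> 1 \<le> i \<Longrightarrow> n < i \<or> k = 0 \<or> n + 1 < i + k \<Longrightarrow> gt_entry n lam g i k = 0"
  by (auto simp: gt_entry_def intro: triangularD)

text \<open>
  The ranges in the definition of a pattern are an artefact of the triangular shape: with zeros
  outside of the triangle the interlacing inequalities hold for all rows and all positions from 1 on,
  and nonnegativity is a consequence because the rows decrease to zero.  This uniform form avoids
  boundary cases from here on.
\<close>

lemma GT_iff_interlacing:
  assumes dom: "lam \<in> dominant_weights n"
  shows "g \<in> GT n lam \<longleftrightarrow> triangular n g \<and> interlacing (gt_entry n lam g)" (is "_ \<longleftrightarrow> ?R")
proof
  let ?Y = "gt_entry n lam g"
  assume "g \<in> GT n lam"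
  then have supp: "\<And>i k. \<not> (1 \<le> i \<and> i \<le> n \<and> 1 \<le> k \<and> k \<le> n + 1 - i) \<Longrightarrow> g i k = 0" and
    il: "\<And>i k. i \<in> {1..n} \<Longrightarrow> k \<in> {1..n + 1 - i} \<Longrightarrow>
      0 \<le> g i k \<and> ?Y i k \<le> ?Y (i - 1) k \<and> ?Y (i - 1) (k + 1) \<le> ?Y i k"
    by (simp_all add: GT_def gt_entry_def)
  have tri: "triangular n g"
    unfolding triangular_def by (intro allI impI supp) auto
  have nonneg: "0 \<le> ?Y i k" if "1 \<le> k" for i k
    using that il[of i k] supp[of i k] part_nonneg[OF dom, of k]
    by (cases i; cases "i \<le> n \<and> k \<le> n + 1 - i") auto
  have "?Y i (Suc k) \<le> ?Y (Suc i) k \<and> ?Y (Suc i) k \<le> ?Y i k" if k: "1 \<le> k" for i k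
  proof (cases "Suc i \<le> n \<and> k \<le> n - i")
    case True
    then show ?thesis using il[of "Suc i" k] k by auto
  next
    case False
    then have "g (Suc i) k = 0" by (intro triangularD[OF tri]) auto
    moreover have "?Y i (Suc k) = 0"
      using False k by (cases i) (auto intro: triangularD[OF tri])
    ultimately show ?thesis using nonneg[OF k, of i] by simp
  qed
  then show ?R using tri by (simp add: interlacing_def)
next
  let ?Y = "gt_entry n lam g"
  assume R: ?R
  have dec: "?Y (i + m) k \<le> ?Y i k" if "1 \<le> k" for i m k
  proof (induction m)
    case (Suc m)
    have "?Y (Suc (i + m)) k \<le> ?Y (i + m) k" using R that unfolding interlacing_def by blast
    then show ?case using Suc by simp
  qed simp
  have nonneg: "0 \<le> g i k" if "1 \<le> i" "1 \<le> k" for i k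
  proof -
    have "g (i + n) k = 0" using R that by (intro triangularD[of n]) auto
    then show ?thesis using dec[OF that(2), of i n] that by (cases i) auto
  qed
  have "0 \<le> g i k \<and> ?Y i k \<le> ?Y (i - 1) k \<and> ?Y (i - 1) (k + 1) \<le> ?Y i k"
    if i: "i \<in> {1..n}" and k: "k \<in> {1..n + 1 - i}" for i k
  proof -
    obtain i' where "i = Suc i'" using i by (cases i) auto
    then show ?thesis using R i k nonneg[of i k] unfolding interlacing_def by auto
  qed
  moreover have "g i k = 0" if "\<not> (1 \<le> i \<and> i \<le> n \<and> 1 \<le> k \<and> k \<le> n + 1 - i)" for i k
    using R that by (intro triangularD[of n]) auto
  ultimately show "g \<in> GT n lam" by (simp add: GT_def gt_entry_def)
qed

text \<open>
  The sums in \<open>gt_sigma\<close> can all be extended to the common upper end \<open>n + 1\<close>, since the added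
  entries vanish.
\<close>

lemma gt_sigma_full:
  assumes "triangular n g" "1 \<le> i"
  shows "gt_sigma n lam g i j = gt_entry n lam g i j
    + 2 * (\<Sum>k = Suc j..Suc n. gt_entry n lam g i k)
    - (\<Sum>k = j..Suc n. gt_entry n lam g (Suc i) k)
    - (\<Sum>k = Suc j..Suc n. gt_entry n lam g (i - 1) k)"
proof -
  have "(\<Sum>k = Suc j..n + 1 - i. gt_entry n lam g i k) = (\<Sum>k = Suc j..Suc n. gt_entry n lam g i k)"
    using assms by (intro sum.mono_neutral_left) (auto intro!: triangular_entry)
  moreover have "(\<Sum>k = j..n - i. gt_entry n lam g (Suc i) k)
      = (\<Sum>k = j..Suc n. gt_entry n lam g (Suc i) k)"
    using assms by (intro sum.mono_neutral_left) (auto intro!: triangularD)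
  moreover have "(\<Sum>k = Suc j..n + 2 - i. gt_entry n lam g (i - 1) k)
      = (\<Sum>k = Suc j..Suc n. gt_entry n lam g (i - 1) k)"
    using assms by (intro sum.mono_neutral_left)
      (auto intro!: triangularD part_eq_0 simp: gt_entry_def)
  ultimately show ?thesis by (simp add: gt_sigma_def)
qed

text \<open>
  The recursion at the heart of the proof.  It also covers \<open>j = 0\<close>, where the entries at position 0
  of the rows \<open>i\<close> and \<open>i + 1\<close> are zero.
\<close>

lemma gt_sigma_rec:
  assumes "triangular n g" "1 \<le> i" "j \<le> n"
  shows "gt_sigma n lam g i j = gt_sigma n lam g i (Suc j)
    + (gt_entry n lam g i j - gt_entry n lam g (Suc i) j)
    - (gt_entry n lam g (i - 1) (Suc j) - gt_entry n lam g i (Suc j))"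
proof -
  have "(\<Sum>k = Suc j..Suc n. f k) = f (Suc j) + (\<Sum>k = Suc (Suc j)..Suc n. f k)" for f :: "nat \<Rightarrow> int"
    using assms(3) by (intro sum.atLeast_Suc_atMost) simp
  moreover have "(\<Sum>k = j..Suc n. f k) = f j + (\<Sum>k = Suc j..Suc n. f k)" for f :: "nat \<Rightarrow> int"
    using assms(3) by (intro sum.atLeast_Suc_atMost) simp
  ultimately show ?thesis
    unfolding gt_sigma_full[OF assms(1,2)] by (simp add: algebra_simps)
qed

lemma gt_sigma_Suc_n:
  assumes "triangular n g" "1 \<le> i" shows "gt_sigma n lam g i (Suc n) = 0"
  unfolding gt_sigma_full[OF assms] using assms
  by (simp add: triangular_entry[OF assms(1)] triangularD[OF assms(1)])

section \<open>The crystal operators on patterns\<close>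

text \<open>
  The number of entries \<open>i\<close> in the reverse tableau that corresponds to the pattern.
\<close>

definition gt_content :: "nat \<Rightarrow> weight \<Rightarrow> gt_pattern \<Rightarrow> nat \<Rightarrow> int" where
  "gt_content n lam g i = (\<Sum>j = 1..Suc n. gt_entry n lam g (i - 1) j - gt_entry n lam g i j)"

definition gt_wt :: "nat \<Rightarrow> weight \<Rightarrow> gt_pattern \<Rightarrow> weight" where
  "gt_wt n lam g = (\<Sum>i = 1..n + 1. wscale (gt_content n lam g i) (eps n i))"

definition GT_crystal :: "nat \<Rightarrow> weight \<Rightarrow> gt_pattern crystal" where
  "GT_crystal n lam =
    \<lparr> cset = GT n lam,
      cwt = gt_wt n lam,
      ce = (\<lambda>i g. if gt_max n lam g i > 0
        then Some (gt_add g i (Max (gt_M n lam g i)) (- 1)) else None),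
      cf = (\<lambda>i g. if gt_max n lam g i > gt_sigma n lam g i 0
        then Some (gt_add g i (Min (gt_M n lam g i)) 1) else None),
      ceps = (\<lambda>i g. Fin (gt_max n lam g i)),
      cphi = (\<lambda>i g. Fin (coroot_pairing i (gt_wt n lam g) + gt_max n lam g i)) \<rparr>"

lemma gt_max_peak_height: "gt_max n lam g i = peak_height n (gt_sigma n lam g i)"
  by (simp add: gt_max_def peak_height_def)

lemma gt_M_peaks: "gt_M n lam g i = peaks n (gt_sigma n lam g i)"
  by (simp add: gt_M_def peaks_def gt_max_peak_height)

lemma wscale_sum_left: "(\<Sum>j\<in>A. wscale (c j) \<mu>) = wscale (\<Sum>j\<in>A. c j) \<mu>"
  by (rule ext) (simp add: sum_weight_apply wscale_def sum_distrib_right)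

lemma gt_wt_eq:
  assumes "triangular n g"
  shows "gt_wt n lam g = (\<Sum>i = 1..n + 1. \<Sum>j = 1..n + 2 - i.
            wscale (gt_entry n lam g (i - 1) j - gt_entry n lam g i j) (eps n i))"
proof -
  have "gt_content n lam g i
      = (\<Sum>j = 1..n + 2 - i. gt_entry n lam g (i - 1) j - gt_entry n lam g i j)"
    if "i \<in> {1..n + 1}" for i
  proof -
    have "gt_entry n lam g (i - 1) j = 0 \<and> gt_entry n lam g i j = 0"
      if "j \<in> {1..Suc n} - {1..n + 2 - i}" for j
      using that by (auto simp: gt_entry_def intro!: triangularD[OF assms])
    then show ?thesis
      unfolding gt_content_def using that by (intro sum.mono_neutral_right) auto
  qed
  then show ?thesis unfolding gt_wt_def wscale_sum_left by (intro sum.cong) auto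
qed

lemma gt_wt_apply:
  assumes "i \<in> {1..n}"
  shows "gt_wt n lam g i = gt_content n lam g i - gt_content n lam g (Suc i)"
proof -
  have "gt_wt n lam g i = (\<Sum>j = 1..n + 1.
      (if i = j then gt_content n lam g j else 0) - (if i + 1 = j then gt_content n lam g j else 0))"
    using assms by (auto simp: gt_wt_def sum_weight_apply wscale_def eps_def intro!: sum.cong)
  also have "\<dots> = gt_content n lam g i - gt_content n lam g (Suc i)"
    using assms by (simp only: sum_subtractf sum.delta finite_atLeastAtMost) auto
  finally show ?thesis .
qed

lemma gt_wt_outside: "i \<notin> {1..n} \<Longrightarrow> gt_wt n lam g i = 0"
  by (auto simp: gt_wt_def sum_weight_apply wscale_def eps_def)

text \<open>
  The coefficient of the weight at \<open>i\<close> is the difference of two consecutive contents, a sum of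
  second differences of the rows \<open>i - 1\<close>, \<open>i\<close> and \<open>i + 1\<close>, which up to sign is \<open>gt_sigma\<close> at 0.
\<close>

lemma coroot_pairing_gt_wt:
  assumes "triangular n g" "i \<in> {1..n}"
  shows "coroot_pairing i (gt_wt n lam g) = - gt_sigma n lam g i 0"
proof -
  have "gt_entry n lam g i 0 = 0" "gt_entry n lam g (Suc i) 0 = 0"
    using assms by (auto intro: triangular_entry triangularD)
  then show ?thesis
    using assms unfolding coroot_pairing_def gt_wt_apply[OF assms(2)] gt_content_def
    by (subst gt_sigma_full) (auto simp: sum_subtractf sum.atLeast_Suc_atMost)
qed

lemma gt_entry_add:
  assumes "1 \<le> i"
  shows "gt_entry n lam (gt_add g i v d) i' k
    = gt_entry n lam g i' k + (if i' = i \<and> k = v then d else 0)"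
  using assms by (auto simp: gt_entry_def gt_add_def)

text \<open>
  The entry \<open>Y i v\<close> occurs in \<open>gt_sigma n lam g i j\<close> with coefficient 2 if \<open>j < v\<close>, 1 if
  \<open>j = v\<close>, and 0 otherwise.
\<close>

lemma gt_sigma_add:
  assumes "triangular n g" "triangular n (gt_add g i v d)" "i \<in> {1..n}" "v \<in> {1..n}"
  shows "gt_sigma n lam (gt_add g i v d) i j
    = gt_sigma n lam g i j + (if j < v then 2 * d else if j = v then d else 0)"
proof -
  have "i - 1 \<noteq> i" "Suc i \<noteq> i" using assms by auto
  then show ?thesis
    using assms
    by (auto simp: gt_sigma_full gt_entry_add sum.distrib sum.delta simp del: gt_entry_Suc sum.cl_ivl_Suc)
qed

lemma gt_content_add:
  assumes "1 \<le> i" "1 \<le> i'" "v \<in> {1..n}"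
  shows "gt_content n lam (gt_add g i v d) i' = gt_content n lam g i'
    + (if i' = Suc i then d else if i' = i then - d else 0)"
proof -
  have "gt_content n lam (gt_add g i v d) i' = (\<Sum>j = 1..Suc n.
     (gt_entry n lam g (i' - 1) j - gt_entry n lam g i' j)
     + (if j = v then (if i' = Suc i then d else if i' = i then - d else 0) else 0))"
    unfolding gt_content_def using assms by (intro sum.cong) (auto simp: gt_entry_add)
  also have "\<dots> = gt_content n lam g i' + (if i' = Suc i then d else if i' = i then - d else 0)"
    unfolding sum.distrib gt_content_def using assms by (simp add: sum.delta)
  finally show ?thesis .
qed

text \<open>
  Entry \<open>Y i v\<close> contributes to the content of \<open>i + 1\<close> positively and to that of \<open>i\<close> negatively.
\<close>

lemma gt_wt_add:
  assumes "i \<in> {1..n}" "v \<in> {1..n}"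
  shows "gt_wt n lam (gt_add g i v d) = gt_wt n lam g - wscale d (alpha n i)"
proof
  fix k
  show "gt_wt n lam (gt_add g i v d) k = (gt_wt n lam g - wscale d (alpha n i)) k"
  proof (cases "k \<in> {1..n}")
    case True
    then show ?thesis
      using assms by (auto simp: gt_wt_apply gt_content_add wscale_def alpha_def eps_def)
  qed (auto simp: gt_wt_outside wscale_def alpha_def eps_def)
qed

text \<open>
  In this context \<open>Y\<close> is the array of the pattern including row 0, \<open>X\<close> below is the corresponding point
  of the polyhedral realization, and \<open>T\<close> the corresponding reverse tableau.
\<close>

locale gt_pattern_of =
  fixes n :: nat and lam :: weight and g :: gt_pattern
  assumes n1: "1 \<le> n" and dom: "lam \<in> dominant_weights n" and g: "g \<in> GT n lam"
begin

abbreviation "Y \<equiv> gt_entry n lam g"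

lemma triangular: "triangular n g"
  and row_le: "1 \<le> k \<Longrightarrow> Y (Suc i) k \<le> Y i k"
  and le_row: "1 \<le> k \<Longrightarrow> Y i (Suc k) \<le> Y (Suc i) k"
  using g dom by (auto simp: GT_iff_interlacing interlacing_def simp del: gt_entry_Suc)

lemma Y_0: "1 \<le> i \<Longrightarrow> Y i 0 = 0"
  and Y_beyond: "n < k \<Longrightarrow> Y i k = 0"
  and Y_bottom: "n < i \<Longrightarrow> Y i k = 0"
  using triangularD[OF triangular] by (auto simp: gt_entry_def)

lemma Y_nonneg: "1 \<le> k \<Longrightarrow> 0 \<le> Y i k"
  using g part_nonneg[OF dom] triangularD[OF triangular, of i k]
  by (cases i; cases "i \<le> n \<and> k \<le> n + 1 - i") (auto simp: GT_def)

lemma Y_antimono: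
  assumes "1 \<le> k" "k \<le> k'" shows "Y i k' \<le> Y i k"
  using assms(2)
proof (induction k' rule: dec_induct)
  case (step m)
  then show ?case using row_le[of m i] le_row[of m i] assms(1) by force
qed simp

lemma sigma_rec:
  assumes "1 \<le> i" "j \<le> n"
  shows "gt_sigma n lam g i j = gt_sigma n lam g i (Suc j)
    + (Y i j - Y (Suc i) j) - (Y (i - 1) (Suc j) - Y i (Suc j))"
  using assms triangular by (rule gt_sigma_rec[rotated])

lemma sigma_Suc_n: "1 \<le> i \<Longrightarrow> gt_sigma n lam g i (Suc n) = 0"
  using triangular by (rule gt_sigma_Suc_n)

lemma sigma_0_le:
  assumes "1 \<le> i" shows "gt_sigma n lam g i 0 \<le> gt_sigma n lam g i 1"
proof -
  obtain i' where "i = Suc i'" using assms by (cases i) auto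
  then show ?thesis
    using sigma_rec[OF assms, of 0] row_le[of 1 i'] Y_0[of i] Y_0[of "Suc i"] by simp
qed

text \<open>
  The recursion at \<open>j = n\<close> leaves the single difference \<open>Y i n - Y (i + 1) n\<close>.  It ensures that
  restricting the maximum to \<open>{1..n}\<close> loses nothing against the zeros beyond.
\<close>

lemma sigma_n_nonneg:
  assumes "1 \<le> i" shows "0 \<le> gt_sigma n lam g i n"
  using sigma_rec[OF assms, of n] sigma_Suc_n[OF assms] row_le[of n i] n1 Y_beyond[of "Suc n"]
  by simp

lemma gt_max_ge: "j \<in> {1..n} \<Longrightarrow> gt_sigma n lam g i j \<le> gt_max n lam g i"
  by (simp add: gt_max_peak_height peak_height_ge)

lemma gt_max_nonneg: "1 \<le> i \<Longrightarrow> 0 \<le> gt_max n lam g i"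
  using sigma_n_nonneg[of i] gt_max_ge[of n i] n1 by force

lemma sigma_le_gt_max:
  assumes "1 \<le> i" "j \<le> Suc n" shows "gt_sigma n lam g i j \<le> gt_max n lam g i"
proof -
  consider "j = 0" | "j \<in> {1..n}" | "j = Suc n" using assms by force
  then show ?thesis
    using sigma_0_le[OF assms(1)] gt_max_ge[of 1 i] gt_max_ge[of j i] gt_max_nonneg[OF assms(1)]
      sigma_Suc_n[OF assms(1)] n1 by cases auto
qed

text \<open>
  Since \<open>\<sigma> (v - 1) < \<sigma> v\<close>, the recursion at \<open>v - 1\<close> says that
  \<open>Y i (v - 1) - Y (i + 1) (v - 1) < Y (i - 1) v - Y i v\<close>.  The left side is nonnegative, so \<open>Y i v\<close>
  is below its upper bound in row \<open>i - 1\<close>; and \<open>Y (i - 1) v \<le> Y i (v - 1)\<close> turns the inequality into the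
  one for its upper bound in row \<open>i + 1\<close>.
  For \<open>v = 1\<close> the hypothesis on \<open>\<sigma> 0\<close> takes the place of the missing neighbour.
\<close>

lemma raise:
  assumes i: "i \<in> {1..n}" and less: "gt_sigma n lam g i 0 < gt_max n lam g i"
    and v: "v = Min (gt_M n lam g i)"
  shows raise_range: "v \<in> {1..n}"
    and raise_sigma: "gt_sigma n lam g i v = gt_max n lam g i"
    and raise_before: "\<And>j. j < v \<Longrightarrow> gt_sigma n lam g i j < gt_max n lam g i"
    and raise_above: "Y i v < Y (i - 1) v"
    and raise_below: "2 \<le> v \<Longrightarrow> Y i v < Y (Suc i) (v - 1)"
proof -
  note fp = first_peak[OF n1, of v "gt_sigma n lam g i",
      folded gt_M_peaks gt_max_peak_height, OF v]
  show range: "v \<in> {1..n}" and sig: "gt_sigma n lam g i v = gt_max n lam g i" by (fact fp)+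
  show before: "gt_sigma n lam g i j < gt_max n lam g i" if "j < v" for j
    using that fp(3)[of j] less by (cases j) auto
  obtain w where w: "v = Suc w" using range by (cases v) auto
  obtain i' where i': "i = Suc i'" using i by (cases i) auto
  \<comment> \<open>for \<open>w = 0\<close> both entries on the left are 0\<close>
  have *: "Y i w - Y (Suc i) w < Y i' v - Y i v"
    using sigma_rec[of i w] before[of w] sig range i w i' by auto
  have "0 \<le> Y i w - Y (Suc i) w"
    using row_le[of w i] Y_0[of i] Y_0[of "Suc i"] i by (cases "w = 0") auto
  then show "Y i v < Y (i - 1) v" using * i' by simp
  show "Y i v < Y (Suc i) (v - 1)" if "2 \<le> v"
    using that * le_row[of w i'] w i' by auto
qed

text \<open>
  The recursion at \<open>v\<close> together with \<open>\<sigma> (v + 1) < \<sigma> v\<close>.  For \<open>v = n\<close> the neighbour is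
  \<open>\<sigma> (n + 1) = 0\<close>, which is why a positive maximum is required.
\<close>

lemma lower:
  assumes i: "i \<in> {1..n}" and pos: "0 < gt_max n lam g i"
    and v: "v = Max (gt_M n lam g i)"
  shows lower_range: "v \<in> {1..n}"
    and lower_sigma: "gt_sigma n lam g i v = gt_max n lam g i"
    and lower_after: "\<And>j. v < j \<Longrightarrow> j \<le> Suc n \<Longrightarrow> gt_sigma n lam g i j < gt_max n lam g i"
    and lower_below: "Y (Suc i) v < Y i v"
    and lower_above: "Y (i - 1) (Suc v) < Y i v"
proof -
  note lp = last_peak[OF n1, of v "gt_sigma n lam g i",
      folded gt_M_peaks gt_max_peak_height, OF v]
  show range: "v \<in> {1..n}" and sig: "gt_sigma n lam g i v = gt_max n lam g i" by (fact lp)+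
  show after: "gt_sigma n lam g i j < gt_max n lam g i" if "v < j" "j \<le> Suc n" for j
    using that lp(3)[of j] pos sigma_Suc_n[of i] i by (cases "j = Suc n") auto
  obtain i' where i': "i = Suc i'" using i by (cases i) auto
  have *: "Y i' (Suc v) - Y i (Suc v) < Y i v - Y (Suc i) v"
    using sigma_rec[of i v] after[of "Suc v"] sig range i i' by auto
  have "Y i (Suc v) \<le> Y i' (Suc v)" using row_le[of "Suc v" i'] i' by simp
  then show "Y (Suc i) v < Y i v" using * by simp
  have "Y i (Suc v) \<le> Y (Suc i) v" using le_row[of v i] range by simp
  then show "Y (i - 1) (Suc v) < Y i v" using * i' by simp
qed

lemma gt_add_in_GT:
  assumes i: "i \<in> {1..n}" and v: "v \<in> {1..n}" "v \<le> n + 1 - i"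
    and up: "Y i v + d \<le> Y (i - 1) v" "2 \<le> v \<Longrightarrow> Y i v + d \<le> Y (Suc i) (v - 1)"
    and down: "Y (Suc i) v \<le> Y i v + d" "Y (i - 1) (Suc v) \<le> Y i v + d"
  shows "gt_add g i v d \<in> GT n lam"
proof -
  have "triangular n (gt_add g i v d)"
    using triangular i v by (auto simp: triangular_def gt_add_def)
  moreover have "interlacing (gt_entry n lam (gt_add g i v d))"
    unfolding interlacing_def
  proof (intro allI impI)
    fix i' k :: nat assume k: "1 \<le> k"
    show "gt_entry n lam (gt_add g i v d) i' (Suc k) \<le> gt_entry n lam (gt_add g i v d) (Suc i') k \<and>
      gt_entry n lam (gt_add g i v d) (Suc i') k \<le> gt_entry n lam (gt_add g i v d) i' k"
      using row_le[OF k, of i'] le_row[OF k, of i'] i k up down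
      by (auto simp: gt_entry_add simp del: gt_entry_Suc)
  qed
  ultimately show ?thesis using dom by (simp add: GT_iff_interlacing)
qed

text \<open>
  Beyond the triangle the position \<open>v\<close> would have a zero entry below it on the left, which leaves no
  room; so the first peak is a genuine position of row \<open>i\<close>.
\<close>

lemma raise_in_GT:
  assumes "i \<in> {1..n}" "gt_sigma n lam g i 0 < gt_max n lam g i" "v = Min (gt_M n lam g i)"
  shows "gt_add g i v 1 \<in> GT n lam" and "v \<le> n + 1 - i"
proof -
  note r = raise[OF assms]
  obtain i' where i': "i = Suc i'" using assms by (cases i) auto
  show v: "v \<le> n + 1 - i"
  proof (rule ccontr)
    assume *: "\<not> v \<le> n + 1 - i"
    then have "2 \<le> v" and "v - 1 > n + 1 - Suc i" using r(1) assms(1) by auto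
    moreover have "g (Suc i) (v - 1) = 0"
      using * by (intro triangularD[OF triangular]) auto
    ultimately show False using r(5) Y_nonneg[of v i] r(1) by auto
  qed
  show "gt_add g i v 1 \<in> GT n lam"
    using r(1,4,5) v assms(1) row_le[of v i] le_row[of v i'] i' by (intro gt_add_in_GT) auto
qed

text \<open>
  An entry that can be lowered is positive, hence inside the triangle.
\<close>

lemma lower_in_GT:
  assumes "i \<in> {1..n}" "0 < gt_max n lam g i" "v = Max (gt_M n lam g i)"
  shows "gt_add g i v (- 1) \<in> GT n lam" and "v \<le> n + 1 - i"
proof -
  note l = lower[OF assms]
  obtain i' where i': "i = Suc i'" using assms by (cases i) auto
  show v: "v \<le> n + 1 - i"
  proof (rule ccontr)
    assume *: "\<not> v \<le> n + 1 - i"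
    then have "g i v = 0" by (intro triangularD[OF triangular]) auto
    then show False using l(4) Y_nonneg[of v "Suc i"] l(1) i' by auto
  qed
  show "gt_add g i v (- 1) \<in> GT n lam"
  proof (rule gt_add_in_GT[OF assms(1) l(1) v])
    show "Y i v + - 1 \<le> Y (i - 1) v" using row_le[of v i'] i' l(1) by auto
    show "Y i v + - 1 \<le> Y (Suc i) (v - 1)" if "2 \<le> v"
      using le_row[of "v - 1" i] that by (cases v) auto
  qed (use l in auto)
qed

end

text \<open>
  Raising and lowering undo each other because they exchange the first and the last peak.
\<close>

lemma is_crystal_GT:
  assumes n1: "1 \<le> n" and dom: "lam \<in> dominant_weights n"
  shows "is_crystal n (GT_crystal n lam)"
  unfolding is_crystal_def
proof (rule conjI; intro ballI)
  fix g assume "g \<in> cset (GT_crystal n lam)"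
  show "cwt (GT_crystal n lam) g \<in> weight_lattice n"
    by (simp add: GT_crystal_def weight_lattice_def gt_wt_outside)
next
  fix i g assume i: "i \<in> {1..n}" and "g \<in> cset (GT_crystal n lam)"
  then have g: "g \<in> GT n lam" by (simp add: GT_crystal_def)
  let ?C = "GT_crystal n lam"
  have loc: "gt_pattern_of n lam g" if "g \<in> GT n lam" for g
    using that n1 dom by unfold_locales
  have tri: "triangular n g" if "g \<in> GT n lam" for g
    using that dom by (simp add: GT_iff_interlacing)
  have alpha: "alpha n i i = 2" using i by (auto simp: alpha_def eps_def)
  have f: "g' \<in> GT n lam \<and> gt_wt n lam g' = gt_wt n lam g - alpha n i
      \<and> gt_max n lam g' i = gt_max n lam g i + 1 \<and> ce ?C i g' = Some g"
    if "cf ?C i g = Some g'" "g \<in> GT n lam" for g g'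
  proof -
    interpret gt_pattern_of n lam g using that(2) by (rule loc)
    define v where "v = Min (gt_M n lam g i)"
    have less: "gt_sigma n lam g i 0 < gt_max n lam g i" and g': "g' = gt_add g i v 1"
      using that(1) by (auto simp: GT_crystal_def v_def split: if_splits)
    note v = raise_range[OF i less v_def]
    have in_GT: "g' \<in> GT n lam" unfolding g' by (rule raise_in_GT[OF i less v_def])
    have "gt_sigma n lam g' i j = gt_sigma n lam g i j + (if j < v then 2 else if j = v then 1 else 0)" for j
      unfolding g' using gt_sigma_add[OF triangular tri[OF in_GT, unfolded g'] i v] by auto
    note r = raise_first_peak[OF n1 _ this, folded gt_M_peaks gt_max_peak_height, OF v_def]
    have "gt_add g' i v (- 1) = g" by (auto simp: g' gt_add_def fun_eq_iff)
    moreover have "0 < gt_max n lam g' i" using r(1) gt_max_nonneg[of i] i by simp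
    ultimately have "ce ?C i g' = Some g" using r(2) by (simp add: GT_crystal_def)
    moreover have "gt_wt n lam g' = gt_wt n lam g - alpha n i"
      unfolding g' gt_wt_add[OF i v] by (simp add: wscale_def)
    ultimately show ?thesis using r(1) in_GT by simp
  qed
  have e: "g' \<in> GT n lam \<and> gt_wt n lam g' = gt_wt n lam g + alpha n i
      \<and> gt_max n lam g' i = gt_max n lam g i - 1 \<and> cf ?C i g' = Some g"
    if "ce ?C i g = Some g'" "g \<in> GT n lam" for g g'
  proof -
    interpret gt_pattern_of n lam g using that(2) by (rule loc)
    define v where "v = Max (gt_M n lam g i)"
    have pos: "0 < gt_max n lam g i" and g': "g' = gt_add g i v (- 1)"
      using that(1) by (auto simp: GT_crystal_def v_def split: if_splits)
    note v = lower_range[OF i pos v_def]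
    have in_GT: "g' \<in> GT n lam" unfolding g' by (rule lower_in_GT[OF i pos v_def])
    have s: "gt_sigma n lam g' i j = gt_sigma n lam g i j - (if j < v then 2 else if j = v then 1 else 0)" for j
      unfolding g' using gt_sigma_add[OF triangular tri[OF in_GT, unfolded g'] i v] by auto
    note r = lower_last_peak[OF n1 _ s, folded gt_M_peaks gt_max_peak_height, OF v_def]
    have "gt_add g' i v 1 = g" by (auto simp: g' gt_add_def fun_eq_iff)
    moreover have "gt_sigma n lam g' i 0 < gt_max n lam g' i"
      using r(1) sigma_le_gt_max[of i 0] i s[of 0] v by simp
    ultimately have "cf ?C i g' = Some g" using r(2) by (simp add: GT_crystal_def)
    moreover have "gt_wt n lam g' = gt_wt n lam g + alpha n i"
      unfolding g' gt_wt_add[OF i v] by (simp add: wscale_def fun_eq_iff)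
    ultimately show ?thesis using r(1) in_GT by simp
  qed
  have wt: "cwt ?C = gt_wt n lam" "cset ?C = GT n lam" by (simp_all add: GT_crystal_def)
  have set: "set_option (ce ?C i g) \<subseteq> cset ?C" "set_option (cf ?C i g) \<subseteq> cset ?C"
    using e[OF _ g] f[OF _ g] unfolding wt elem_set subset_iff by blast+
  have ep: "ceps ?C i g = Fin (gt_max n lam g i)"
    "cphi ?C i g = Fin (coroot_pairing i (gt_wt n lam g) + gt_max n lam g i)" for g
    by (simp_all add: GT_crystal_def)
  have other: "ceps ?C i g \<noteq> \<infinity>" "cphi ?C i g \<noteq> \<infinity>" "cphi ?C i g \<noteq> -\<infinity>"
      "cphi ?C i g = ceps ?C i g + Fin (coroot_pairing i (cwt ?C g))"
    by (simp_all add: wt ep)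
  have "\<forall>g'. ce ?C i g = Some g' \<longrightarrow> cwt ?C g' = cwt ?C g + alpha n i \<and>
        ceps ?C i g' = ceps ?C i g - Fin 1 \<and> cphi ?C i g' = cphi ?C i g + Fin 1"
    using e[OF _ g] alpha by (auto simp: wt ep coroot_pairing_def)
  moreover have "\<forall>g'. cf ?C i g = Some g' \<longrightarrow> cwt ?C g' = cwt ?C g - alpha n i \<and>
        ceps ?C i g' = ceps ?C i g + Fin 1 \<and> cphi ?C i g' = cphi ?C i g - Fin 1"
    using f[OF _ g] alpha by (auto simp: wt ep coroot_pairing_def)
  moreover have "\<forall>g'\<in>cset ?C. cf ?C i g = Some g' \<longleftrightarrow> ce ?C i g' = Some g"
    using e f g unfolding wt by blast
  ultimately show "set_option (ce ?C i g) \<subseteq> cset ?C \<and> set_option (cf ?C i g) \<subseteq> cset ?C \<and>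
      ceps ?C i g \<noteq> \<infinity> \<and> cphi ?C i g \<noteq> \<infinity> \<and>
      cphi ?C i g = ceps ?C i g + Fin (coroot_pairing i (cwt ?C g)) \<and>
      (\<forall>b'. ce ?C i g = Some b' \<longrightarrow> cwt ?C b' = cwt ?C g + alpha n i \<and>
        ceps ?C i b' = ceps ?C i g - Fin 1 \<and> cphi ?C i b' = cphi ?C i g + Fin 1) \<and>
      (\<forall>b'. cf ?C i g = Some b' \<longrightarrow> cwt ?C b' = cwt ?C g - alpha n i \<and>
        ceps ?C i b' = ceps ?C i g + Fin 1 \<and> cphi ?C i b' = cphi ?C i g - Fin 1) \<and>
      (\<forall>b'\<in>cset ?C. cf ?C i g = Some b' \<longleftrightarrow> ce ?C i b' = Some g) \<and>
      (cphi ?C i g = -\<infinity> \<longrightarrow> ce ?C i g = None \<and> cf ?C i g = None)"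
    using set other by blast
qed

section \<open>The polyhedral realization\<close>

definition seq_index :: "nat \<Rightarrow> nat \<Rightarrow> nat \<Rightarrow> nat" where
  "seq_index n i j = (j - 1) * n + i"

lemma iota_seq_index: "i \<in> {1..n} \<Longrightarrow> iota n (seq_index n i j) = i"
  and row_seq_index: "i \<in> {1..n} \<Longrightarrow> (seq_index n i j - 1) div n = j - 1"
proof -
  assume i: "i \<in> {1..n}"
  then obtain r where r: "i = Suc r" "r < n" by (cases i) auto
  then show "iota n (seq_index n i j) = i" "(seq_index n i j - 1) div n = j - 1"
    by (simp_all add: iota_def seq_index_def)
qed

lemma iota_range: "1 \<le> n \<Longrightarrow> iota n m \<in> {1..n}"
  by (simp add: iota_def Suc_leI)

lemma seq_index_iota: "1 \<le> m \<Longrightarrow> m = seq_index n (iota n m) ((m - 1) div n + 1)"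
  by (simp add: seq_index_def iota_def div_mult_mod_eq)

text \<open>
  The coordinates of colour \<open>i\<close> form the progression \<open>i, n + i, 2 * n + i, \<dots>\<close>.
\<close>

lemma iota_eq_iff:
  assumes "i \<in> {1..n}"
  shows "1 \<le> k \<and> iota n k = i \<longleftrightarrow> (\<exists>j\<ge>1. k = seq_index n i j)"
proof
  assume "1 \<le> k \<and> iota n k = i"
  then have "k = seq_index n i ((k - 1) div n + 1)" using seq_index_iota by metis
  then show "\<exists>j\<ge>1. k = seq_index n i j" by (metis le_add2)
qed (use assms iota_seq_index in \<open>auto simp: seq_index_def\<close>)

lemma seq_index_Suc: "1 \<le> j \<Longrightarrow> seq_index n i (Suc j) = seq_index n i j + n"
  by (cases j) (auto simp: seq_index_def)

lemma seq_index_mono: "j \<le> j' \<Longrightarrow> seq_index n i j \<le> seq_index n i j'"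
  by (simp add: seq_index_def diff_le_mono)

lemma xc_eq: "1 \<le> i \<Longrightarrow> xc n x j i = x (seq_index n i j)"
  by (simp add: xc_def seq_index_def)

lemma seq_zero_beyond:
  assumes "1 \<le> n" and "\<And>i j. i \<in> {1..n} \<Longrightarrow> n < j \<Longrightarrow> x (seq_index n i j) = 0" and "n * n < m"
  shows "x m = 0"
proof -
  have "n * n \<le> m - 1" using assms(3) by linarith
  then have "n \<le> (m - 1) div n"
    using assms(1) by (simp add: less_eq_div_iff_mult_less_eq)
  moreover have "m = seq_index n (iota n m) ((m - 1) div n + 1)"
    using assms(3) by (intro seq_index_iota) simp
  ultimately show ?thesis
    using assms(2)[OF iota_range[OF assms(1)], of "(m - 1) div n + 1" m] by simp
qed

text \<open>
  Including \<open>i = 0\<close> and the positions outside of the triangle makes the formula uniform; in both cases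
  the two sides vanish.
\<close>

lemma xc_varsigma:
  assumes tri: "triangular n g" and i: "i \<le> n" and k: "1 \<le> k"
  shows "xc n (varsigma n lam g) k i = gt_entry n lam g i k - part n lam (k + i)"
proof (cases "i = 0")
  case False
  then have i': "i \<in> {1..n}" using i by simp
  have "xc n (varsigma n lam g) k i
      = (if k \<le> n + 1 - i then g i k - part n lam (k + i) else 0)"
    using False k row_seq_index[OF i', of k] iota_seq_index[OF i', of k]
    by (auto simp: xc_eq varsigma_def seq_index_def Let_def)
  then show ?thesis
    using False i by (auto simp: gt_entry_def triangularD[OF tri])
qed (simp add: xc_def)

definition gt_of_seq :: "nat \<Rightarrow> weight \<Rightarrow> zseq \<Rightarrow> gt_pattern" where
  "gt_of_seq n lam x = (\<lambda>i k.
    if 1 \<le> i \<and> i \<le> n \<and> 1 \<le> k \<and> k \<le> n + 1 - i then xc n x k i + part n lam (k + i) else 0)"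

lemma gt_of_seq_varsigma:
  assumes "triangular n g" shows "gt_of_seq n lam (varsigma n lam g) = g"
proof (intro ext)
  fix i k
  show "gt_of_seq n lam (varsigma n lam g) i k = g i k"
  proof (cases "1 \<le> i \<and> i \<le> n \<and> 1 \<le> k \<and> k \<le> n + 1 - i")
    case True
    then show ?thesis
      using xc_varsigma[OF assms, of i k lam] by (simp add: gt_of_seq_def gt_entry_def)
  next
    case False
    then have "g i k = 0" by (intro triangularD[OF assms]) auto
    then show ?thesis using False by (simp only: gt_of_seq_def if_False)
  qed
qed

lemma varsigma_gt_of_seq:
  assumes n1: "1 \<le> n" and x: "x \<in> Sigma_set n lam"
  shows "varsigma n lam (gt_of_seq n lam x) = x"
proof
  fix m
  show "varsigma n lam (gt_of_seq n lam x) m = x m"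
  proof (cases "m = 0")
    case True
    then show ?thesis using x by (simp add: varsigma_def Sigma_set_def)
  next
    case False
    define i k where ik: "i = iota n m" "k = (m - 1) div n + 1"
    have i: "i \<in> {1..n}" using iota_range[OF n1] ik by simp
    have m: "m = seq_index n i k" using False seq_index_iota[of m n] ik by simp
    have xm: "xc n x k i = x m" using i m xc_eq by simp
    have "xc n x k i = 0" if "\<not> k \<le> n + 1 - i"
    proof -
      have "1 \<le> k" "i + k > n + 1" using that ik by auto
      then show ?thesis using x i unfolding Sigma_set_def by blast
    qed
    then show ?thesis
      using False i xm by (auto simp: varsigma_def gt_of_seq_def Let_def ik[symmetric] ik(2))
  qed
qed

text \<open>
  Every inequality defining \<open>Sigma_set\<close> is one interlacing inequality, in which the row lengths
  subtracted by \<open>varsigma\<close> agree or cancel.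
\<close>

lemma (in gt_pattern_of) varsigma_in_Sigma: "varsigma n lam g \<in> Sigma_set n lam"
proof -
  let ?x = "varsigma n lam g"
  have xc: "xc n ?x k i = Y i k - part n lam (k + i)" if "i \<le> n" "1 \<le> k" for i k
    using triangular that by (rule xc_varsigma)
  have zero: "xc n ?x j i = 0" if "i \<in> {1..n}" "1 \<le> j" "i + j > n + 1" for i j
    using that by (simp add: xc triangular_entry[OF triangular] add.commute)
  have "?x (seq_index n i j) = 0" if "i \<in> {1..n}" "n < j" for i j
    using zero[of i j] that xc_eq[of i n ?x j] by simp
  then have "\<exists>K. \<forall>k>K. ?x k = 0" using seq_zero_beyond[OF n1] by blast
  moreover have "xc n ?x j (i - j + 1) \<ge> xc n ?x (j + 1) (i - j)"
    if "i \<in> {1..n}" "1 \<le> j \<and> j < i" for i j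
  proof -
    have "Suc (i - j) \<le> n" using that by auto
    then show ?thesis using that le_row[of j "i - j"] by (simp add: xc del: gt_entry_Suc)
  qed
  moreover have "xc n ?x i 1 \<ge> 0" if "i \<in> {1..n}" for i
    using that le_row[of i 0] by (simp add: xc)
  moreover have "part n lam i - part n lam (i + 1) \<ge> xc n ?x j (i - j + 1) - xc n ?x j (i - j)"
    if "i \<in> {1..n}" "j \<in> {1..i}" for i j
  proof -
    have "Suc (i - j) \<le> n" using that by auto
    then show ?thesis using that row_le[of j "i - j"] by (simp add: xc del: gt_entry_Suc)
  qed
  ultimately show ?thesis
    using zero by (simp add: Sigma_set_def varsigma_def)
qed

text \<open>
  The converse translation of the inequalities.  On the edge of the triangle an interlacing inequality
  has a zero on one side, and there nonnegativity of all coordinates is used, which follows by walking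
  down an antidiagonal to a coordinate of colour 1.
\<close>

lemma gt_of_seq_in_GT:
  assumes dom: "lam \<in> dominant_weights n" and x: "x \<in> Sigma_set n lam"
  shows "gt_of_seq n lam x \<in> GT n lam"
proof -
  let ?g = "gt_of_seq n lam x"
  have tri: "triangular n ?g"
    by (auto simp: triangular_def gt_of_seq_def)
  have left: "xc n x (Suc k) i \<le> xc n x k (Suc i)" if "1 \<le> i" "1 \<le> k" "i + k \<le> n" for i k
  proof -
    have "i + k \<in> {1..n}" "1 \<le> k \<and> k < i + k" using that by auto
    then have "xc n x k (i + k - k + 1) \<ge> xc n x (k + 1) (i + k - k)"
      using x unfolding Sigma_set_def by blast
    then show ?thesis by simp
  qed
  have bottom: "0 \<le> xc n x k 1" if "k \<in> {1..n}" for k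
    using x that unfolding Sigma_set_def by blast
  have up: "xc n x k (Suc i) - xc n x k i \<le> part n lam (i + k) - part n lam (Suc (i + k))"
    if "1 \<le> k" "i + k \<le> n" for i k
  proof -
    have "i + k \<in> {1..n}" "k \<in> {1..i + k}" using that by auto
    then have "part n lam (i + k) - part n lam (i + k + 1)
        \<ge> xc n x k (i + k - k + 1) - xc n x k (i + k - k)"
      using x unfolding Sigma_set_def by blast
    then show ?thesis by simp
  qed
  have nonneg: "0 \<le> xc n x k (Suc i)" if "1 \<le> k" "i + k \<le> n" for i k
    using that
  proof (induction i arbitrary: k)
    case 0
    then show ?case using bottom by simp
  next
    case (Suc i)
    have "0 \<le> xc n x (Suc k) (Suc i)" using Suc.prems by (intro Suc.IH) auto
    also have "\<dots> \<le> xc n x k (Suc (Suc i))" using Suc.prems by (intro left) auto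
    finally show ?case .
  qed
  have entry: "gt_entry n lam ?g i k = xc n x k i + part n lam (k + i)" if "1 \<le> k" "i + k \<le> n + 1" "i \<le> n" for i k
    using that by (auto simp: gt_entry_def gt_of_seq_def xc_def)
  have "interlacing (gt_entry n lam ?g)"
    unfolding interlacing_def
  proof (intro allI impI)
    fix i k :: nat assume k: "1 \<le> k"
    show "gt_entry n lam ?g i (Suc k) \<le> gt_entry n lam ?g (Suc i) k \<and>
      gt_entry n lam ?g (Suc i) k \<le> gt_entry n lam ?g i k"
    proof (cases "i + k \<le> n")
      case True
      have "xc n x (Suc k) i \<le> xc n x k (Suc i)"
        using left[of i k] nonneg[of k 0] True k by (cases "i = 0") (auto simp: xc_def[of n x _ 0])
      then show ?thesis
        using True k up[of k i] by (simp add: entry add.commute del: gt_entry_Suc)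
    next
      case False
      have "gt_entry n lam ?g (Suc i) k = 0" "gt_entry n lam ?g i (Suc k) = 0"
        using False by (auto simp: gt_entry_def intro!: triangularD[OF tri])
      moreover have "0 \<le> gt_entry n lam ?g i k"
      proof (cases "1 \<le> i \<and> i + k = n + 1")
        case True
        then show ?thesis using nonneg[of k "i - 1"] k by (simp add: entry)
      next
        case F: False
        then have "gt_entry n lam ?g i k = 0"
          using False k by (cases "i = 0") (auto simp: gt_entry_def intro!: triangularD[OF tri])
        then show ?thesis by simp
      qed
      ultimately show ?thesis by simp
    qed
  qed
  then show ?thesis using tri GT_iff_interlacing[OF dom] by blast
qed

lemma bij_betw_varsigma:
  assumes n1: "1 \<le> n" and dom: "lam \<in> dominant_weights n"
  shows "bij_betw (varsigma n lam) (GT n lam) (Sigma_set n lam)"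
proof (rule bij_betw_byWitness[where f' = "gt_of_seq n lam"])
  show "\<forall>g\<in>GT n lam. gt_of_seq n lam (varsigma n lam g) = g"
    using gt_of_seq_varsigma GT_iff_interlacing[OF dom] by blast
  show "\<forall>x\<in>Sigma_set n lam. varsigma n lam (gt_of_seq n lam x) = x"
    using varsigma_gt_of_seq[OF n1] by blast
  show "varsigma n lam ` GT n lam \<subseteq> Sigma_set n lam"
    using gt_pattern_of.varsigma_in_Sigma gt_pattern_of.intro[OF n1 dom] by blast
  show "gt_of_seq n lam ` Sigma_set n lam \<subseteq> GT n lam"
    using gt_of_seq_in_GT[OF dom] by blast
qed

text \<open>
  Colours run cyclically through \<open>1, \<dots>, n\<close>.
\<close>

lemma iota_add:
  assumes "iota n k = i" "1 \<le> k" "t \<in> {1..n}"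
  shows "iota n (k + t) = (if i + t \<le> n then i + t else i + t - n)"
proof -
  have i: "i - 1 = (k - 1) mod n" "i - 1 < n" "1 \<le> i" using assms by (auto simp: iota_def)
  have "(k + t - 1) mod n = (i - 1 + t) mod n"
    unfolding i(1) mod_add_left_eq using assms(2) by simp
  also have "\<dots> = (if i + t \<le> n then i - 1 + t else i - 1 + t - n)"
  proof (cases "i + t \<le> n")
    case False
    then have "i - 1 + t = (i - 1 + t - n) + n" "i - 1 + t - n < n" using i(2,3) assms(3) by auto
    then have "(i - 1 + t) mod n = i - 1 + t - n" by (metis mod_add_self2 mod_less)
    then show ?thesis using False by simp
  qed (use i(3) in simp)
  finally show ?thesis using i(3) assms(3) by (auto simp: iota_def)
qed

lemma coroot_pairing_alpha:
  assumes "i \<in> {1..n}"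
  shows "coroot_pairing i (alpha n j)
    = (if j = i then 2 else 0) - (if j = Suc i then 1 else 0) - (if Suc j = i then 1 else 0)"
  using assms by (auto simp: coroot_pairing_def alpha_def eps_def)

text \<open>
  Passing from \<open>k\<close> to the next coordinate \<open>k + n\<close> of the same colour only exchanges the terms with
  index in the window from \<open>k + 1\<close> to \<open>k + n\<close>.  Every colour occurs there once, so the Cartan matrix leaves
  the contributions of the colours \<open>i\<close> and \<open>i \<plusminus> 1\<close>; the two neighbouring colours, if they exist, sit
  at the first and at the last but one place of the window.
\<close>

lemma seq_sigma_rec:
  assumes k: "1 \<le> k" "iota n k = i" and n1: "1 \<le> n" and fin: "finite {j. x j \<noteq> 0}"
  shows "seq_sigma n x k = seq_sigma n x (k + n) + x k + x (k + n)
    - (if i < n then x (k + 1) else 0) - (if 1 < i then x (k + n - 1) else 0)"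
proof -
  have i: "i \<in> {1..n}" using iota_range[OF n1, of k] k by simp
  define f where "f j = coroot_pairing i (alpha n (iota n j)) * x j" for j
  have split: "{j. j > k \<and> x j \<noteq> 0} = {j\<in>{Suc k..k + n}. x j \<noteq> 0} \<union> {j. j > k + n \<and> x j \<noteq> 0}"
    by auto
  have union: "sum f ({j\<in>{Suc k..k + n}. x j \<noteq> 0} \<union> {j. j > k + n \<and> x j \<noteq> 0})
      = (\<Sum>j | j \<in> {Suc k..k + n} \<and> x j \<noteq> 0. f j) + (\<Sum>j | j > k + n \<and> x j \<noteq> 0. f j)"
    using finite_subset[OF _ fin, of "{j. j > k + n \<and> x j \<noteq> 0}"]
    by (intro sum.union_disjoint) auto
  have "(\<Sum>j | j > k \<and> x j \<noteq> 0. f j)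
      = (\<Sum>j | j \<in> {Suc k..k + n} \<and> x j \<noteq> 0. f j) + (\<Sum>j | j > k + n \<and> x j \<noteq> 0. f j)"
    by (simp only: split union)
  moreover have "(\<Sum>j | j \<in> {Suc k..k + n} \<and> x j \<noteq> 0. f j) = 2 * x (k + n)
      - (if i < n then x (k + 1) else 0) - (if 1 < i then x (k + n - 1) else 0)"
  proof -
    have "(\<Sum>j | j \<in> {Suc k..k + n} \<and> x j \<noteq> 0. f j) = (\<Sum>j = Suc k..k + n. f j)"
      by (intro sum.mono_neutral_left) (auto simp: f_def)
    also have "(\<Sum>j = Suc k..k + n. f j) = (\<Sum>j = Suc k..k + n.
        (if j = k + n then 2 * x (k + n) else 0)
        - (if j = k + 1 then if i < n then x (k + 1) else 0 else 0)
        - (if j = k + n - 1 then if 1 < i then x (k + n - 1) else 0 else 0))"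
    proof (rule sum.cong[OF refl])
      fix j assume "j \<in> {Suc k..k + n}"
      then obtain t where t: "j = k + t" "t \<in> {1..n}"
        by (auto simp: le_iff_add intro: that[of "j - k"])
      have "coroot_pairing i (alpha n (iota n j)) = (if t = n then 2 else 0)
        - (if t = 1 \<and> i < n then 1 else 0) - (if Suc t = n \<and> 1 < i then 1 else 0)"
        using i t(2) unfolding t(1) iota_add[OF k(2,1) t(2)] coroot_pairing_alpha[OF i] by auto
      then show "f j = (if j = k + n then 2 * x (k + n) else 0)
        - (if j = k + 1 then if i < n then x (k + 1) else 0 else 0)
        - (if j = k + n - 1 then if 1 < i then x (k + n - 1) else 0 else 0)"
        using t i by (auto simp: f_def)
    qed
    also have "\<dots> = 2 * x (k + n) - (if i < n then x (k + 1) else 0)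
        - (if 1 < i then x (k + n - 1) else 0)"
      using i by (auto simp: sum_subtractf sum.delta)
    finally show ?thesis .
  qed
  moreover have "iota n (k + n) = i"
    using iota_add[OF k(2,1), of n] n1 i by simp
  then have "seq_sigma n x (k + n) = x (k + n) + (\<Sum>j | j > k + n \<and> x j \<noteq> 0. f j)"
    by (simp add: seq_sigma_def f_def)
  moreover have "seq_sigma n x k = x k + (\<Sum>j | j > k \<and> x j \<noteq> 0. f j)"
    by (simp add: seq_sigma_def f_def k)
  ultimately show ?thesis by linarith
qed

text \<open>
  The first \<open>i\<close> coordinates have the colours \<open>1, \<dots>, i\<close>, so only the last two of them are paired
  nontrivially with the coroot; the remaining terms are those of \<open>seq_sigma\<close> at \<open>i\<close>.
\<close>

lemma seq_sigma0_eq: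
  assumes i: "i \<in> {1..n}" and x0: "x 0 = 0" and fin: "finite {j. x j \<noteq> 0}"
  shows "seq_sigma0 n lam x i = seq_sigma n x i + x i - lam i - x (i - 1)"
proof -
  define f where "f j = coroot_pairing i (alpha n (iota n j)) * x j" for j
  have io: "iota n j = j" if "j \<in> {1..n}" for j using that by (auto simp: iota_def)
  have split: "{j. j \<ge> 1 \<and> x j \<noteq> 0} = {j\<in>{1..i}. x j \<noteq> 0} \<union> {j. j > i \<and> x j \<noteq> 0}"
    using i by auto
  have union: "sum f ({j\<in>{1..i}. x j \<noteq> 0} \<union> {j. j > i \<and> x j \<noteq> 0})
      = (\<Sum>j | j \<in> {1..i} \<and> x j \<noteq> 0. f j) + (\<Sum>j | j > i \<and> x j \<noteq> 0. f j)"
    using finite_subset[OF _ fin, of "{j. j > i \<and> x j \<noteq> 0}"]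
    by (intro sum.union_disjoint) auto
  have "(\<Sum>j | j \<ge> 1 \<and> x j \<noteq> 0. f j)
      = (\<Sum>j | j \<in> {1..i} \<and> x j \<noteq> 0. f j) + (\<Sum>j | j > i \<and> x j \<noteq> 0. f j)"
    by (simp only: split union)
  moreover have "(\<Sum>j | j \<in> {1..i} \<and> x j \<noteq> 0. f j) = 2 * x i - x (i - 1)"
  proof -
    have "(\<Sum>j | j \<in> {1..i} \<and> x j \<noteq> 0. f j) = (\<Sum>j = 1..i. f j)"
      by (intro sum.mono_neutral_left) (auto simp: f_def)
    also have "(\<Sum>j = 1..i. f j)
        = (\<Sum>j = 1..i. (if j = i then 2 * x i else 0) - (if j = i - 1 then x (i - 1) else 0))"
      using i by (intro sum.cong[OF refl]) (auto simp: f_def io coroot_pairing_alpha)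
    also have "\<dots> = 2 * x i - x (i - 1)"
      using i x0 by (auto simp: sum_subtractf sum.delta)
    finally show ?thesis .
  qed
  moreover have "seq_sigma n x i = x i + (\<Sum>j | j > i \<and> x j \<noteq> 0. f j)"
    using i by (simp add: seq_sigma_def f_def io)
  moreover have "seq_sigma0 n lam x i = - lam i + (\<Sum>j | j \<ge> 1 \<and> x j \<noteq> 0. f j)"
    by (simp add: seq_sigma0_def f_def coroot_pairing_def)
  ultimately show ?thesis by linarith
qed

context gt_pattern_of
begin

abbreviation "X \<equiv> varsigma n lam g"

lemma X_seq_index:
  assumes "i \<in> {1..n}" "1 \<le> j" shows "X (seq_index n i j) = Y i j - part n lam (j + i)"
  using xc_varsigma[OF triangular, of i j lam] assms by (simp add: xc_eq)

lemma X_zero: "n * n < m \<Longrightarrow> X m = 0"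
  using seq_zero_beyond[OF n1, of X m]
  by (simp add: X_seq_index Y_beyond)

lemma X_finite: "finite {j. X j \<noteq> 0}"
  by (rule finite_subset[of _ "{..n * n}"]) (use X_zero in \<open>auto simp: not_le\<close>, meson leI)

text \<open>
  Both sides satisfy the same recursion and vanish at \<open>j = n + 1\<close>.  The row lengths that \<open>varsigma\<close>
  subtracts enter the recursion as \<open>- p (j + i) - p (j + 1 + i) + p (j + i + 1) + p (j + i) = 0\<close>, where \<open>p\<close> stands
  for \<open>part n lam\<close>.
\<close>

lemma seq_sigma_eq_gt_sigma:
  assumes i: "i \<in> {1..n}" and j: "1 \<le> j" "j \<le> Suc n"
  shows "seq_sigma n X (seq_index n i j) = gt_sigma n lam g i j"
  using j(2,1)
proof (induction j rule: inc_induct)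
  case base
  have "X m = 0" if "m \<ge> seq_index n i (Suc n)" for m
    using that i by (intro X_zero) (auto simp: seq_index_def)
  then have "seq_sigma n X (seq_index n i (Suc n)) = 0"
    unfolding seq_sigma_def by (subst sum.neutral) auto
  then show ?case using sigma_Suc_n[of i] i by simp
next
  case (step j)
  let ?k = "seq_index n i j"
  have k: "1 \<le> ?k" "iota n ?k = i" using i iota_seq_index by (auto simp: seq_index_def)
  have 1: "(if i < n then X (?k + 1) else 0) = Y (Suc i) j - part n lam (j + Suc i)"
    using X_seq_index[of "Suc i" j] step(4) i Y_bottom[of "Suc i" j]
    by (auto simp: seq_index_def)
  have 2: "(if 1 < i then X (?k + n - 1) else 0) = Y (i - 1) (Suc j) - part n lam (j + i)"
  proof (cases "1 < i")
    case True
    then have "i - 1 \<in> {1..n}" "?k + n - 1 = seq_index n (i - 1) (Suc j)"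
      using i step(4) by (cases j; auto simp: seq_index_def ac_simps)+
    then show ?thesis using X_seq_index[of "i - 1" "Suc j"] True by simp
  next
    case False
    then show ?thesis using i by auto
  qed
  have "seq_sigma n X ?k = gt_sigma n lam g i (Suc j) + X ?k + X (?k + n)
    - (Y (Suc i) j - part n lam (j + Suc i)) - (Y (i - 1) (Suc j) - part n lam (j + i))"
    unfolding seq_sigma_rec[OF k n1 X_finite] 1 2
    using step seq_index_Suc[of j n i] by simp
  also have "\<dots> = gt_sigma n lam g i j"
    using step i by (subst sigma_rec[of i j])
      (simp_all add: X_seq_index seq_index_Suc[symmetric] del: gt_entry_Suc)
  finally show ?case .
qed

lemma seq_sigma_beyond:
  assumes i: "i \<in> {1..n}" and j: "n < j"
  shows "seq_sigma n X (seq_index n i j) = 0"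
proof -
  have "n * n < seq_index n i j"
  proof -
    have "n * n \<le> (j - 1) * n" using j by (intro mult_le_mono1) auto
    moreover have "0 < i" using i by simp
    ultimately show ?thesis unfolding seq_index_def by linarith
  qed
  then have "X m = 0" if "m \<ge> seq_index n i j" for m
    using that by (intro X_zero) simp
  then show ?thesis
    unfolding seq_sigma_def by (subst sum.neutral) auto
qed

lemma seq_sigma_le_gt_max:
  assumes "i \<in> {1..n}" "1 \<le> j" shows "seq_sigma n X (seq_index n i j) \<le> gt_max n lam g i"
  using assms seq_sigma_beyond[of i j] seq_sigma_eq_gt_sigma[of i j] gt_max_nonneg[of i]
    sigma_le_gt_max[of i j] by (cases "n < j") auto

text \<open>
  The coordinates with \<open>j > n\<close> only contribute the value 0, which does not exceed \<open>gt_max\<close>.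
\<close>

lemma seq_max_eq_gt_max:
  assumes i: "i \<in> {1..n}" shows "seq_max n X i = gt_max n lam g i"
  unfolding seq_max_def iota_eq_iff[OF i]
proof (rule Max_eqI)
  have "seq_sigma n X ` {k. \<exists>j\<ge>1. k = seq_index n i j}
      \<subseteq> insert 0 (gt_sigma n lam g i ` {1..n})"
  proof clarify
    fix j :: nat assume "1 \<le> j" "seq_sigma n X (seq_index n i j) \<notin> gt_sigma n lam g i ` {1..n}"
    then show "seq_sigma n X (seq_index n i j) = 0"
      using seq_sigma_beyond[OF i, of j] seq_sigma_eq_gt_sigma[OF i, of j] by (cases "n < j") auto
  qed
  then show "finite (seq_sigma n X ` {k. \<exists>j\<ge>1. k = seq_index n i j})"
    by (rule finite_subset) simp
  show "\<And>y. y \<in> seq_sigma n X ` {k. \<exists>j\<ge>1. k = seq_index n i j} \<Longrightarrow> y \<le> gt_max n lam g i"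
    using seq_sigma_le_gt_max[OF i] by auto
  obtain v where "v \<in> gt_M n lam g i" using peaks_nonempty[OF n1] gt_M_peaks by blast
  then have "v \<in> {1..n}" "seq_sigma n X (seq_index n i v) = gt_max n lam g i"
    using seq_sigma_eq_gt_sigma[OF i, of v] by (auto simp: gt_M_def)
  then show "gt_max n lam g i \<in> seq_sigma n X ` {k. \<exists>j\<ge>1. k = seq_index n i j}"
    by (metis (mono_tags, lifting) atLeastAtMost_iff image_eqI mem_Collect_eq)
qed

lemma seq_M_iff:
  assumes i: "i \<in> {1..n}"
  shows "k \<in> seq_M n X i \<longleftrightarrow> (\<exists>j\<ge>1. k = seq_index n i j \<and>
    (if j \<le> n then j \<in> gt_M n lam g i else gt_max n lam g i = 0))"
proof -
  have "k \<in> seq_M n X i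
      \<longleftrightarrow> (\<exists>j\<ge>1. k = seq_index n i j \<and> seq_sigma n X (seq_index n i j) = gt_max n lam g i)"
    using iota_eq_iff[OF i, of k] seq_max_eq_gt_max[OF i] unfolding seq_M_def by auto
  moreover have "seq_sigma n X (seq_index n i j) = gt_max n lam g i
      \<longleftrightarrow> (if j \<le> n then j \<in> gt_M n lam g i else gt_max n lam g i = 0)" if "1 \<le> j" for j
    using that seq_sigma_eq_gt_sigma[OF i that] seq_sigma_beyond[OF i, of j]
    by (auto simp: gt_M_def)
  ultimately show ?thesis by blast
qed

text \<open>
  If the maximum is 0, then \<open>seq_M\<close> also contains all coordinates with \<open>j > n\<close>; they are too large to
  affect its least element.
\<close>

lemma Least_seq_M:
  assumes i: "i \<in> {1..n}"
  shows "(LEAST k. k \<in> seq_M n X i) = seq_index n i (Min (gt_M n lam g i))"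
proof (rule Least_equality)
  let ?v = "Min (gt_M n lam g i)"
  have v: "?v \<in> gt_M n lam g i" "\<And>j. j \<in> gt_M n lam g i \<Longrightarrow> ?v \<le> j"
    using finite_peaks peaks_nonempty[OF n1] by (simp_all add: gt_M_peaks Min_in)
  then have "?v \<in> {1..n}" by (simp add: gt_M_def)
  then show "seq_index n i ?v \<in> seq_M n X i"
    using v(1) unfolding seq_M_iff[OF i] by auto
  fix k assume "k \<in> seq_M n X i"
  then obtain j where "k = seq_index n i j" "j \<in> gt_M n lam g i \<or> n < j"
    unfolding seq_M_iff[OF i] by (auto split: if_splits)
  then show "seq_index n i ?v \<le> k"
    using v(2)[of j] \<open>?v \<in> {1..n}\<close> by (auto intro!: seq_index_mono)
qed

lemma Max_seq_M:
  assumes i: "i \<in> {1..n}" and pos: "0 < gt_max n lam g i"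
  shows "Max (seq_M n X i) = seq_index n i (Max (gt_M n lam g i))"
proof (rule Max_eqI)
  let ?v = "Max (gt_M n lam g i)"
  have M: "k \<in> seq_M n X i \<longleftrightarrow> k \<in> seq_index n i ` gt_M n lam g i" for k
    unfolding seq_M_iff[OF i] using pos by (auto simp: gt_M_def)
  have fin: "finite (gt_M n lam g i)" "gt_M n lam g i \<noteq> {}"
    using finite_peaks peaks_nonempty[OF n1] by (simp_all add: gt_M_peaks)
  have "seq_M n X i = seq_index n i ` gt_M n lam g i" using M by blast
  then show "finite (seq_M n X i)" using fin by simp
  show "seq_index n i ?v \<in> seq_M n X i" using fin M by simp
  show "\<And>k. k \<in> seq_M n X i \<Longrightarrow> k \<le> seq_index n i ?v"
    using M fin by (auto intro!: seq_index_mono)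
qed

lemma seq_sigma0_eq_gt_sigma:
  assumes i: "i \<in> {1..n}" shows "seq_sigma0 n lam X i = gt_sigma n lam g i 0"
proof -
  have X0: "X 0 = 0" by (simp add: varsigma_def)
  have 1: "seq_index n i' 1 = i'" for i' by (simp add: seq_index_def)
  have "X (i - 1) = Y (i - 1) 1 - part n lam i"
  proof (cases "i = 1")
    case False
    then have "i - 1 \<in> {1..n}" using i by auto
    then show ?thesis using X_seq_index[of "i - 1" 1] 1[of "i - 1"] i by simp
  qed (use X0 in simp)
  then show ?thesis
    unfolding seq_sigma0_eq[OF i X0 X_finite]
    using seq_sigma_eq_gt_sigma[OF i, of 1] X_seq_index[OF i, of 1] sigma_rec[of i 0] i
      part_rec[of i n lam] Y_0[of i] Y_0[of "Suc i"] n1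
    by (simp add: 1[unfolded One_nat_def] del: gt_entry_Suc)
qed

text \<open>
  Both coefficients at \<open>i\<close> are the negative of the value at 0 of the respective \<open>\<sigma>\<close>.
\<close>

lemma Sigma_wt_eq_gt_wt: "Sigma_wt n lam X = gt_wt n lam g"
proof
  fix i
  show "Sigma_wt n lam X i = gt_wt n lam g i"
  proof (cases "i \<in> {1..n}")
    case True
    have "Sigma_wt n lam X i = - seq_sigma0 n lam X i"
      by (simp add: Sigma_wt_def seq_sigma0_def sum_weight_apply wscale_def coroot_pairing_def
          mult.commute)
    then show ?thesis
      using seq_sigma0_eq_gt_sigma[OF True] coroot_pairing_gt_wt[OF triangular True, of lam]
      by (simp add: coroot_pairing_def)
  next
    case False
    then show ?thesis
      using dom by (auto simp: Sigma_wt_def sum_weight_apply wscale_def alpha_def eps_def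
          gt_wt_outside dominant_weights_def weight_lattice_def)
  qed
qed

lemma varsigma_gt_add:
  assumes i: "i \<in> {1..n}" and v: "1 \<le> v" "v \<le> n + 1 - i"
  shows "varsigma n lam (gt_add g i v d)
    = X (seq_index n i v := X (seq_index n i v) + d)"
proof
  fix m
  show "varsigma n lam (gt_add g i v d) m = (X (seq_index n i v := X (seq_index n i v) + d)) m"
  proof (cases "m = seq_index n i v")
    case True
    then show ?thesis
      using i v iota_seq_index[OF i, of v] row_seq_index[OF i, of v]
      by (auto simp: varsigma_def gt_add_def Let_def seq_index_def)
  next
    case False
    then have "\<not> (iota n m = i \<and> (m - 1) div n + 1 = v)" if "m \<noteq> 0"
      using seq_index_iota[of m n] that by auto
    then show ?thesis using False by (auto simp: varsigma_def gt_add_def Let_def)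
  qed
qed

end

lemma varsigma_crystal_iso:
  assumes n1: "1 \<le> n" and dom: "lam \<in> dominant_weights n"
  shows "crystal_iso n (varsigma n lam) (GT_crystal n lam) (Sigma_crystal n lam)"
  unfolding crystal_iso_def
proof (intro conjI ballI)
  show "bij_betw (varsigma n lam) (cset (GT_crystal n lam)) (cset (Sigma_crystal n lam))"
    using bij_betw_varsigma[OF assms] by (simp add: GT_crystal_def Sigma_crystal_def)
next
  fix g assume "g \<in> cset (GT_crystal n lam)"
  then interpret gt_pattern_of n lam g using assms by unfold_locales (simp_all add: GT_crystal_def)
  show "cwt (Sigma_crystal n lam) X = cwt (GT_crystal n lam) g"
    by (simp add: GT_crystal_def Sigma_crystal_def Sigma_wt_eq_gt_wt)
  fix i assume i: "i \<in> {1..n}"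
  have mx: "max (seq_max n X i) (seq_sigma0 n lam X i) = gt_max n lam g i"
    using sigma_le_gt_max[of i 0] i by (simp add: seq_max_eq_gt_max seq_sigma0_eq_gt_sigma)
  show "ceps (Sigma_crystal n lam) i X = ceps (GT_crystal n lam) i g"
    "cphi (Sigma_crystal n lam) i X = cphi (GT_crystal n lam) i g"
    by (simp_all add: GT_crystal_def Sigma_crystal_def Sigma_wt_eq_gt_wt mx)
  show "cf (Sigma_crystal n lam) i X = map_option (varsigma n lam) (cf (GT_crystal n lam) i g)"
    using raise_in_GT(2)[OF i _ refl] raise_range[OF i _ refl]
    by (simp add: GT_crystal_def Sigma_crystal_def seq_max_eq_gt_max[OF i]
        seq_sigma0_eq_gt_sigma[OF i] Least_seq_M[OF i] varsigma_gt_add[OF i] Let_def)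
  show "ce (Sigma_crystal n lam) i X = map_option (varsigma n lam) (ce (GT_crystal n lam) i g)"
    using lower_in_GT(2)[OF i _ refl] lower_range[OF i _ refl] sigma_le_gt_max[of i 0] i
    by (simp add: GT_crystal_def Sigma_crystal_def seq_max_eq_gt_max[OF i]
        seq_sigma0_eq_gt_sigma[OF i] Max_seq_M[OF i] varsigma_gt_add[OF i] Let_def)
qed

section \<open>Patterns and reverse tableaux\<close>

text \<open>
  A way to derive inequalities between row lengths from implications between boxes.
\<close>

lemma int_le_by_nat:
  assumes "\<And>c. 1 \<le> c \<Longrightarrow> int c \<le> a \<Longrightarrow> int c \<le> b" and "0 \<le> b"
  shows "a \<le> b"
  using assms(1)[of "nat a"] assms(2) by (cases "1 \<le> a") auto

lemma down_closed_eq_atLeastAtMost: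
  assumes "finite S" "0 \<notin> S" and down: "\<And>c. 1 \<le> c \<Longrightarrow> Suc c \<in> S \<Longrightarrow> c \<in> S"
  shows "S = {1..card S}"
proof (cases "S = {}")
  case False
  have "c \<in> S" if "1 \<le> c" "c \<le> Max S" for c
    using that(2,1)
  proof (induction c rule: inc_induct)
    case base
    then show ?case using assms(1) False by simp
  next
    case (step c)
    then show ?case using down[of c] by simp
  qed
  moreover have "1 \<le> c \<and> c \<le> Max S" if "c \<in> S" for c
  proof -
    have "c \<noteq> 0" using that assms(2) by metis
    then show ?thesis using Max_ge[OF assms(1) that] by simp
  qed
  ultimately have S: "S = {1..Max S}"
    by (intro set_eqI) (simp only: atLeastAtMost_iff, blast)
  then have "card S = card {1..Max S}" by (rule arg_cong)
  then have "card S = Max S" by simp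
  then show ?thesis unfolding \<open>card S = Max S\<close> by (intro S)
qed simp

lemma boxes_iff: "(r, c) \<in> boxes n lam \<longleftrightarrow> r \<in> {1..n} \<and> 1 \<le> c \<and> int c \<le> part n lam r"
  by (auto simp: boxes_def)

lemma part_antimono:
  assumes "lam \<in> dominant_weights n" "1 \<le> i" "i \<le> j" shows "part n lam j \<le> part n lam i"
  using assms(3)
proof (induction j rule: dec_induct)
  case (step j)
  then show ?case using part_Suc_le[OF assms(1), of j] assms(2) by simp
qed simp

lemma boxes_up:
  assumes "lam \<in> dominant_weights n" "(Suc r, c) \<in> boxes n lam" "1 \<le> r"
  shows "(r, c) \<in> boxes n lam"
  using assms part_Suc_le[OF assms(1,3)] by (auto simp: boxes_iff)

lemma finite_boxes:
  assumes "lam \<in> dominant_weights n" shows "finite (boxes n lam)"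
proof (rule finite_subset)
  show "boxes n lam \<subseteq> {1..n} \<times> {1..nat (part n lam 1)}"
    using part_antimono[OF assms, of 1] by (force simp: boxes_def)
qed simp

lemma RSSYT_range: "S \<in> RSSYT n lam \<Longrightarrow> b \<in> boxes n lam \<Longrightarrow> S b \<in> {1..n + 1}"
  and RSSYT_outside: "S \<in> RSSYT n lam \<Longrightarrow> b \<notin> boxes n lam \<Longrightarrow> S b = 0"
  unfolding RSSYT_def fillings_def by blast+

lemma RSSYT_row:
  "S \<in> RSSYT n lam \<Longrightarrow> (r, c) \<in> boxes n lam \<Longrightarrow> (r, Suc c) \<in> boxes n lam
    \<Longrightarrow> S (r, Suc c) \<le> S (r, c)"
  by (simp add: RSSYT_def)

lemma RSSYT_column:
  "S \<in> RSSYT n lam \<Longrightarrow> (r, c) \<in> boxes n lam \<Longrightarrow> (Suc r, c) \<in> boxes n lam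
    \<Longrightarrow> S (Suc r, c) < S (r, c)"
  by (simp add: RSSYT_def)

context gt_pattern_of
begin

abbreviation "T \<equiv> psi n lam X"

lemma Y_antimono_row:
  assumes "1 \<le> k" "i \<le> i'" shows "Y i' k \<le> Y i k"
  using assms(2)
proof (induction i' rule: dec_induct)
  case (step m)
  then show ?case using row_le[OF assms(1), of m] by simp
qed simp

text \<open>
  The diagram \<open>\<Lambda>\<^sub>i\<close> has the entries of row \<open>i - 1\<close> of the pattern as its row lengths.
\<close>

lemma psi_row_eq:
  assumes "1 \<le> k" "i \<in> {1..n + 2}" shows "psi_row n lam X i k = Y (i - 1) k"
proof (cases "k \<le> n + 2 - i")
  case True
  then have "i - 1 \<le> n" using assms by auto
  then show ?thesis
    using True assms xc_varsigma[OF triangular, of "i - 1" k lam] by (auto simp: psi_row_def)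
next
  case False
  then have "Y (i - 1) k = 0"
    using assms by (auto simp: gt_entry_def intro!: triangularD[OF triangular])
  then show ?thesis using False by (simp add: psi_row_def)
qed

text \<open>
  The intervals from \<open>Y t r\<close> to \<open>Y (t - 1) r\<close> for \<open>t = 1, \<dots>, n + 1\<close> tile row \<open>r\<close> of the diagram, because
  \<open>Y i r\<close> decreases in \<open>i\<close>; so the description in \<open>psi\<close> is unique.
\<close>

lemma tab_eqI:
  assumes "(r, c) \<in> boxes n lam" "t \<in> {1..n + 1}" "Y t r < int c" "int c \<le> Y (t - 1) r"
  shows "T (r, c) = t"
proof -
  have r: "1 \<le> r" using assms(1) by (simp add: boxes_iff)
  have "(THE t. t \<in> {1..n + 1} \<and> psi_row n lam X (t + 1) r < int c \<and> int c \<le> psi_row n lam X t r) = t"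
  proof (rule the_equality)
    show "t \<in> {1..n + 1} \<and> psi_row n lam X (t + 1) r < int c \<and> int c \<le> psi_row n lam X t r"
      using assms r by (simp add: psi_row_eq del: gt_entry_Suc)
    fix t' assume "t' \<in> {1..n + 1} \<and> psi_row n lam X (t' + 1) r < int c \<and> int c \<le> psi_row n lam X t' r"
    then have t': "t' \<in> {1..n + 1}" "Y t' r < int c" "int c \<le> Y (t' - 1) r"
      using r by (auto simp: psi_row_eq simp del: gt_entry_Suc)
    have "\<not> t \<le> t' - 1" using Y_antimono_row[OF r, of t "t' - 1"] t' assms by auto
    moreover have "\<not> t' \<le> t - 1" using Y_antimono_row[OF r, of t' "t - 1"] t' assms by auto
    ultimately show "t' = t" using t' assms by auto
  qed
  then show ?thesis using assms(1) by (simp add: psi_def)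
qed

lemma tab_props:
  assumes b: "(r, c) \<in> boxes n lam"
  shows tab_range: "T (r, c) \<in> {1..n + 1}"
    and tab_lower: "Y (T (r, c)) r < int c" and tab_upper: "int c \<le> Y (T (r, c) - 1) r"
proof -
  have c: "int c \<le> Y 0 r" "\<not> int c \<le> Y (Suc n) r"
    using b Y_bottom[of "Suc n" r] by (auto simp: boxes_iff simp del: gt_entry_Suc)
  then obtain k where k: "k < Suc n" "\<forall>i\<le>k. int c \<le> Y i r" "\<not> int c \<le> Y (Suc k) r"
    using ex_least_nat_less[of "\<lambda>i. \<not> int c \<le> Y i r" "Suc n"] by blast
  then have "T (r, c) = Suc k" by (intro tab_eqI[OF b]) (auto simp del: gt_entry_Suc)
  then show "T (r, c) \<in> {1..n + 1}" "Y (T (r, c)) r < int c" "int c \<le> Y (T (r, c) - 1) r"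
    using k by (simp_all del: gt_entry_Suc)
qed

lemma tab_eq_iff:
  assumes "(r, c) \<in> boxes n lam" "t \<in> {1..n + 1}"
  shows "T (r, c) = t \<longleftrightarrow> Y t r < int c \<and> int c \<le> Y (t - 1) r"
  using tab_eqI[OF assms] tab_props[OF assms(1)] by auto

text \<open>
  The basic dictionary: the boxes with entries larger than \<open>i\<close> form the diagram whose row lengths are the
  row \<open>i\<close> of the pattern.
\<close>

lemma less_tab_iff:
  assumes b: "(r, c) \<in> boxes n lam"
  shows "i < T (r, c) \<longleftrightarrow> int c \<le> Y i r"
proof -
  have r: "1 \<le> r" using b by (simp add: boxes_iff)
  show ?thesis
  proof
    assume "i < T (r, c)"
    then have "Y (T (r, c) - 1) r \<le> Y i r" by (intro Y_antimono_row[OF r]) simp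
    then show "int c \<le> Y i r" using tab_upper[OF b] by simp
  next
    assume c: "int c \<le> Y i r"
    show "i < T (r, c)"
    proof (rule ccontr)
      assume "\<not> i < T (r, c)"
      then have "Y i r \<le> Y (T (r, c)) r" by (intro Y_antimono_row[OF r]) simp
      then show False using tab_lower[OF b] c by simp
    qed
  qed
qed

lemma tab_outside: "b \<notin> boxes n lam \<Longrightarrow> T b = 0"
  by (auto simp: psi_def split: prod.splits)

text \<open>
  Rows decrease weakly since the boxes with entries larger than \<open>i\<close> are left-justified; columns
  decrease strictly by \<open>Y t (r + 1) \<le> Y (t + 1) r\<close>.
\<close>

lemma tab_in_RSSYT: "T \<in> RSSYT n lam"
proof -
  have "T (r, c) \<ge> T (r, c + 1)" if "(r, c) \<in> boxes n lam" "(r, c + 1) \<in> boxes n lam" for r c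
    using less_tab_iff[OF that(1), of "T (r, c + 1) - 1"] tab_props[OF that(2)] by auto
  moreover have "T (r, c) > T (r + 1, c)" if b: "(r, c) \<in> boxes n lam" "(r + 1, c) \<in> boxes n lam" for r c
  proof -
    obtain t where t: "T (r + 1, c) = Suc t"
      using tab_range[OF b(2)] by (cases "T (r + 1, c)") auto
    have "int c \<le> Y t (Suc r)" using tab_upper[OF b(2)] t by simp
    also have "\<dots> \<le> Y (Suc t) r" using b(1) by (intro le_row) (simp add: boxes_iff)
    finally show ?thesis unfolding less_tab_iff[OF b(1)] t .
  qed
  ultimately show ?thesis
    using tab_range tab_outside by (auto simp: RSSYT_def fillings_def)
qed

end

definition gt_of_tab :: "nat \<Rightarrow> weight \<Rightarrow> tableau \<Rightarrow> gt_pattern" where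
  "gt_of_tab n lam T = (\<lambda>i r. if 1 \<le> i \<and> 1 \<le> r
    then int (card {c. (r, c) \<in> boxes n lam \<and> i < T (r, c)}) else 0)"

lemma (in gt_pattern_of) gt_of_tab_psi: "gt_of_tab n lam T = g"
proof (intro ext)
  fix i r
  show "gt_of_tab n lam T i r = g i r"
  proof (cases "1 \<le> i \<and> r \<in> {1..n}")
    case True
    have "int c \<le> part n lam r" if "int c \<le> Y i r" for c
      using that Y_antimono_row[of r 0 i] True by simp
    then have "{c. (r, c) \<in> boxes n lam \<and> i < T (r, c)} = {c. 1 \<le> c \<and> int c \<le> Y i r}"
      using True less_tab_iff[of r _ i] by (auto simp: boxes_iff)
    also have "\<dots> = {1..nat (Y i r)}" by auto
    finally show ?thesis
      using True Y_nonneg[of r i] by (simp add: gt_of_tab_def gt_entry_def)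
  next
    case False
    then have "g i r = 0" by (intro triangularD[OF triangular]) auto
    moreover have "{c. (r, c) \<in> boxes n lam \<and> i < T (r, c)} = {}" if "1 \<le> i"
      using that False by (auto simp: boxes_iff)
    then have "1 \<le> i \<Longrightarrow> card {c. (r, c) \<in> boxes n lam \<and> i < T (r, c)} = 0"
      by (simp only: card.empty)
    ultimately show ?thesis by (simp add: gt_of_tab_def)
  qed
qed

context
  fixes n lam S
  assumes dom: "lam \<in> dominant_weights n" and S: "S \<in> RSSYT n lam"
begin

text \<open>
  As the rows of \<open>S\<close> decrease, the boxes of a row with entry larger than \<open>i\<close> are the leftmost ones, and
  counting them is the same as recording the last column.  For \<open>i = 0\<close> the statement describes
  the diagram itself.
\<close>

lemma gt_of_tab_ge_iff:
  assumes "1 \<le> r" "1 \<le> c"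
  shows "int c \<le> gt_entry n lam (gt_of_tab n lam S) i r \<longleftrightarrow> (r, c) \<in> boxes n lam \<and> i < S (r, c)"
proof (cases i)
  case 0
  have "(r, c) \<in> boxes n lam \<longleftrightarrow> int c \<le> part n lam r"
    using assms by (cases "r \<le> n") (auto simp: boxes_iff)
  moreover have "(r, c) \<in> boxes n lam \<Longrightarrow> 0 < S (r, c)"
    using RSSYT_range[OF S, of "(r, c)"] by simp
  ultimately show ?thesis using 0 by auto
next
  case (Suc i')
  let ?C = "{c. (r, c) \<in> boxes n lam \<and> i < S (r, c)}"
  have "?C = {1..card ?C}"
  proof (rule down_closed_eq_atLeastAtMost)
    have "?C \<subseteq> snd ` boxes n lam" by force
    then show "finite ?C" using finite_boxes[OF dom] by (blast intro: finite_subset)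
    fix c assume c: "1 \<le> c" "Suc c \<in> ?C"
    then have "(r, c) \<in> boxes n lam" by (auto simp: boxes_iff)
    moreover from this have "S (r, Suc c) \<le> S (r, c)" using RSSYT_row[OF S] c(2) by simp
    ultimately show "c \<in> ?C" using c(2) by simp
  qed (auto simp: boxes_iff)
  then have "c \<in> ?C \<longleftrightarrow> c \<in> {1..card ?C}" by (rule arg_cong)
  then have "c \<le> card ?C \<longleftrightarrow> (r, c) \<in> boxes n lam \<and> i < S (r, c)" using assms by simp
  then show ?thesis using Suc assms by (simp add: gt_of_tab_def)
qed

text \<open>
  Entries in a column decrease strictly and start with at most \<open>n + 1\<close>; hence the pattern obtained from
  a tableau is triangular.
\<close>

lemma tab_plus_row_le:
  assumes "(r, c) \<in> boxes n lam" shows "S (r, c) + r \<le> n + 2"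
  using assms
proof (induction r)
  case (Suc r)
  show ?case
  proof (cases "r = 0")
    case True
    then show ?thesis using RSSYT_range[OF S Suc.prems] by simp
  next
    case False
    then have b: "(r, c) \<in> boxes n lam" using boxes_up[OF dom Suc.prems] by simp
    then have "S (Suc r, c) < S (r, c)" using RSSYT_column[OF S] Suc.prems by simp
    then show ?thesis using Suc.IH[OF b] by simp
  qed
qed (simp add: boxes_iff)

lemma gt_of_tab_in_GT: "gt_of_tab n lam S \<in> GT n lam"
proof -
  let ?g = "gt_of_tab n lam S"
  let ?Y = "gt_entry n lam ?g"
  have nonneg: "0 \<le> ?Y i r" if "1 \<le> r" for i r
    using part_nonneg[OF dom that] by (simp add: gt_entry_def gt_of_tab_def)
  have S_le: "S b \<le> n + 1" if "b \<in> boxes n lam" for b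
    using RSSYT_range[OF S that] by simp
  have "triangular n ?g"
    unfolding triangular_def
  proof (intro allI impI)
    fix i r assume "i = 0 \<or> n < i \<or> r = 0 \<or> n + 1 < i + r"
    then have "\<not> i < S (r, c)" if "1 \<le> i" "1 \<le> r" "(r, c) \<in> boxes n lam" for c
      using that(1,2) S_le[OF that(3)] tab_plus_row_le[OF that(3)] by linarith
    then have "{c. (r, c) \<in> boxes n lam \<and> i < S (r, c)} = {}" if "1 \<le> i" "1 \<le> r"
      using that by blast
    then have "1 \<le> i \<Longrightarrow> 1 \<le> r \<Longrightarrow> card {c. (r, c) \<in> boxes n lam \<and> i < S (r, c)} = 0"
      by (simp only: card.empty)
    then show "?g i r = 0" by (simp add: gt_of_tab_def)
  qed
  moreover have "interlacing ?Y"
    unfolding interlacing_def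
  proof (intro allI impI conjI)
    fix i r :: nat assume r: "1 \<le> r"
    show "?Y (Suc i) r \<le> ?Y i r"
    proof (rule int_le_by_nat)
      fix c :: nat assume c: "1 \<le> c" "int c \<le> ?Y (Suc i) r"
      then show "int c \<le> ?Y i r"
        unfolding gt_of_tab_ge_iff[OF r c(1)] by simp
    qed (rule nonneg[OF r])
    show "?Y i (Suc r) \<le> ?Y (Suc i) r"
    proof (rule int_le_by_nat)
      fix c :: nat assume c: "1 \<le> c" "int c \<le> ?Y i (Suc r)"
      have r': "1 \<le> Suc r" by simp
      have b: "(Suc r, c) \<in> boxes n lam" "i < S (Suc r, c)"
        using c(2) unfolding gt_of_tab_ge_iff[OF r' c(1)] by blast+
      have b': "(r, c) \<in> boxes n lam" using boxes_up[OF dom b(1) r] .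
      then have "S (Suc r, c) < S (r, c)" using RSSYT_column[OF S] b(1) by simp
      then show "int c \<le> ?Y (Suc i) r"
        using b(2) b' unfolding gt_of_tab_ge_iff[OF r c(1)] by simp
    qed (rule nonneg[OF r])
  qed
  ultimately show ?thesis using GT_iff_interlacing[OF dom] by blast
qed

lemma psi_gt_of_tab:
  assumes "1 \<le> n" shows "psi n lam (varsigma n lam (gt_of_tab n lam S)) = S"
proof
  interpret gt_pattern_of n lam "gt_of_tab n lam S"
    using assms dom gt_of_tab_in_GT by unfold_locales
  fix b
  show "psi n lam (varsigma n lam (gt_of_tab n lam S)) b = S b"
  proof (cases "b \<in> boxes n lam")
    case True
    obtain r c where b: "b = (r, c)" by force
    have rc: "1 \<le> r" "1 \<le> c" using True b by (auto simp: boxes_iff)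
    have "S b \<in> {1..n + 1}" by (rule RSSYT_range[OF S True])
    moreover from this have "\<not> int c \<le> Y (S b) r" "int c \<le> Y (S b - 1) r"
      using True gt_of_tab_ge_iff[OF rc] b by auto
    ultimately show ?thesis
      using True unfolding b by (intro tab_eqI) (simp_all only: not_le)
  next
    case False
    then show ?thesis using RSSYT_outside[OF S] tab_outside by simp
  qed
qed

end

lemma bij_betw_psi_varsigma:
  assumes n1: "1 \<le> n" and dom: "lam \<in> dominant_weights n"
  shows "bij_betw (psi n lam \<circ> varsigma n lam) (GT n lam) (RSSYT n lam)"
proof (rule bij_betw_byWitness[where f' = "gt_of_tab n lam"])
  note loc = gt_pattern_of.intro[OF n1 dom]
  show "\<forall>g\<in>GT n lam. gt_of_tab n lam ((psi n lam \<circ> varsigma n lam) g) = g"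
    using gt_pattern_of.gt_of_tab_psi loc by auto
  show "\<forall>S\<in>RSSYT n lam. (psi n lam \<circ> varsigma n lam) (gt_of_tab n lam S) = S"
    using psi_gt_of_tab[OF dom _ n1] by simp
  show "(psi n lam \<circ> varsigma n lam) ` GT n lam \<subseteq> RSSYT n lam"
    using gt_pattern_of.tab_in_RSSYT loc by auto
  show "gt_of_tab n lam ` RSSYT n lam \<subseteq> GT n lam"
    using gt_of_tab_in_GT[OF dom] by blast
qed

lemma inj_on_flip: "inj_on (flip n lam) (RSSYT n lam)"
proof (rule inj_onI, rule ext)
  fix S S' b assume S: "S \<in> RSSYT n lam" "S' \<in> RSSYT n lam" and eq: "flip n lam S = flip n lam S'"
  show "S b = S' b"
  proof (cases "b \<in> boxes n lam")
    case True
    then have "S b \<le> n + 1" "S' b \<le> n + 1" using S[THEN RSSYT_range, of b] by auto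
    then show ?thesis using fun_cong[OF eq, of b] True by (simp add: flip_def)
  qed (use S RSSYT_outside in \<open>metis\<close>)
qed

section \<open>Signatures of reverse tableaux\<close>

context gt_pattern_of
begin

lemma tab_wt_eq_gt_wt: "tab_wt n lam T = gt_wt n lam g"
proof -
  have "int (card {b \<in> boxes n lam. T b = i}) = gt_content n lam g i" if i: "i \<in> {1..n + 1}" for i
  proof -
    obtain i' where i': "i = Suc i'" using i by (cases i) auto
    have le: "Y i r \<le> Y i' r" "Y i' r \<le> part n lam r" "0 \<le> Y i r" if "1 \<le> r" for r
      using row_le[OF that, of i'] Y_antimono_row[OF that, of 0 i'] Y_nonneg[OF that, of i] i' by simp_all
    have "{b \<in> boxes n lam. T b = i} = (SIGMA r:{1..n}. {nat (Y i r)<..nat (Y i' r)})"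
    proof (intro set_eqI)
      fix b :: "nat \<times> nat"
      obtain r c where b: "b = (r, c)" by force
      have "(r, c) \<in> boxes n lam \<and> T (r, c) = i \<longleftrightarrow> r \<in> {1..n} \<and> Y i r < int c \<and> int c \<le> Y i' r"
        using tab_eq_iff[of r c i] i le[of r] unfolding boxes_iff i'
        by (cases "1 \<le> c") (auto simp del: gt_entry_Suc)
      then show "b \<in> {b \<in> boxes n lam. T b = i} \<longleftrightarrow> b \<in> (SIGMA r:{1..n}. {nat (Y i r)<..nat (Y i' r)})"
        using le[of r] unfolding b by (auto simp: nat_less_iff)
    qed
    then have "card {b \<in> boxes n lam. T b = i} = (\<Sum>r = 1..n. nat (Y i' r) - nat (Y i r))"
      by simp
    then have "int (card {b \<in> boxes n lam. T b = i})
        = (\<Sum>r = 1..n. int (nat (Y i' r) - nat (Y i r)))"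
      by simp
    also have "\<dots> = (\<Sum>r = 1..n. Y i' r - Y i r)"
    proof (rule sum.cong[OF refl])
      fix r assume "r \<in> {1..n}"
      then have "1 \<le> r" by simp
      from le[OF this] show "int (nat (Y i' r) - nat (Y i r)) = Y i' r - Y i r" by linarith
    qed
    also have "\<dots> = gt_content n lam g i"
      using Y_beyond[of "Suc n"] i' by (simp add: gt_content_def del: gt_entry_Suc)
    finally show ?thesis .
  qed
  then show ?thesis unfolding tab_wt_def gt_wt_def by (intro sum.cong) auto
qed

text \<open>
  The part of the signature of the flipped tableau that stems from column \<open>c\<close>, expressed by the rows
  of the pattern; \<open>word i c\<close> collects the columns from \<open>c\<close> down to 1, so the suffixes that consist of
  full columns are the words for smaller \<open>c\<close>.
\<close>

definition column :: "nat \<Rightarrow> nat \<Rightarrow> ((nat \<times> nat) \<times> bracket) list" where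
  "column i c = map (\<lambda>r. ((r, c), if int c \<le> Y i r then Plus else Minus))
    (filter (\<lambda>r. Y (Suc i) r < int c \<and> int c \<le> Y (i - 1) r) [1..<n + 1])"

definition word :: "nat \<Rightarrow> nat \<Rightarrow> ((nat \<times> nat) \<times> bracket) list" where
  "word i c = concat (map (column i) (rev [1..<c + 1]))"

lemma word_0 [simp]: "word i 0 = []"
  and word_Suc [simp]: "word i (Suc c) = column i (Suc c) @ word i c"
  by (simp_all add: word_def)

text \<open>
  Replacing entries \<open>a\<close> by \<open>n + 2 - a\<close> turns \<open>i + 1\<close> into \<open>n + 1 - i\<close>, read as a plus, and \<open>i\<close>
  into \<open>n + 2 - i\<close>, read as a minus.
\<close>

lemma signature_flip:
  assumes i: "i \<in> {1..n}"
  shows "signature n lam (n + 1 - i) (flip n lam T) = word i (nat (part n lam 1))"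
proof -
  let ?S = "flip n lam T" and ?m = "n + 1 - i"
  obtain i' where i': "i = Suc i'" using i by (cases i) auto
  have flip: "?S b = ?m \<longleftrightarrow> b \<in> boxes n lam \<and> T b = Suc i"
    "?S b = ?m + 1 \<longleftrightarrow> b \<in> boxes n lam \<and> T b = i" for b
    using i tab_range[of "fst b" "snd b"] by (auto simp: flip_def)
  have col: "map (\<lambda>b. (b, if ?S b = ?m then Plus else Minus)) (filter (\<lambda>b. ?S b = ?m \<or> ?S b = ?m + 1)
      (filter (\<lambda>b. b \<in> boxes n lam) (map (\<lambda>r. (r, c)) [1..<n + 1]))) = column i c" if c: "1 \<le> c" for c
  proof -
    have iff: "(r, c) \<in> boxes n lam \<and> (T (r, c) = Suc i \<or> T (r, c) = i)
      \<longleftrightarrow> Y (Suc i) r < int c \<and> int c \<le> Y (i - 1) r" if r: "r \<in> {1..n}" for r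
    proof -
      have "Y (Suc i) r \<le> Y i r" "Y i r \<le> Y i' r" "Y i' r \<le> part n lam r"
        using r row_le[of r i] row_le[of r i'] Y_antimono_row[of r 0 i'] i' by simp_all
      then show ?thesis
        using r c tab_eq_iff[of r c i] tab_eq_iff[of r c "Suc i"] i i'
        by (auto simp: boxes_iff simp del: gt_entry_Suc)
    qed
    have plus: "T (r, c) = Suc i \<longleftrightarrow> int c \<le> Y i r"
      if "(r, c) \<in> boxes n lam \<and> (T (r, c) = Suc i \<or> T (r, c) = i)" for r
      using less_tab_iff[of r c i] that by auto
    have "map (\<lambda>b. (b, if ?S b = ?m then Plus else Minus)) (filter (\<lambda>b. ?S b = ?m \<or> ?S b = ?m + 1)
      (filter (\<lambda>b. b \<in> boxes n lam) (map (\<lambda>r. (r, c)) [1..<n + 1])))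
      = map (\<lambda>r. ((r, c), if ?S (r, c) = ?m then Plus else Minus))
        (filter (\<lambda>r. (r, c) \<in> boxes n lam \<and> (?S (r, c) = ?m \<or> ?S (r, c) = ?m + 1)) [1..<n + 1])"
      by (simp add: filter_map o_def conj_commute)
    also have "filter (\<lambda>r. (r, c) \<in> boxes n lam \<and> (?S (r, c) = ?m \<or> ?S (r, c) = ?m + 1)) [1..<n + 1]
      = filter (\<lambda>r. Y (Suc i) r < int c \<and> int c \<le> Y (i - 1) r) [1..<n + 1]"
    proof (rule filter_cong[OF refl])
      fix r assume "r \<in> set [1..<n + 1]"
      then have "r \<in> {1..n}" by auto
      from iff[OF this] show "((r, c) \<in> boxes n lam \<and> (?S (r, c) = ?m \<or> ?S (r, c) = ?m + 1))
        = (Y (Suc i) r < int c \<and> int c \<le> Y (i - 1) r)"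
        unfolding flip by blast
    qed
    also have "map (\<lambda>r. ((r, c), if ?S (r, c) = ?m then Plus else Minus)) \<dots> = column i c"
      unfolding column_def
    proof (rule map_cong[OF refl])
      fix r assume "r \<in> set (filter (\<lambda>r. Y (Suc i) r < int c \<and> int c \<le> Y (i - 1) r) [1..<n + 1])"
      then have "(r, c) \<in> boxes n lam \<and> (T (r, c) = Suc i \<or> T (r, c) = i)"
        by (subst iff) auto
      from plus[OF this] this show "((r, c), if ?S (r, c) = ?m then Plus else Minus)
        = ((r, c), if int c \<le> Y i r then Plus else Minus)"
        unfolding flip by simp
    qed
    finally show ?thesis .
  qed
  have "signature n lam ?m ?S = concat (map (\<lambda>c. map (\<lambda>b. (b, if ?S b = ?m then Plus else Minus))
      (filter (\<lambda>b. ?S b = ?m \<or> ?S b = ?m + 1) (filter (\<lambda>b. b \<in> boxes n lam)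
        (map (\<lambda>r. (r, c)) [1..<n + 1])))) (rev [1..<nat (part n lam 1) + 1]))"
    by (simp only: signature_def reading_def filter_concat map_concat map_map o_def)
  also have "\<dots> = word i (nat (part n lam 1))"
    unfolding word_def by (intro arg_cong[where f = concat] map_cong[OF refl] col) auto
  finally show ?thesis .
qed

text \<open>
  For a column \<open>c\<close> in strip \<open>k\<close>, that is with \<open>Y i (k + 1) < c \<le> Y i k\<close> (no upper bound for
  \<open>k = 0\<close>), the entry in a row above \<open>k\<close> is larger than \<open>i + 1\<close> and the entry in a row below
  \<open>k + 1\<close> is smaller than \<open>i\<close>, by interlacing.  What remains is at most one plus, followed by at most one minus.
\<close>

lemma column_eq:
  assumes i: "i \<in> {1..n}" and k: "k \<le> n" "Y i (Suc k) < int c" "k = 0 \<or> int c \<le> Y i k"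
  shows "column i c = (if 1 \<le> k \<and> Y (Suc i) k < int c then [((k, c), Plus)] else [])
    @ (if int c \<le> Y (i - 1) (Suc k) then [((Suc k, c), Minus)] else [])"
proof -
  obtain i' where i': "i = Suc i'" using i by (cases i) auto
  let ?rs = "(if 1 \<le> k \<and> Y (Suc i) k < int c then [k] else [])
    @ (if int c \<le> Y (i - 1) (Suc k) then [Suc k] else [])"
  have pos: "0 < int c" using k(2) Y_nonneg[of "Suc k" i] by simp
  have "r \<in> set ?rs \<longleftrightarrow> r \<in> {1..n} \<and> Y (Suc i) r < int c \<and> int c \<le> Y (i - 1) r" for r
  proof -
    consider "r = 0" | "1 \<le> r" "r < k" | "r = k" "1 \<le> k" | "r = Suc k" | "Suc k < r" by linarith
    then show ?thesis
    proof cases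
      case 2
      then have "Y i k \<le> Y i (Suc r)" by (intro Y_antimono) auto
      also have "\<dots> \<le> Y (Suc i) r" using 2 by (intro le_row)
      finally show ?thesis using 2 k by auto
    next
      case 3
      then show ?thesis using k row_le[of k i'] i' by auto
    next
      case 4
      have "Y (Suc i) (Suc k) < int c" using k(2) row_le[of "Suc k" i] by simp
      moreover have "k < n" if "int c \<le> Y (i - 1) (Suc k)"
      proof (rule ccontr)
        assume "\<not> k < n"
        then show False using that pos Y_beyond[of "Suc k" "i - 1"] by simp
      qed
      ultimately show ?thesis using 4 by auto
    next
      case 5
      then obtain r' where r': "r = Suc r'" by (cases r) auto
      have "Y i' (Suc r') \<le> Y i r'" unfolding i' using 5 r' by (intro le_row) auto
      also have "\<dots> \<le> Y i (Suc k)" using 5 r' by (intro Y_antimono) auto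
      finally show ?thesis using 5 k r' i' by auto
    qed auto
  qed
  then have "{r \<in> {1..n}. Y (Suc i) r < int c \<and> int c \<le> Y (i - 1) r} = set ?rs"
    by blast
  moreover have "set [1..<n + 1] = {1..n}" by auto
  ultimately have set_eq:
    "set (filter (\<lambda>r. Y (Suc i) r < int c \<and> int c \<le> Y (i - 1) r) [1..<n + 1]) = set ?rs"
    by (simp only: set_filter)
  have rs: "filter (\<lambda>r. Y (Suc i) r < int c \<and> int c \<le> Y (i - 1) r) [1..<n + 1] = ?rs"
  proof (rule sorted_distinct_set_unique[OF _ _ _ _ set_eq])
    show "sorted (filter (\<lambda>r. Y (Suc i) r < int c \<and> int c \<le> Y (i - 1) r) [1..<n + 1])"
      by (intro sorted_wrt_filter sorted_upt)
    show "distinct (filter (\<lambda>r. Y (Suc i) r < int c \<and> int c \<le> Y (i - 1) r) [1..<n + 1])"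
      by (intro distinct_filter distinct_upt)
  qed simp_all
  have "1 \<le> k \<Longrightarrow> int c \<le> Y i k" using k(3) by auto
  then show ?thesis unfolding column_def rs using k(2) by auto
qed

lemma strip_exists:
  assumes "i \<in> {1..n}" "1 \<le> c"
  obtains k where "k \<le> n" "Y i (Suc k) < int c" "k = 0 \<or> int c \<le> Y i k"
proof -
  have ex: "Y i (Suc n) < int c" using Y_beyond[of "Suc n" i] assms by simp
  define k where "k = (LEAST k. Y i (Suc k) < int c)"
  have "Y i (Suc k) < int c" unfolding k_def by (rule LeastI[of _ n]) (rule ex)
  moreover have "k \<le> n" unfolding k_def by (rule Least_le) (rule ex)
  moreover have "k = 0 \<or> int c \<le> Y i k"
  proof (cases k)
    case (Suc k')
    then have "\<not> Y i (Suc k') < int c" unfolding k_def by (intro not_less_Least) simp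
    then show ?thesis using Suc by simp
  qed simp
  ultimately show ?thesis using that by blast
qed

text \<open>
  Inside strip \<open>k\<close> the minuses occupy the left part of row \<open>k + 1\<close>, and the pluses the right part of row
  \<open>k\<close>; their numbers up to column \<open>c\<close> are the two correction terms.  Going through one strip column by
  column and then passing to the next strip on its right reproduces the recursion of \<open>gt_sigma\<close>.
\<close>

lemma balance_word:
  assumes i: "i \<in> {1..n}" and k: "k \<le> n" "Y i (Suc k) \<le> int c" "k = 0 \<or> int c \<le> Y i k"
  shows "balance (word i c) = gt_sigma n lam g i (Suc k)
    + (if k = 0 then 0 else max 0 (int c - Y (Suc i) k))
    - (min (int c) (Y (i - 1) (Suc k)) - Y i (Suc k))"
proof -
  obtain i' where i': "i = Suc i'" using i by (cases i) auto
  define H where "H k c = gt_sigma n lam g i (Suc k)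
    + (if k = 0 then 0 else max 0 (int c - Y (Suc i) k))
    - (min (int c) (Y (i - 1) (Suc k)) - Y i (Suc k))" for k c
  \<comment> \<open>within one strip, by induction on the column, starting from its left end\<close>
  have strip: "balance (word i c) = H k c"
    if base: "balance (word i (nat (Y i (Suc k)))) = gt_sigma n lam g i (Suc k)"
      and k: "k \<le> n" "Y i (Suc k) \<le> int c" "k = 0 \<or> int c \<le> Y i k" for k c
  proof -
    have le: "nat (Y i (Suc k)) \<le> c" using k(2) by simp
    then show ?thesis using k(3)
    proof (induction c rule: dec_induct)
      case base
      have "Y i (Suc k) \<le> Y i' (Suc k)" using row_le[of "Suc k" i'] i' by simp
      moreover have "k = 0 \<or> Y i (Suc k) \<le> Y (Suc i) k" using le_row[of k i] by (cases "k = 0") auto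
      ultimately show ?case
        using \<open>balance (word i (nat (Y i (Suc k)))) = _\<close> Y_nonneg[of "Suc k" i] i'
        by (auto simp: H_def simp del: gt_entry_Suc)
    next
      case (step c)
      have "Y i (Suc k) < int (Suc c)" using step(1) by linarith
      note col = column_eq[OF i k(1) this step.prems]
      have IH: "balance (word i c) = H k c" using step by auto
      show ?case
        unfolding word_Suc balance_simps IH col by (auto simp: H_def max_def min_def simp del: gt_entry_Suc)
    qed
  qed
  \<comment> \<open>the right end of strip \<open>k + 1\<close> is the left end of strip \<open>k\<close>\<close>
  have "balance (word i (nat (Y i (Suc k)))) = gt_sigma n lam g i (Suc k)"
    using k(1)
  proof (induction k rule: inc_induct)
    case base
    then show ?case using Y_beyond[of "Suc n" i] sigma_Suc_n[of i] i by simp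
  next
    case (step k)
    let ?c = "nat (Y i (Suc k))"
    have c: "int ?c = Y i (Suc k)" using Y_nonneg[of "Suc k" i] by simp
    have "Y i (Suc (Suc k)) \<le> Y i (Suc k)" by (intro Y_antimono) auto
    then have "balance (word i ?c) = H (Suc k) ?c"
      using step c by (intro strip) auto
    also have "\<dots> = gt_sigma n lam g i (Suc k)"
      using sigma_rec[of i "Suc k"] i step(2) row_le[of "Suc k" i] le_row[of "Suc k" i'] i'
      by (simp add: H_def c Y_nonneg del: gt_entry_Suc)
    finally show ?case .
  qed
  from strip[OF this k] show ?thesis by (simp only: H_def)
qed

lemma strip_inequalities:
  assumes "i \<in> {1..n}"
  shows "Y i (Suc k) \<le> Y (i - 1) (Suc k)"
    and "1 \<le> k \<Longrightarrow> Y i (Suc k) \<le> Y (Suc i) k"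
    and "1 \<le> k \<Longrightarrow> Y (Suc i) k \<le> Y i k"
    and "1 \<le> k \<Longrightarrow> Y (i - 1) (Suc k) \<le> Y i k"
proof -
  obtain i' where i': "i = Suc i'" using assms by (cases i) auto
  show "Y i (Suc k) \<le> Y (i - 1) (Suc k)"
    and "1 \<le> k \<Longrightarrow> Y i (Suc k) \<le> Y (Suc i) k"
    and "1 \<le> k \<Longrightarrow> Y (Suc i) k \<le> Y i k"
    and "1 \<le> k \<Longrightarrow> Y (i - 1) (Suc k) \<le> Y i k"
    using row_le[of "Suc k" i'] row_le[of k i] le_row[of k i] le_row[of k i'] i' by simp_all
qed

text \<open>
  As a function of \<open>c\<close> the balance has at first steps \<open>-1\<close>, then 0, then \<open>+1\<close>, so it is convex on a strip
  and bounded by its values at the two ends.  If one of these lies strictly below the bound, the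
  bound can be attained at the opposite end only.  Strip 0 has no pluses and so no increasing part.
\<close>

lemma balance_word_bounds:
  assumes i: "i \<in> {1..n}" and k: "k \<le> n" "Y i (Suc k) < int c" "k = 0 \<or> int c \<le> Y i k"
    and s: "gt_sigma n lam g i (Suc k) \<le> m" "gt_sigma n lam g i k \<le> m"
  shows "balance (word i c) \<le> m"
    and "gt_sigma n lam g i k < m \<Longrightarrow> balance (word i c) < m"
    and "gt_sigma n lam g i (Suc k) < m \<Longrightarrow> k \<noteq> 0 \<Longrightarrow> int c < Y i k \<Longrightarrow> balance (word i c) < m"
proof -
  \<comment> \<open>\<open>L\<close> and \<open>R\<close> are the ends of the strip; the pluses start after \<open>A\<close>, the minuses end at \<open>B\<close>\<close>
  define L A B R s0 s1 where d: "L = Y i (Suc k)" "A = Y (Suc i) k" "B = Y (i - 1) (Suc k)" "R = Y i k"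
    "s0 = gt_sigma n lam g i k" "s1 = gt_sigma n lam g i (Suc k)"
  have bal: "balance (word i c) = s1 + (if k = 0 then 0 else max 0 (int c - A)) - (min (int c) B - L)"
    unfolding d by (rule balance_word) (use assms in auto)
  have rec: "s0 = s1 + (R - A) - (B - L)" unfolding d using sigma_rec[of i k] i k by simp
  have k0: "R = 0 \<and> A = 0" if "k = 0" using that Y_0[of i] Y_0[of "Suc i"] i by (simp add: d)
  have ineq: "L \<le> B" "k \<noteq> 0 \<Longrightarrow> L \<le> A \<and> A \<le> R \<and> B \<le> R"
    using strip_inequalities[OF i, of k] unfolding d by auto
  have c: "L < int c" "k = 0 \<or> int c \<le> R" using k by (auto simp: d)
  have s': "s1 \<le> m" "s0 \<le> m" using s by (auto simp: d)
  show "balance (word i c) \<le> m"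
    using bal rec k0 ineq c s' by (auto simp: max_def min_def split: if_splits)
  show "balance (word i c) < m" if "gt_sigma n lam g i k < m"
    using that[folded d] bal rec k0 ineq c s' by (auto simp: max_def min_def split: if_splits)
  show "balance (word i c) < m" if "gt_sigma n lam g i (Suc k) < m" "k \<noteq> 0" "int c < Y i k"
    using that[folded d] bal rec ineq c s' by (auto simp: max_def min_def split: if_splits)
qed

lemma balance_word_le:
  assumes i: "i \<in> {1..n}" shows "balance (word i c) \<le> gt_max n lam g i"
proof (cases "c = 0")
  case True
  then show ?thesis using gt_max_nonneg[of i] i by simp
next
  case False
  then obtain k where k: "k \<le> n" "Y i (Suc k) < int c" "k = 0 \<or> int c \<le> Y i k"
    using strip_exists[OF i, of c] by (metis One_nat_def Suc_leI not_gr_zero)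
  then show ?thesis
    using sigma_le_gt_max[of i] i by (intro balance_word_bounds(1)[OF i k]) auto
qed

text \<open>
  To the right of column \<open>Y i v\<close> all strips have their right end strictly below the maximum, as \<open>v\<close> is the first peak.
\<close>

lemma balance_word_less_raise:
  assumes i: "i \<in> {1..n}" and less: "gt_sigma n lam g i 0 < gt_max n lam g i"
    and v: "v = Min (gt_M n lam g i)" and c: "Y i v < int c"
  shows "balance (word i c) < gt_max n lam g i"
proof -
  note r = raise[OF i less v]
  have "1 \<le> c" using c Y_nonneg[of v i] r(1) by auto
  then obtain k where k: "k \<le> n" "Y i (Suc k) < int c" "k = 0 \<or> int c \<le> Y i k"
    using strip_exists[OF i] by blast
  have "k < v"
  proof (rule ccontr)
    assume "\<not> k < v"
    then have "k \<noteq> 0" "Y i k \<le> Y i v" using r(1) by (auto intro: Y_antimono)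
    then show False using c k(3) by auto
  qed
  then show ?thesis
    using sigma_le_gt_max[of i] i k(1) r(3)[of k]
    by (intro balance_word_bounds(2)[OF i k]) auto
qed

text \<open>
  To the left of column \<open>Y i v\<close> all strips but one have their right end strictly below the maximum, as
  \<open>v\<close> is the last peak; in the strip that ends at \<open>Y i v\<close> the left end is.
\<close>

lemma balance_word_less_lower:
  assumes i: "i \<in> {1..n}" and pos: "0 < gt_max n lam g i"
    and v: "v = Max (gt_M n lam g i)" and c: "int c < Y i v"
  shows "balance (word i c) < gt_max n lam g i"
proof (cases "c = 0")
  case True
  then show ?thesis using pos by simp
next
  case False
  note l = lower[OF i pos v]
  obtain k where k: "k \<le> n" "Y i (Suc k) < int c" "k = 0 \<or> int c \<le> Y i k"
    using strip_exists[OF i, of c] False by (metis One_nat_def Suc_leI not_gr_zero)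
  have "v \<le> k"
  proof (rule ccontr)
    assume "\<not> v \<le> k"
    then have "Y i v \<le> Y i (Suc k)" by (intro Y_antimono) auto
    then show False using c k(2) by auto
  qed
  show ?thesis
  proof (cases "v = k")
    case True
    then show ?thesis
      using sigma_le_gt_max[of i] i k(1) l(1) l(3)[of "Suc k"] c
      by (intro balance_word_bounds(3)[OF i k]) auto
  next
    case False
    then show ?thesis
      using sigma_le_gt_max[of i] i k(1) l(3)[of k] \<open>v \<le> k\<close>
      by (intro balance_word_bounds(2)[OF i k]) auto
  qed
qed

lemma suffix_word_word: "c \<le> d \<Longrightarrow> suffix (word i c) (word i d)"
  by (induction d rule: dec_induct) (auto simp: suffix_appendI)

text \<open>
  A column contributes at most a plus and a minus, in this order.  A suffix that starts within a column
  therefore starts with a minus, and such a suffix never has maximal balance.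
\<close>

lemma suffix_word:
  assumes i: "i \<in> {1..n}" and "suffix x (word i d)"
  shows "(\<exists>c\<le>d. x = word i c) \<or> (\<exists>b c. c < d \<and> x = (b, Minus) # word i c)"
  using assms(2)
proof (induction d)
  case (Suc d)
  obtain k where k: "k \<le> n" "Y i (Suc k) < int (Suc d)" "k = 0 \<or> int (Suc d) \<le> Y i k"
    using strip_exists[OF i, of "Suc d"] by (metis One_nat_def Suc_leI zero_less_Suc)
  define p where "p = (if 1 \<le> k \<and> Y (Suc i) k < int (Suc d) then [((k, Suc d), Plus)] else [])"
  define m where "m = (if int (Suc d) \<le> Y (i - 1) (Suc k) then [((Suc k, Suc d), Minus)] else [])"
  have col: "column i (Suc d) = p @ m" unfolding p_def m_def by (rule column_eq[OF i k])
  have "p = [] \<or> (\<exists>q. p = [q])" "m = [] \<or> (\<exists>b. m = [(b, Minus)])"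
    by (simp_all add: p_def m_def)
  then have "x = word i (Suc d) \<or> (\<exists>b. x = (b, Minus) # word i d) \<or> suffix x (word i d)"
    using Suc.prems unfolding word_Suc col by (elim disjE exE) (auto simp: suffix_Cons)
  then show ?case
  proof (elim disjE exE)
    assume "x = word i (Suc d)"
    then show ?thesis by (blast intro: order_refl)
  next
    fix b assume "x = (b, Minus) # word i d"
    then show ?thesis by (blast intro: lessI)
  next
    assume "suffix x (word i d)"
    then show ?thesis using Suc.IH by (blast intro: le_SucI less_SucI)
  qed
qed simp

lemma suffix_word_less_length:
  assumes "length (word i c) < length (word i d)" shows "c < d"
  using assms suffix_length_le[OF suffix_word_word[of d c i]] by (meson leD leI)

lemma balance_suffix_word:
  assumes i: "i \<in> {1..n}" and "suffix x (word i d)"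
  shows "balance x \<le> gt_max n lam g i"
  using suffix_word[OF assms]
proof (elim disjE exE conjE)
  fix c assume "x = word i c"
  then show ?thesis using balance_word_le[OF i] by simp
next
  fix b c assume "x = (b, Minus) # word i c"
  then show ?thesis using balance_word_le[OF i, of c] by simp
qed

lemma balance_word_row:
  assumes i: "i \<in> {1..n}" and v: "v \<in> {1..n}"
  shows "balance (word i (nat (Y i v))) = gt_sigma n lam g i v"
proof -
  obtain w where w: "v = Suc w" using v by (cases v) auto
  have "int (nat (Y i v)) = Y i v" using Y_nonneg[of v i] v by simp
  moreover have "w = 0 \<or> Y i v \<le> Y i w" using w Y_antimono[of w v i] by (cases "w = 0") auto
  ultimately show ?thesis
    using strip_inequalities[OF i, of w] v w by (subst balance_word[OF i, of w]) auto
qed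

lemma row_le_first: "1 \<le> v \<Longrightarrow> nat (Y i v) \<le> nat (part n lam 1)"
  using Y_antimono[of 1 v i] Y_antimono_row[of 1 0 i] by simp

lemma pluses_flip:
  assumes "i \<in> {1..n}"
  shows "pluses n lam (n + 1 - i) (flip n lam T) = unpaired Plus (word i (nat (part n lam 1)))"
  unfolding pluses_def signature_flip[OF assms] unpaired_def ..

lemma minuses_flip:
  assumes "i \<in> {1..n}"
  shows "minuses n lam (n + 1 - i) (flip n lam T) = unpaired Minus (word i (nat (part n lam 1)))"
  unfolding minuses_def signature_flip[OF assms] unpaired_def ..

text \<open>
  The maximal suffix balance is attained by the columns up to \<open>Y i v\<close> for any peak \<open>v\<close>.
\<close>

lemma length_pluses_flip:
  assumes i: "i \<in> {1..n}"
  shows "int (length (pluses n lam (n + 1 - i) (flip n lam T))) = gt_max n lam g i"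
proof -
  obtain v where "v \<in> gt_M n lam g i" using peaks_nonempty[OF n1] gt_M_peaks by blast
  then have v: "v \<in> {1..n}" "gt_sigma n lam g i v = gt_max n lam g i" by (auto simp: gt_M_def)
  have "int (length (unpaired Plus (word i (nat (part n lam 1))))) = gt_max n lam g i"
    using v balance_suffix_word[OF i] balance_word_row[OF i v(1)] row_le_first[of v i]
    by (intro length_unpaired_Plus[of _ _ "word i (nat (Y i v))"] suffix_word_word) auto
  then show ?thesis unfolding pluses_flip[OF i] .
qed

text \<open>
  The balance of the whole word is \<open>gt_sigma\<close> at 0.
\<close>

lemma length_minuses_flip:
  assumes i: "i \<in> {1..n}"
  shows "int (length (minuses n lam (n + 1 - i) (flip n lam T)))
    = gt_max n lam g i - gt_sigma n lam g i 0"
proof -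
  let ?c = "nat (part n lam 1)"
  have c: "int ?c = part n lam 1" using part_nonneg[OF dom, of 1] by simp
  have "Y i 1 \<le> part n lam 1" "Y (i - 1) 1 \<le> part n lam 1"
    using Y_antimono_row[of 1 0 i] Y_antimono_row[of 1 0 "i - 1"] by simp_all
  then have "balance (word i ?c) = gt_sigma n lam g i 0"
    using balance_word[OF i, of 0 ?c] sigma_rec[of i 0] i Y_0[of i] Y_0[of "Suc i"]
    by (simp add: c[unfolded One_nat_def] del: gt_entry_Suc)
  then show ?thesis
    using balance_unpaired[of "word i ?c"] length_pluses_flip[OF i]
    unfolding minuses_flip[OF i] pluses_flip[OF i] by linarith
qed

text \<open>
  The longest suffix of maximal balance consists of the columns up to \<open>Y i v\<close> for the first peak \<open>v\<close>.
  Since \<open>Y i v < Y (i - 1) v\<close>, the next column contains a minus in row \<open>v\<close>, and it is the last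
  bracket of that column.
\<close>

lemma last_minuses_flip:
  assumes i: "i \<in> {1..n}" and less: "gt_sigma n lam g i 0 < gt_max n lam g i"
    and v: "v = Min (gt_M n lam g i)"
  shows "minuses n lam (n + 1 - i) (flip n lam T) \<noteq> []
    \<and> last (minuses n lam (n + 1 - i) (flip n lam T)) = (v, Suc (nat (Y i v)))"
proof -
  note r = raise[OF i less v]
  let ?c = "nat (Y i v)" and ?d = "nat (part n lam 1)"
  have c: "int ?c = Y i v" using Y_nonneg[of v i] r(1) by simp
  obtain w where w: "v = Suc w" using r(1) by (cases v) auto
  have "int (Suc ?c) \<le> Y (i - 1) v" using r(4) c by simp
  moreover have "w = 0 \<or> int (Suc ?c) \<le> Y i w"
    using calculation strip_inequalities(4)[OF i, of w] w by force
  ultimately have "suffix [((v, Suc ?c), Minus)] (column i (Suc ?c))"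
    using r(1) c w by (subst column_eq[OF i, of w]) (auto simp: suffix_def)
  then have 1: "suffix (((v, Suc ?c), Minus) # word i ?c) (word i (Suc ?c))"
    by (auto simp: suffix_def)
  have "Y (i - 1) v \<le> part n lam 1"
    using Y_antimono[of 1 v "i - 1"] Y_antimono_row[of 1 0 "i - 1"] r(1) by simp
  then have "Suc ?c \<le> ?d" using r(4) c by linarith
  then have suf: "suffix (((v, Suc ?c), Minus) # word i ?c) (word i ?d)"
    using 1 suffix_word_word suffix_order.trans by blast
  have bal: "balance (word i ?c) = gt_max n lam g i"
    using balance_word_row[OF i r(1)] r(2) by simp
  have "unpaired Minus (word i ?d) \<noteq> [] \<and> last (unpaired Minus (word i ?d)) = (v, Suc ?c)"
  proof (rule last_unpaired_Minus[OF suf])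
    fix x assume x: "suffix x (word i ?d)"
    show "balance x \<le> balance (word i ?c)" using balance_suffix_word[OF i x] bal by simp
    assume len: "length (word i ?c) < length x"
    from suffix_word[OF i x] show "balance x < balance (word i ?c)"
    proof (elim disjE exE conjE)
      fix c' assume x: "x = word i c'"
      then have "Y i v < int c'" using suffix_word_less_length[of i ?c c'] len c by auto
      then show ?thesis using balance_word_less_raise[OF i less v] bal x by simp
    next
      fix b c' assume "x = (b, Minus) # word i c'"
      then show ?thesis using balance_word_le[OF i, of c'] bal by simp
    qed
  qed
  then show ?thesis unfolding minuses_flip[OF i] .
qed

text \<open>
  The shortest suffix of maximal balance consists of the columns up to \<open>Y i v\<close> for the last peak \<open>v\<close>.
  By the inequalities of \<open>lower\<close> its first column is a single plus in row \<open>v\<close>.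
\<close>

lemma hd_pluses_flip:
  assumes i: "i \<in> {1..n}" and pos: "0 < gt_max n lam g i"
    and v: "v = Max (gt_M n lam g i)"
  shows "pluses n lam (n + 1 - i) (flip n lam T) \<noteq> []
    \<and> hd (pluses n lam (n + 1 - i) (flip n lam T)) = (v, nat (Y i v))"
proof -
  note l = lower[OF i pos v]
  let ?c = "nat (Y i v)" and ?d = "nat (part n lam 1)"
  have pos': "0 < Y i v" using l(4) Y_nonneg[of v "Suc i"] l(1) by auto
  then obtain c' where c': "?c = Suc c'" by (cases ?c) auto
  have c: "int ?c = Y i v" "int c' < Y i v" using pos' c' by linarith+
  have "Y i (Suc v) < int ?c" using l(5) c strip_inequalities(1)[OF i, of v] by simp
  then have "column i ?c = [((v, ?c), Plus)]"
    using l c by (subst column_eq[OF i, of v]) auto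
  then have word: "word i ?c = ((v, ?c), Plus) # word i c'" by (simp add: c')
  have "suffix (word i ?c) (word i ?d)"
    using l(1) by (intro suffix_word_word row_le_first) simp
  then have suf: "suffix (((v, ?c), Plus) # word i c') (word i ?d)"
    unfolding word .
  have bal: "balance (word i c') + 1 = gt_max n lam g i"
    using balance_word_row[OF i l(1)] l(2) word by simp
  have "unpaired Plus (word i ?d) \<noteq> [] \<and> hd (unpaired Plus (word i ?d)) = (v, ?c)"
  proof (rule hd_unpaired_Plus[OF suf])
    fix x assume x: "suffix x (word i ?d)"
    show "balance x \<le> balance (word i c') + 1" using balance_suffix_word[OF i x] bal by simp
    assume len: "length x \<le> length (word i c')"
    from suffix_word[OF i x] show "balance x \<le> balance (word i c')"
    proof (elim disjE exE conjE)
      fix d assume x: "x = word i d"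
      then have "length (word i d) < length (word i ?c)" using len word by simp
      then have "int d < Y i v" using suffix_word_less_length[of i d ?c] c by linarith
      then show ?thesis using balance_word_less_lower[OF i pos v] bal x by force
    next
      fix b d assume "x = (b, Minus) # word i d"
      then show ?thesis using balance_word_le[OF i, of d] bal by simp
    qed
  qed
  then show ?thesis unfolding pluses_flip[OF i] .
qed

text \<open>
  Enlarging row \<open>v\<close> of the diagram of entries larger than \<open>i\<close> by one box turns the leftmost \<open>i\<close> of that
  row into \<open>i + 1\<close>.
\<close>

lemma psi_raise:
  assumes i: "i \<in> {1..n}" and less: "gt_sigma n lam g i 0 < gt_max n lam g i"
    and v: "v = Min (gt_M n lam g i)" and b: "b = (v, Suc (nat (Y i v)))"
  shows "b \<in> boxes n lam" and "psi n lam (varsigma n lam (gt_add g i v 1)) = T(b := Suc i)"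
proof -
  note r = raise[OF i less v]
  interpret g': gt_pattern_of n lam "gt_add g i v 1"
    using n1 dom raise_in_GT(1)[OF i less v] by unfold_locales
  have c: "int (nat (Y i v)) = Y i v" using Y_nonneg[of v i] r(1) by simp
  have "Y (i - 1) v \<le> part n lam v" using Y_antimono_row[of v 0 "i - 1"] r(1) by simp
  then show box: "b \<in> boxes n lam" using r(1,4) c by (auto simp: b boxes_iff)
  show "psi n lam (varsigma n lam (gt_add g i v 1)) = T(b := Suc i)"
  proof
    fix b'
    show "psi n lam (varsigma n lam (gt_add g i v 1)) b' = (T(b := Suc i)) b'"
    proof (cases "b' \<in> boxes n lam")
      case True
      obtain r c where b': "b' = (r, c)" by force
      show ?thesis
      proof (cases "b' = b")
        case bb: True
        have "Y (Suc i) v \<le> Y i v" using row_le[of v i] r(1) by simp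
        then show ?thesis
          using True i bb b c box unfolding bb b fun_upd_same
          by (intro g'.tab_eqI) (auto simp: gt_entry_add simp del: gt_entry_Suc)
      next
        case False
        have "\<not> (r = v \<and> c = Suc (nat (Y i v)))" using False b b' by simp
        then have "\<not> (r = v \<and> int c = Y i v + 1)" using c by linarith
        then show ?thesis
          using True False i tab_props[of r c] unfolding b' fun_upd_other[OF False[unfolded b']]
          by (intro g'.tab_eqI) (auto simp: gt_entry_add simp del: gt_entry_Suc)
      qed
    next
      case False
      then show ?thesis using box tab_outside g'.tab_outside by auto
    qed
  qed
qed

text \<open>
  Removing the last box of row \<open>v\<close> from the diagram of entries larger than \<open>i\<close> turns the rightmost
  entry \<open>i + 1\<close> of that row into \<open>i\<close>.
\<close>

lemma psi_lower:
  assumes i: "i \<in> {1..n}" and pos: "0 < gt_max n lam g i"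
    and v: "v = Max (gt_M n lam g i)" and b: "b = (v, nat (Y i v))"
  shows "b \<in> boxes n lam" and "psi n lam (varsigma n lam (gt_add g i v (- 1))) = T(b := i)"
proof -
  note l = lower[OF i pos v]
  interpret g': gt_pattern_of n lam "gt_add g i v (- 1)"
    using n1 dom lower_in_GT(1)[OF i pos v] by unfold_locales
  have c: "int (nat (Y i v)) = Y i v" "0 < Y i v"
    using l(4) Y_nonneg[of v "Suc i"] l(1) by auto
  have "Y i v \<le> part n lam v" using Y_antimono_row[of v 0 i] l(1) by simp
  then show box: "b \<in> boxes n lam" using l(1,4) c by (auto simp: b boxes_iff)
  show "psi n lam (varsigma n lam (gt_add g i v (- 1))) = T(b := i)"
  proof
    fix b'
    show "psi n lam (varsigma n lam (gt_add g i v (- 1))) b' = (T(b := i)) b'"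
    proof (cases "b' \<in> boxes n lam")
      case True
      obtain r c where b': "b' = (r, c)" by force
      show ?thesis
      proof (cases "b' = b")
        case bb: True
        have "Y i v \<le> Y (i - 1) v" using Y_antimono_row[of v "i - 1" i] l(1) by simp
        then show ?thesis
          using True i bb b c box unfolding bb b fun_upd_same
          by (intro g'.tab_eqI) (auto simp: gt_entry_add simp del: gt_entry_Suc)
      next
        case False
        have "\<not> (r = v \<and> c = nat (Y i v))" using False b b' by simp
        then have "\<not> (r = v \<and> int c = Y i v)" using c by linarith
        then show ?thesis
          using True False i tab_props[of r c] unfolding b' fun_upd_other[OF False[unfolded b']]
          by (intro g'.tab_eqI) (auto simp: gt_entry_add simp del: gt_entry_Suc)
      qed
    next
      case False
      then show ?thesis using box tab_outside g'.tab_outside by auto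
    qed
  qed
qed

end

text \<open>
  The flip exchanges the roles of the two operators: \<open>cf\<close> on reverse tableaux changes the last surviving
  minus of the flipped tableau, and this is the box added by raising at the first peak.
\<close>

lemma psi_crystal_iso:
  assumes n1: "1 \<le> n" and dom: "lam \<in> dominant_weights n"
  shows "crystal_iso n (psi n lam \<circ> varsigma n lam) (GT_crystal n lam) (RSSYT_crystal n lam)"
  unfolding crystal_iso_def
proof (intro conjI ballI)
  show "bij_betw (psi n lam \<circ> varsigma n lam) (cset (GT_crystal n lam)) (cset (RSSYT_crystal n lam))"
    using bij_betw_psi_varsigma[OF assms] by (simp add: GT_crystal_def RSSYT_crystal_def)
next
  let ?h = "psi n lam \<circ> varsigma n lam"
  fix g assume "g \<in> cset (GT_crystal n lam)"
  then interpret gt_pattern_of n lam g using assms by unfold_locales (simp_all add: GT_crystal_def)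
  show "cwt (RSSYT_crystal n lam) (?h g) = cwt (GT_crystal n lam) g"
    by (simp add: GT_crystal_def RSSYT_crystal_def tab_wt_eq_gt_wt)
  fix i assume i: "i \<in> {1..n}"
  have h: "?h g = T" by simp
  show "ceps (RSSYT_crystal n lam) i (?h g) = ceps (GT_crystal n lam) i g"
    unfolding h using length_pluses_flip[OF i]
    by (simp add: GT_crystal_def RSSYT_crystal_def SSYT_crystal_def)
  show "cphi (RSSYT_crystal n lam) i (?h g) = cphi (GT_crystal n lam) i g"
    unfolding h using length_minuses_flip[OF i] coroot_pairing_gt_wt[OF triangular i, of lam]
    by (simp add: GT_crystal_def RSSYT_crystal_def SSYT_crystal_def)
  have unflip: "inv_into (RSSYT n lam) (flip n lam) (flip n lam S) = S" if "S \<in> RSSYT n lam" for S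
    using inj_on_flip that by (rule inv_into_f_f)
  have in_RSSYT: "psi n lam (varsigma n lam g') \<in> RSSYT n lam" if "g' \<in> GT n lam" for g'
    using that gt_pattern_of.tab_in_RSSYT gt_pattern_of.intro[OF n1 dom] by blast
  show "cf (RSSYT_crystal n lam) i (?h g) = map_option ?h (cf (GT_crystal n lam) i g)"
  proof (cases "gt_sigma n lam g i 0 < gt_max n lam g i")
    case True
    define v b where v: "v = Min (gt_M n lam g i)" and b: "b = (v, Suc (nat (Y i v)))"
    note p = psi_raise[OF i True v b]
    have "(flip n lam T)(b := n + 1 - i) = flip n lam (T(b := Suc i))"
      using p(1) by (auto simp: flip_def fun_eq_iff)
    also have "\<dots> = flip n lam (?h (gt_add g i v 1))" using p(2) by simp
    finally show ?thesis
      using last_minuses_flip[OF i True v] True unflip[OF in_RSSYT[OF raise_in_GT(1)[OF i True v]]]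
      unfolding h by (simp add: GT_crystal_def RSSYT_crystal_def SSYT_crystal_def b v[symmetric])
  next
    case False
    moreover have "gt_sigma n lam g i 0 \<le> gt_max n lam g i"
      using i by (intro sigma_le_gt_max) auto
    ultimately have "length (minuses n lam (n + 1 - i) (flip n lam T)) = 0"
      using length_minuses_flip[OF i] by linarith
    then have "minuses n lam (n + 1 - i) (flip n lam T) = []"
      by simp
    then show ?thesis
      using False unfolding h by (simp add: GT_crystal_def RSSYT_crystal_def SSYT_crystal_def)
  qed
  show "ce (RSSYT_crystal n lam) i (?h g) = map_option ?h (ce (GT_crystal n lam) i g)"
  proof (cases "0 < gt_max n lam g i")
    case True
    define v b where v: "v = Max (gt_M n lam g i)" and b: "b = (v, nat (Y i v))"
    note p = psi_lower[OF i True v b]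
    have "(flip n lam T)(b := n + 1 - i + 1) = flip n lam (T(b := i))"
      using p(1) i by (auto simp: flip_def fun_eq_iff)
    also have "\<dots> = flip n lam (?h (gt_add g i v (- 1)))" using p(2) by simp
    finally show ?thesis
      using hd_pluses_flip[OF i True v] True unflip[OF in_RSSYT[OF lower_in_GT(1)[OF i True v]]]
      unfolding h by (simp add: GT_crystal_def RSSYT_crystal_def SSYT_crystal_def b v[symmetric])
  next
    case False
    then have "length (pluses n lam (n + 1 - i) (flip n lam T)) = 0"
      using length_pluses_flip[OF i] by linarith
    then have "pluses n lam (n + 1 - i) (flip n lam T) = []"
      by simp
    then show ?thesis
      using False unfolding h by (simp add: GT_crystal_def RSSYT_crystal_def SSYT_crystal_def)
  qed
qed

section \<open>Transport to Gelfand--Tsetlin patterns\<close>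

theorem theorem4p1:
  fixes n :: nat and lam :: weight
  assumes "n \<ge> 1" and "lam \<in> dominant_weights n"
  shows
    "bij_betw (varsigma n lam) (GT n lam) (Sigma_set n lam) \<and>
     bij_betw (psi n lam) (Sigma_set n lam) (RSSYT n lam) \<and>
     is_crystal n (Sigma_crystal n lam) \<and>
     is_crystal n (RSSYT_crystal n lam) \<and>
     (\<forall>C \<in> {transport (varsigma n lam) (GT n lam) (Sigma_crystal n lam),
             transport (psi n lam \<circ> varsigma n lam) (GT n lam) (RSSYT_crystal n lam)}.
        is_crystal n C \<and>
        (\<forall>g \<in> GT n lam.
          cwt C g = (\<Sum>i = 1..n + 1. \<Sum>j = 1..n + 2 - i.
            wscale (gt_entry n lam g (i - 1) j - gt_entry n lam g i j) (eps n i)) \<and>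
          (\<forall>i \<in> {1..n}.
            ceps C i g = Fin (gt_max n lam g i) \<and>
            cphi C i g = Fin (coroot_pairing i (cwt C g)) + ceps C i g \<and>
            cf C i g =
              (if gt_max n lam g i > gt_sigma n lam g i 0
               then Some (gt_add g i (Min (gt_M n lam g i)) 1) else None) \<and>
            ce C i g =
              (if gt_max n lam g i > 0
               then Some (gt_add g i (Max (gt_M n lam g i)) (- 1)) else None))))"
proof -
  let ?GT = "GT_crystal n lam"
  note iso = varsigma_crystal_iso[OF assms] psi_crystal_iso[OF assms]
  have bij: "bij_betw (varsigma n lam) (GT n lam) (Sigma_set n lam)"
    "bij_betw (psi n lam \<circ> varsigma n lam) (GT n lam) (RSSYT n lam)"
    using bij_betw_varsigma[OF assms] bij_betw_psi_varsigma[OF assms] .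
  have crystal: "is_crystal n ?GT" by (rule is_crystal_GT[OF assms])
  have cset: "cset ?GT = GT n lam" by (simp add: GT_crystal_def)
  have transported: "is_crystal n C \<and>
      (\<forall>g \<in> GT n lam.
        cwt C g = (\<Sum>i = 1..n + 1. \<Sum>j = 1..n + 2 - i.
          wscale (gt_entry n lam g (i - 1) j - gt_entry n lam g i j) (eps n i)) \<and>
        (\<forall>i \<in> {1..n}.
          ceps C i g = Fin (gt_max n lam g i) \<and>
          cphi C i g = Fin (coroot_pairing i (cwt C g)) + ceps C i g \<and>
          cf C i g =
            (if gt_max n lam g i > gt_sigma n lam g i 0
             then Some (gt_add g i (Min (gt_M n lam g i)) 1) else None) \<and>
          ce C i g =
            (if gt_max n lam g i > 0
             then Some (gt_add g i (Max (gt_M n lam g i)) (- 1)) else None)))"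
    if C: "C = transport h (GT n lam) D" and iso: "crystal_iso n h ?GT D" for C D h
  proof (intro conjI ballI)
    show "is_crystal n C"
      using is_crystal_transport[OF crystal iso] by (simp only: C cset)
    fix g assume "g \<in> GT n lam"
    then have g: "g \<in> cset ?GT" and tri: "triangular n g"
      using cset GT_iff_interlacing[OF assms(2)] by auto
    have wt: "cwt C g = gt_wt n lam g"
      using transport_wt[OF iso g] by (simp add: C cset) (simp add: GT_crystal_def)
    show "cwt C g = (\<Sum>i = 1..n + 1. \<Sum>j = 1..n + 2 - i.
          wscale (gt_entry n lam g (i - 1) j - gt_entry n lam g i j) (eps n i))"
      unfolding wt by (rule gt_wt_eq[OF tri])
    fix i assume i: "i \<in> {1..n}"
    note transport = transport_iso[OF crystal iso g i, unfolded cset, folded C]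
    show "ceps C i g = Fin (gt_max n lam g i)"
      "cphi C i g = Fin (coroot_pairing i (cwt C g)) + ceps C i g"
      "cf C i g =
            (if gt_max n lam g i > gt_sigma n lam g i 0
             then Some (gt_add g i (Min (gt_M n lam g i)) 1) else None)"
      "ce C i g =
            (if gt_max n lam g i > 0
             then Some (gt_add g i (Max (gt_M n lam g i)) (- 1)) else None)"
      unfolding transport wt by (simp_all add: GT_crystal_def)
  qed
  have "bij_betw (psi n lam) (Sigma_set n lam) (RSSYT n lam)"
    using bij_betw_comp_iff[OF bij(1)] bij(2) by blast
  moreover have "is_crystal n (Sigma_crystal n lam)" "is_crystal n (RSSYT_crystal n lam)"
    using is_crystal_iso[OF crystal] iso by blast+
  ultimately show ?thesis
    using bij(1) transported[OF refl iso(1)] transported[OF refl iso(2)] by blast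
qed

end
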